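(* Let $R$ be an associative ring with identity and let $A$ be a coneat quasi injective left $R$-module. Then the endomorphism ring $\operatorname{End}(A)$ is von Neumann regular and self injective modulo its Jacobson radical; that is, the quotient of $\operatorname{End}(A)$ by its Jacobson radical is von Neumann regular and self injective.
   Context: Modules are left unital $R$-modules. A submodule $K\subseteq B$ is coneat if the sequence $0\to K\hookrightarrow B\to B/K\to 0$ remains exact when tensored with any simple right $R$-module. A module $M$ is coneat injective if it is injective with respect to all coneat exact sequences, i.e. for every coneat submodule $K\subseteq B$ every homomorphism $K\to M$ extends to $B$. Every module $M$ has a coneat injective envelope $\operatorname{CE}(M)$, unique up to isomorphism: a coneat injective module containing $M$ as a coneat submodule, such that every homomorphism from $M$ to a coneat injective module extends to $\operatorname{CE}(M)$, and every endomorphism of $\operatorname{CE}(M)$ restricting to the identity on $M$ is an automorphism. A module $M$ is coneat quasi injective if it is fully invariant in its coneat injective envelope, i.e. $f(M)\subseteq M$ for every endomorphism $f$ of $\operatorname{CE}(M)$. A ring is self injective if it is injective as a module over itself. *)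

theory Defs
  imports "HOL-Algebra.Algebra"
begin

section \<open>Modules over a non-commutative ring\<close>

text \<open>
  The locale \<open>module\<close> of the library requires a commutative ring, so one-sided modules are
  introduced here on the library record \<open>module\<close> (whose fields \<open>mult\<close> and \<open>one\<close> are ignored).
  The library locale \<open>submodule\<close> does not depend on commutativity and is used as it is.
\<close>

locale left_module = R?: ring R + M?: abelian_group M
    for R :: "'r ring" and M :: "('r, 'm) module" (structure) +
  assumes smult_closed [simp, intro]:
      "\<lbrakk>a \<in> carrier R; x \<in> carrier M\<rbrakk> \<Longrightarrow> a \<odot>\<^bsub>M\<^esub> x \<in> carrier M"
    and smult_l_distr:
      "\<lbrakk>a \<in> carrier R; b \<in> carrier R; x \<in> carrier M\<rbrakk> \<Longrightarrow>
        (a \<oplus>\<^bsub>R\<^esub> b) \<odot>\<^bsub>M\<^esub> x = a \<odot>\<^bsub>M\<^esub> x \<oplus>\<^bsub>M\<^esub> b \<odot>\<^bsub>M\<^esub> x"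
    and smult_r_distr:
      "\<lbrakk>a \<in> carrier R; x \<in> carrier M; y \<in> carrier M\<rbrakk> \<Longrightarrow>
        a \<odot>\<^bsub>M\<^esub> (x \<oplus>\<^bsub>M\<^esub> y) = a \<odot>\<^bsub>M\<^esub> x \<oplus>\<^bsub>M\<^esub> a \<odot>\<^bsub>M\<^esub> y"
    and smult_assoc:
      "\<lbrakk>a \<in> carrier R; b \<in> carrier R; x \<in> carrier M\<rbrakk> \<Longrightarrow>
        (a \<otimes>\<^bsub>R\<^esub> b) \<odot>\<^bsub>M\<^esub> x = a \<odot>\<^bsub>M\<^esub> (b \<odot>\<^bsub>M\<^esub> x)"
    and smult_one [simp]: "x \<in> carrier M \<Longrightarrow> \<one>\<^bsub>R\<^esub> \<odot>\<^bsub>M\<^esub> x = x"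

definition opposite_ring :: "'r ring \<Rightarrow> 'r ring" where
  "opposite_ring R = R\<lparr>monoid.mult := \<lambda>x y. y \<otimes>\<^bsub>R\<^esub> x\<rparr>"

text \<open>A right module \<open>S\<close> is a left module over the opposite ring: \<open>r \<odot>\<^bsub>S\<^esub> s\<close> stands for \<open>s\<cdot>r\<close>.\<close>

abbreviation right_module :: "'r ring \<Rightarrow> ('r, 's) module \<Rightarrow> bool" where
  "right_module R S \<equiv> left_module (opposite_ring R) S"

definition simple_right_module :: "'r ring \<Rightarrow> ('r, 's) module \<Rightarrow> bool" where
  "simple_right_module R S \<longleftrightarrow>
     right_module R S \<and> carrier S \<noteq> {\<zero>\<^bsub>S\<^esub>} \<and>
     (\<forall>N. submodule N (opposite_ring R) S \<longrightarrow> N = {\<zero>\<^bsub>S\<^esub>} \<or> N = carrier S)"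

definition module_homs :: "'r ring \<Rightarrow> ('r, 'm) module \<Rightarrow> ('r, 'n) module \<Rightarrow> ('m \<Rightarrow> 'n) set" where
  "module_homs R M N =
     {f \<in> hom (add_monoid M) (add_monoid N).
        \<forall>r\<in>carrier R. \<forall>x\<in>carrier M. f (r \<odot>\<^bsub>M\<^esub> x) = r \<odot>\<^bsub>N\<^esub> f x}"

definition regular_module :: "'r ring \<Rightarrow> ('r, 'r) module" where
  "regular_module R =
     \<lparr>carrier = carrier R, monoid.mult = monoid.mult R, monoid.one = \<one>\<^bsub>R\<^esub>,
      ring.zero = \<zero>\<^bsub>R\<^esub>, ring.add = ring.add R, smult = monoid.mult R\<rparr>"

definition quotient_module :: "('r, 'm) module \<Rightarrow> 'm set \<Rightarrow> ('r, 'm set) module" where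
  "quotient_module B K =
     \<lparr>carrier = a_rcosets\<^bsub>B\<^esub> K, monoid.mult = undefined, monoid.one = undefined, ring.zero = K,
      ring.add = set_add B, smult = (\<lambda>r C. \<Union>x\<in>C. K +>\<^bsub>B\<^esub> (r \<odot>\<^bsub>B\<^esub> x))\<rparr>"


section \<open>Tensor products and coneat submodules\<close>

text \<open>
  \<open>S \<otimes>\<^sub>R M\<close> for a right module \<open>S\<close> and a left module \<open>M\<close> is the free abelian group on
  \<open>carrier S \<times> carrier M\<close> modulo the usual relations.
\<close>

definition tensor_relations ::
    "'r ring \<Rightarrow> ('r, 's) module \<Rightarrow> ('r, 'm) module \<Rightarrow> ('s \<times> 'm \<Rightarrow>\<^sub>0 int) set" where
  "tensor_relations R S M = generate (free_Abelian_group (carrier S \<times> carrier M))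
    ({frag_of (s \<oplus>\<^bsub>S\<^esub> t, x) - frag_of (s, x) - frag_of (t, x) | s t x.
        s \<in> carrier S \<and> t \<in> carrier S \<and> x \<in> carrier M} \<union>
     {frag_of (s, x \<oplus>\<^bsub>M\<^esub> y) - frag_of (s, x) - frag_of (s, y) | s x y.
        s \<in> carrier S \<and> x \<in> carrier M \<and> y \<in> carrier M} \<union>
     {frag_of (r \<odot>\<^bsub>S\<^esub> s, x) - frag_of (s, r \<odot>\<^bsub>M\<^esub> x) | r s x.
        r \<in> carrier R \<and> s \<in> carrier S \<and> x \<in> carrier M})"

definition tensor ::
    "'r ring \<Rightarrow> ('r, 's) module \<Rightarrow> ('r, 'm) module \<Rightarrow> ('s \<times> 'm \<Rightarrow>\<^sub>0 int) set monoid" where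
  "tensor R S M = free_Abelian_group (carrier S \<times> carrier M) Mod tensor_relations R S M"

text \<open>The map \<open>id\<^sub>S \<otimes> f : S \<otimes>\<^sub>R M \<rightarrow> S \<otimes>\<^sub>R N\<close> induced by \<open>f : M \<rightarrow> N\<close>.\<close>

definition tensor_map ::
    "'r ring \<Rightarrow> ('r, 's) module \<Rightarrow> ('r, 'n) module \<Rightarrow> ('m \<Rightarrow> 'n) \<Rightarrow>
     ('s \<times> 'm \<Rightarrow>\<^sub>0 int) set \<Rightarrow> ('s \<times> 'n \<Rightarrow>\<^sub>0 int) set" where
  "tensor_map R S N f C =
     (\<Union>c\<in>C. tensor_relations R S N #>\<^bsub>free_Abelian_group (carrier S \<times> carrier N)\<^esub>
              frag_extend (\<lambda>(s, x). frag_of (s, f x)) c)"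

text \<open>
  Exactness of \<open>0 \<rightarrow> G1 \<rightarrow> G2 \<rightarrow> G3 \<rightarrow> 0\<close>; the library notion \<open>exact_seq\<close> requires all groups to have
  the same element type.
\<close>

definition short_exact ::
    "'a monoid \<Rightarrow> 'b monoid \<Rightarrow> 'c monoid \<Rightarrow> ('a \<Rightarrow> 'b) \<Rightarrow> ('b \<Rightarrow> 'c) \<Rightarrow> bool" where
  "short_exact G1 G2 G3 f g \<longleftrightarrow>
     f \<in> mon G1 G2 \<and> g \<in> epi G2 G3 \<and> f ` carrier G1 = kernel G2 G3 g"

text \<open>
  It suffices to let \<open>S\<close> range over modules with elements of type \<open>'r set\<close>: every simple right module
  is isomorphic to \<open>R/I\<close> for a maximal right ideal \<open>I\<close>, and the elements of \<open>R/I\<close> are subsets of \<open>R\<close>.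
\<close>

definition coneat_submodule :: "'r ring \<Rightarrow> 'm set \<Rightarrow> ('r, 'm) module \<Rightarrow> bool" where
  "coneat_submodule R K B \<longleftrightarrow>
     submodule K R B \<and>
     (\<forall>S :: ('r, 'r set) module. simple_right_module R S \<longrightarrow>
        short_exact (tensor R S (B\<lparr>carrier := K\<rparr>)) (tensor R S B) (tensor R S (quotient_module B K))
          (tensor_map R S B (\<lambda>x. x)) (tensor_map R S (quotient_module B K) (\<lambda>x. K +>\<^bsub>B\<^esub> x)))"


section \<open>Coneat injective and coneat quasi injective modules\<close>

text \<open>
  A definition cannot quantify over the element type of \<open>B\<close>, so \<open>B\<close> ranges over the modules with
  elements of type \<open>('r, 'm) test\<close>. This type is large enough for the definition to agree with the
  unrestricted one. Indeed let \<open>\<kappa>\<close> be the cardinality of \<open>'r \<times> 'm \<times> nat\<close>, so that \<open>('r, 'm) test\<close> has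
  \<open>2\<^bsup>2\<^bsup>\<kappa>\<^esup>\<^esup>\<close> elements. Pushing out along \<open>K \<rightarrow> M\<close>, it is enough to split every coneat inclusion \<open>M \<subseteq> P\<close>.
  By Zorn's lemma choose a submodule \<open>N\<close> of \<open>P\<close> that is maximal with \<open>N \<inter> M = 0\<close> and \<open>M\<close> coneat in
  \<open>P/N\<close>. With \<open>(-)\<^sup>+ = Hom\<^sub>\<int>(-, \<rat>/\<int>)\<close>, the module \<open>M\<close> is a coneat submodule of the coneat injective
  module \<open>G = (\<Prod>\<^bsub>Hom(M,R\<^sup>+)\<^esub> R\<^sup>+) \<times> (\<Prod>\<^bsub>S simple\<^esub> \<Prod>\<^bsub>Hom(M,S\<^sup>+)\<^esub> S\<^sup>+)\<close>, which has at most \<open>2\<^bsup>2\<^bsup>\<kappa>\<^esup>\<^esup>\<close>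
  elements. The inclusion \<open>M \<subseteq> G\<close> extends to \<open>P/N \<rightarrow> G\<close>, which is injective by maximality of \<open>N\<close>.
  Hence \<open>P/N\<close> is isomorphic to one of the test modules, \<open>M\<close> is a direct summand of \<open>P/N\<close>, and therefore
  of \<open>P\<close>.
\<close>

type_synonym ('r, 'm) test = "('r \<times> 'm \<times> nat) set set"

definition coneat_injective :: "'r ring \<Rightarrow> ('r, 'm) module \<Rightarrow> bool" where
  "coneat_injective R M \<longleftrightarrow>
     left_module R M \<and>
     (\<forall>(B :: ('r, ('r, 'm) test) module) K.
        left_module R B \<and> coneat_submodule R K B \<longrightarrow>
        (\<forall>f \<in> module_homs R (B\<lparr>carrier := K\<rparr>) M. \<exists>g \<in> module_homs R B M. \<forall>x\<in>K. g x = f x))"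

text \<open>
  \<open>E\<close> is a coneat injective envelope of \<open>M\<close> along the embedding \<open>u\<close>. Since \<open>u ` carrier M\<close> is a coneat
  submodule of \<open>E\<close>, the extension property holds for coneat injective \<open>F\<close> of every element type, so
  stating it for \<open>F\<close> of type \<open>('r, 'e) module\<close> loses nothing.
\<close>

definition coneat_injective_envelope ::
    "'r ring \<Rightarrow> ('r, 'm) module \<Rightarrow> ('r, 'e) module \<Rightarrow> ('m \<Rightarrow> 'e) \<Rightarrow> bool" where
  "coneat_injective_envelope R M E u \<longleftrightarrow>
     coneat_injective R E \<and>
     u \<in> module_homs R M E \<and> inj_on u (carrier M) \<and> coneat_submodule R (u ` carrier M) E \<and>
     (\<forall>F :: ('r, 'e) module. coneat_injective R F \<longrightarrow>
        (\<forall>g \<in> module_homs R M F. \<exists>h \<in> module_homs R E F. \<forall>x\<in>carrier M. h (u x) = g x)) \<and>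
     (\<forall>h \<in> module_homs R E E.
        (\<forall>x\<in>carrier M. h (u x) = u x) \<longrightarrow> bij_betw h (carrier E) (carrier E))"

text \<open>
  The type argument is the element type of the envelope. Envelopes are unique up to isomorphism, so
  apart from the availability of an envelope with elements of type \<open>'e\<close> the choice of \<open>'e\<close> is irrelevant.
\<close>

definition coneat_quasi_injective :: "'e itself \<Rightarrow> 'r ring \<Rightarrow> ('r, 'm) module \<Rightarrow> bool" where
  "coneat_quasi_injective (_ :: 'e itself) R M \<longleftrightarrow>
     left_module R M \<and>
     (\<exists>(E :: ('r, 'e) module) u. coneat_injective_envelope R M E u \<and>
        (\<forall>f \<in> module_homs R E E. f ` (u ` carrier M) \<subseteq> u ` carrier M))"


section \<open>Endomorphism rings, Jacobson radical, regularity and self-injectivity\<close>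

text \<open>Endomorphisms are written on the left: the product \<open>f g\<close> is \<open>x \<mapsto> f (g x)\<close>.\<close>

definition endo_ring :: "'r ring \<Rightarrow> ('r, 'm) module \<Rightarrow> ('m \<Rightarrow> 'm) ring" where
  "endo_ring R M =
     \<lparr>carrier = module_homs R M M \<inter> extensional (carrier M),
      monoid.mult = compose (carrier M), monoid.one = (\<lambda>x\<in>carrier M. x),
      ring.zero = (\<lambda>x\<in>carrier M. \<zero>\<^bsub>M\<^esub>), ring.add = (\<lambda>f g. \<lambda>x\<in>carrier M. f x \<oplus>\<^bsub>M\<^esub> g x)\<rparr>"

definition maximal_left_ideal :: "'s set \<Rightarrow> 's ring \<Rightarrow> bool" where
  "maximal_left_ideal I S \<longleftrightarrow>
     submodule I S (regular_module S) \<and> I \<noteq> carrier S \<and>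
     (\<forall>L. submodule L S (regular_module S) \<and> I \<subseteq> L \<longrightarrow> L = I \<or> L = carrier S)"

definition jacobson_radical :: "'s ring \<Rightarrow> 's set" where
  "jacobson_radical S = carrier S \<inter> \<Inter>{I. maximal_left_ideal I S}"

definition von_neumann_regular :: "'s ring \<Rightarrow> bool" where
  "von_neumann_regular S \<longleftrightarrow>
     ring S \<and> (\<forall>a\<in>carrier S. \<exists>b\<in>carrier S. a \<otimes>\<^bsub>S\<^esub> b \<otimes>\<^bsub>S\<^esub> a = a)"

text \<open>The type argument is the element type of the modules \<open>B\<close> against which injectivity is tested.\<close>

definition injective_module :: "'b itself \<Rightarrow> 'r ring \<Rightarrow> ('r, 'm) module \<Rightarrow> bool" where
  "injective_module (_ :: 'b itself) R M \<longleftrightarrow>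
     left_module R M \<and>
     (\<forall>(B :: ('r, 'b) module) K.
        left_module R B \<and> submodule K R B \<longrightarrow>
        (\<forall>f \<in> module_homs R (B\<lparr>carrier := K\<rparr>) M. \<exists>g \<in> module_homs R B M. \<forall>x\<in>K. g x = f x))"

text \<open>
  \<open>S\<close> is injective as a right module over itself. For endomorphism rings with endomorphisms written on
  the left this is the relevant side: the endomorphism ring of an infinite-dimensional vector space is
  right but not left self-injective. If endomorphisms of left modules are written on the right, the
  endomorphism ring is replaced by its opposite and the condition becomes left self-injectivity.
\<close>

definition right_self_injective :: "'b itself \<Rightarrow> 's ring \<Rightarrow> bool" where
  "right_self_injective T S \<longleftrightarrow>
     injective_module T (opposite_ring S) (regular_module (opposite_ring S))"

end

theory Submission
  imports Defs
begin

text \<open>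
  Let \<open>S = End(A)\<close>. Locally split submodules are coneat, so every coneat injective module \<open>E\<close> admits
  linear generalised limits: a function that picks, for every \<open>E\<close>-valued function on a filtered index
  set, an element of \<open>E\<close>, linearly and with the right value on eventually constant functions. Applied
  to approximate solutions, and because \<open>A\<close> is fully invariant in its envelope, this shows that \<open>S\<close> is
  compact with respect to the cosets of the left ideals \<open>Sa\<close> and \<open>{s. sa = 0}\<close>: a family of such cosets
  with the finite intersection property has a common element.

  The theorem holds for every ring with this property. Minimal supplements of left ideals exist by
  Zorn's lemma; they give regularity modulo the radical, and pairs of mutual supplements give
  idempotents in every right ideal outside the radical. For self-injectivity, Baer's criterion reduces
  the problem to a homomorphism \<open>\<phi>\<close> from a right ideal of \<open>S/J\<close> to \<open>S/J\<close>, and compactness produces the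
  required left multiplication from its values on a maximal independent family of idempotents.
\<close>

section \<open>Modules and coneat submodules\<close>

text \<open>Two obstacles shape the argument. The first is size: coneat injectivity of E is tested
  only on modules whose elements have the test type over \<open>'e\<close>. A limit over an index
  type \<open>'i\<close> lives on a power of E, so the functions from \<open>'i\<close> to
  \<open>'e\<close> must inject into that test type. Endomorphisms of A are therefore indexed by
  functions from \<open>'e\<close> to \<open>'e\<close>, read through the embedding of A into E.
  Locally split submodules are coneat because a tensor involves only finitely many elements. The
  second is that compactness concerns S, while \<open>\<phi>\<close> is defined modulo J. Its values
  are lifted and the equations \<open>x e = a\<close> are posed exactly in S. Independence modulo J
  is sharpened to independence in S, using that \<open>1 - j\<close> has a left inverse for j in J.
  Both kinds of cosets have a task: those of \<open>Sa\<close> give supplements of principal left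
  ideals, annihilators turn a supplement into an idempotent, and the sets of all x with
  \<open>x e = a\<close> interpolate \<open>\<phi>\<close>.\<close>

lemma carrier_opposite_ring [simp]: "carrier (opposite_ring R) = carrier R"
  by (simp add: opposite_ring_def)

lemma module_homsI:
  assumes "\<And>x. x \<in> carrier M \<Longrightarrow> f x \<in> carrier N"
    and "\<And>x y. \<lbrakk>x \<in> carrier M; y \<in> carrier M\<rbrakk> \<Longrightarrow> f (x \<oplus>\<^bsub>M\<^esub> y) = f x \<oplus>\<^bsub>N\<^esub> f y"
    and "\<And>r x. \<lbrakk>r \<in> carrier R; x \<in> carrier M\<rbrakk> \<Longrightarrow> f (r \<odot>\<^bsub>M\<^esub> x) = r \<odot>\<^bsub>N\<^esub> f x"
  shows "f \<in> module_homs R M N"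
  using assms by (auto simp: module_homs_def hom_def)

lemma module_homsD:
  assumes "f \<in> module_homs R M N"
  shows module_homs_closed: "x \<in> carrier M \<Longrightarrow> f x \<in> carrier N"
    and module_homs_add: "\<lbrakk>x \<in> carrier M; y \<in> carrier M\<rbrakk> \<Longrightarrow> f (x \<oplus>\<^bsub>M\<^esub> y) = f x \<oplus>\<^bsub>N\<^esub> f y"
    and module_homs_smult: "\<lbrakk>r \<in> carrier R; x \<in> carrier M\<rbrakk> \<Longrightarrow> f (r \<odot>\<^bsub>M\<^esub> x) = r \<odot>\<^bsub>N\<^esub> f x"
  using assms by (auto simp: module_homs_def hom_def)

lemma left_module_submodule:
  assumes "left_module R B" "submodule K R B"
  shows "left_module R (B\<lparr>carrier := K\<rparr>)"
proof -
  interpret B: left_module R B by fact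
  interpret K: submodule K R B by fact
  interpret A: additive_subgroup K B by (intro additive_subgroup.intro K.subgroup_axioms)
  have ab: "abelian_group (B\<lparr>carrier := K\<rparr>)"
    by (rule abelian_groupI)
      (auto simp: B.a_ac B.r_neg intro!: bexI[where x = "\<ominus>\<^bsub>B\<^esub> _"])
  show ?thesis
    using K.subset
    by (intro left_module.intro left_module_axioms.intro B.R.ring_axioms ab)
      (auto simp: B.smult_l_distr B.smult_r_distr B.smult_assoc subset_iff)
qed


context left_module
begin

lemma smult_zero_left [simp]:
  assumes "x \<in> carrier M"
  shows "\<zero>\<^bsub>R\<^esub> \<odot>\<^bsub>M\<^esub> x = \<zero>\<^bsub>M\<^esub>"
proof -
  have "\<zero>\<^bsub>R\<^esub> \<odot>\<^bsub>M\<^esub> x \<oplus>\<^bsub>M\<^esub> \<zero>\<^bsub>R\<^esub> \<odot>\<^bsub>M\<^esub> x = \<zero>\<^bsub>R\<^esub> \<odot>\<^bsub>M\<^esub> x"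
    using smult_l_distr[of "\<zero>\<^bsub>R\<^esub>" "\<zero>\<^bsub>R\<^esub>" x] assms by simp
  then show ?thesis using M.add.l_cancel_one' assms by (metis R.zero_closed smult_closed)
qed

lemma smult_zero_right [simp]:
  assumes "r \<in> carrier R"
  shows "r \<odot>\<^bsub>M\<^esub> \<zero>\<^bsub>M\<^esub> = \<zero>\<^bsub>M\<^esub>"
proof -
  have "r \<odot>\<^bsub>M\<^esub> \<zero>\<^bsub>M\<^esub> \<oplus>\<^bsub>M\<^esub> r \<odot>\<^bsub>M\<^esub> \<zero>\<^bsub>M\<^esub> = r \<odot>\<^bsub>M\<^esub> \<zero>\<^bsub>M\<^esub>"
    using smult_r_distr[of r "\<zero>\<^bsub>M\<^esub>" "\<zero>\<^bsub>M\<^esub>"] assms by simp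
  then show ?thesis using M.add.l_cancel_one' assms by (metis M.zero_closed smult_closed)
qed

lemma smult_minus_one:
  assumes "x \<in> carrier M"
  shows "(\<ominus>\<^bsub>R\<^esub> \<one>\<^bsub>R\<^esub>) \<odot>\<^bsub>M\<^esub> x = \<ominus>\<^bsub>M\<^esub> x"
proof -
  have "(\<ominus>\<^bsub>R\<^esub> \<one>\<^bsub>R\<^esub>) \<odot>\<^bsub>M\<^esub> x \<oplus>\<^bsub>M\<^esub> x = \<zero>\<^bsub>M\<^esub>"
    using smult_l_distr[of "\<ominus>\<^bsub>R\<^esub> \<one>\<^bsub>R\<^esub>" "\<one>\<^bsub>R\<^esub>" x] assms by (simp add: R.l_neg)
  then show ?thesis using assms by (intro M.minus_equality[symmetric]) auto
qed

lemma submoduleI: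
  assumes "H \<subseteq> carrier M" "\<zero>\<^bsub>M\<^esub> \<in> H"
    and "\<And>a b. \<lbrakk>a \<in> H; b \<in> H\<rbrakk> \<Longrightarrow> a \<oplus>\<^bsub>M\<^esub> b \<in> H"
    and smult: "\<And>r a. \<lbrakk>r \<in> carrier R; a \<in> H\<rbrakk> \<Longrightarrow> r \<odot>\<^bsub>M\<^esub> a \<in> H"
  shows "submodule H R M"
proof -
  have "\<ominus>\<^bsub>M\<^esub> a \<in> H" if "a \<in> H" for a
    using smult[of "\<ominus>\<^bsub>R\<^esub> \<one>\<^bsub>R\<^esub>" a] that assms(1) smult_minus_one[of a] by auto
  then have "subgroup H (add_monoid M)"
    using assms by (intro M.add.subgroupI) (auto simp: a_inv_def)
  then show ?thesis
    using smult by (intro submodule.intro submodule_axioms.intro) auto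
qed

end

lemma left_module_regular:
  assumes "ring T"
  shows "left_module T (regular_module T)"
proof -
  interpret T: ring T by fact
  have "abelian_group (regular_module T)"
    by (rule abelian_groupI)
      (auto simp: regular_module_def T.a_ac intro!: bexI[of _ "\<ominus>\<^bsub>T\<^esub> _"] T.l_neg)
  then show ?thesis
    by (intro left_module.intro left_module_axioms.intro assms)
      (auto simp: regular_module_def T.l_distr T.r_distr T.m_assoc)
qed

subsection \<open>Tensor products\<close>

text \<open>The generating set inside \<open>tensor_relations\<close>, named so that the definition
  can be folded and the generators treated on their own.\<close>

definition tensor_relators ::
    "'r ring \<Rightarrow> ('r, 's) module \<Rightarrow> ('r, 'm) module \<Rightarrow> ('s \<times> 'm \<Rightarrow>\<^sub>0 int) set" where
  "tensor_relators R S M =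
    {frag_of (s \<oplus>\<^bsub>S\<^esub> t, x) - frag_of (s, x) - frag_of (t, x) | s t x.
        s \<in> carrier S \<and> t \<in> carrier S \<and> x \<in> carrier M} \<union>
     {frag_of (s, x \<oplus>\<^bsub>M\<^esub> y) - frag_of (s, x) - frag_of (s, y) | s x y.
        s \<in> carrier S \<and> x \<in> carrier M \<and> y \<in> carrier M} \<union>
     {frag_of (r \<odot>\<^bsub>S\<^esub> s, x) - frag_of (s, r \<odot>\<^bsub>M\<^esub> x) | r s x.
        r \<in> carrier R \<and> s \<in> carrier S \<and> x \<in> carrier M}"

lemma keys_diff_subset: "Poly_Mapping.keys a \<subseteq> U \<Longrightarrow> Poly_Mapping.keys b \<subseteq> U \<Longrightarrow> Poly_Mapping.keys (a - b) \<subseteq> U"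
  for a b :: "'x \<Rightarrow>\<^sub>0 int"
  using keys_diff[of a b] by blast

lemma carrier_free_Abelian_group_eq: "carrier (free_Abelian_group U) = {c. Poly_Mapping.keys c \<subseteq> U}"
  by (auto simp: carrier_free_Abelian_group_iff)

context
  fixes R :: "'r ring" and S :: "('r, 's) module" and M :: "('r, 'm) module"
  assumes S: "right_module R S" and M: "left_module R M"
begin

interpretation S: left_module "opposite_ring R" S by (rule S)
interpretation M: left_module R M by (rule M)

lemma tensor_relators_carrier:
  "tensor_relators R S M \<subseteq> carrier (free_Abelian_group (carrier S \<times> carrier M))"
proof -
  have "r \<odot>\<^bsub>S\<^esub> s \<in> carrier S" if "r \<in> carrier R" "s \<in> carrier S" for r s
    using S.smult_closed that by simp
  then show ?thesis
    unfolding tensor_relators_def carrier_free_Abelian_group_eq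
    by (elim UnE CollectE exE conjE | intro subsetI)+ (simp_all add: keys_diff_subset)
qed

lemma tensor_relations_subgroup:
  "subgroup (tensor_relations R S M) (free_Abelian_group (carrier S \<times> carrier M))"
  unfolding tensor_relations_def tensor_relators_def[symmetric]
  by (intro group.generate_is_subgroup tensor_relators_carrier) simp

lemma tensor_relations_keys:
  "c \<in> tensor_relations R S M \<Longrightarrow> Poly_Mapping.keys c \<subseteq> carrier S \<times> carrier M"
  using subgroup.subset[OF tensor_relations_subgroup] by (auto simp: carrier_free_Abelian_group_eq)

lemma tensor_relations_zero: "0 \<in> tensor_relations R S M"
  using subgroup.one_closed[OF tensor_relations_subgroup] by simp

lemma tensor_relations_add:
  "\<lbrakk>a \<in> tensor_relations R S M; b \<in> tensor_relations R S M\<rbrakk> \<Longrightarrow> a + b \<in> tensor_relations R S M"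
  using subgroup.m_closed[OF tensor_relations_subgroup] by simp

lemma tensor_relations_minus:
  "a \<in> tensor_relations R S M \<Longrightarrow> - a \<in> tensor_relations R S M"
  using subgroup.m_inv_closed[OF tensor_relations_subgroup, of a] tensor_relations_keys[of a] by simp

lemma tensor_relations_diff:
  "\<lbrakk>a \<in> tensor_relations R S M; b \<in> tensor_relations R S M\<rbrakk> \<Longrightarrow> a - b \<in> tensor_relations R S M"
  using tensor_relations_add[of a "- b"] tensor_relations_minus[of b] by simp

lemma relators_in_relations: "c \<in> tensor_relators R S M \<Longrightarrow> c \<in> tensor_relations R S M"
  unfolding tensor_relations_def tensor_relators_def[symmetric] by (rule generate.incl)

lemma tensor_relationsI:
  "\<lbrakk>s \<in> carrier S; t \<in> carrier S; x \<in> carrier M\<rbrakk> \<Longrightarrow>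
    frag_of (s \<oplus>\<^bsub>S\<^esub> t, x) - frag_of (s, x) - frag_of (t, x) \<in> tensor_relations R S M"
  "\<lbrakk>s \<in> carrier S; x \<in> carrier M; y \<in> carrier M\<rbrakk> \<Longrightarrow>
    frag_of (s, x \<oplus>\<^bsub>M\<^esub> y) - frag_of (s, x) - frag_of (s, y) \<in> tensor_relations R S M"
  "\<lbrakk>r \<in> carrier R; s \<in> carrier S; x \<in> carrier M\<rbrakk> \<Longrightarrow>
    frag_of (r \<odot>\<^bsub>S\<^esub> s, x) - frag_of (s, r \<odot>\<^bsub>M\<^esub> x) \<in> tensor_relations R S M"
  by (rule relators_in_relations; unfold tensor_relators_def; blast)+

text \<open>Truth at 0 and stability under differences yield stability under negation and sums, so
  one closure condition serves the inverse and the product case of \<open>generate\<close>.\<close>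

lemma tensor_relations_induct [consumes 1, case_names zero diff left right balanced]:
  assumes "c \<in> tensor_relations R S M"
    and zero: "P 0"
    and diff: "\<And>a b. P a \<Longrightarrow> P b \<Longrightarrow> P (a - b)"
    and "\<And>s t x. \<lbrakk>s \<in> carrier S; t \<in> carrier S; x \<in> carrier M\<rbrakk> \<Longrightarrow>
      P (frag_of (s \<oplus>\<^bsub>S\<^esub> t, x) - frag_of (s, x) - frag_of (t, x))"
    and "\<And>s x y. \<lbrakk>s \<in> carrier S; x \<in> carrier M; y \<in> carrier M\<rbrakk> \<Longrightarrow>
      P (frag_of (s, x \<oplus>\<^bsub>M\<^esub> y) - frag_of (s, x) - frag_of (s, y))"
    and "\<And>r s x. \<lbrakk>r \<in> carrier R; s \<in> carrier S; x \<in> carrier M\<rbrakk> \<Longrightarrow>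
      P (frag_of (r \<odot>\<^bsub>S\<^esub> s, x) - frag_of (s, r \<odot>\<^bsub>M\<^esub> x))"
  shows "P c"
proof -
  have rel: "P h" if "h \<in> tensor_relators R S M" for h
    using that unfolding tensor_relators_def
    by (elim UnE CollectE exE conjE) (simp_all add: assms(4-6))
  have minus: "P (- h)" if "P h" for h
    using diff[OF zero that] by simp
  show ?thesis
    using assms(1) unfolding tensor_relations_def tensor_relators_def[symmetric]
  proof (induction rule: generate.induct)
    case (inv h)
    then show ?case using rel minus tensor_relators_carrier by auto
  next
    case (eng h1 h2)
    then show ?case using diff[OF eng.IH(1) minus[OF eng.IH(2)]] by simp
  qed (use zero rel in auto)
qed

lemma tensor_coset_eq_iff:
  assumes "Poly_Mapping.keys a \<subseteq> carrier S \<times> carrier M" "Poly_Mapping.keys b \<subseteq> carrier S \<times> carrier M"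
  shows "tensor_relations R S M #>\<^bsub>free_Abelian_group (carrier S \<times> carrier M)\<^esub> a =
      tensor_relations R S M #>\<^bsub>free_Abelian_group (carrier S \<times> carrier M)\<^esub> b
    \<longleftrightarrow> a - b \<in> tensor_relations R S M" (is "?C a = ?C b \<longleftrightarrow> _")
proof
  assume "?C a = ?C b"
  moreover have "a \<in> ?C a"
    using tensor_relations_zero by (force simp: r_coset_def)
  ultimately obtain h where "h \<in> tensor_relations R S M" "a = h + b"
    by (auto simp: r_coset_def)
  then show "a - b \<in> tensor_relations R S M" by simp
next
  assume ab: "a - b \<in> tensor_relations R S M"
  have sub: "?C x \<subseteq> ?C y" if "x - y \<in> tensor_relations R S M" for x y
  proof
    fix z assume "z \<in> ?C x"
    then obtain h where h: "h \<in> tensor_relations R S M" "z = h + x" by (auto simp: r_coset_def)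
    then have "h + (x - y) \<in> tensor_relations R S M" "z = (h + (x - y)) + y"
      using tensor_relations_add[OF h(1) that] by simp_all
    then show "z \<in> ?C y" unfolding r_coset_def mult_free_Abelian_group by blast
  qed
  have "b - a \<in> tensor_relations R S M" using tensor_relations_minus[OF ab] by simp
  then show "?C a = ?C b" using sub[of a b] sub[of b a] ab by blast
qed

lemma tensor_coset_zero_iff:
  assumes "Poly_Mapping.keys a \<subseteq> carrier S \<times> carrier M"
  shows "tensor_relations R S M #>\<^bsub>free_Abelian_group (carrier S \<times> carrier M)\<^esub> a =
      tensor_relations R S M \<longleftrightarrow> a \<in> tensor_relations R S M"
proof -
  have "tensor_relations R S M #>\<^bsub>free_Abelian_group (carrier S \<times> carrier M)\<^esub> 0
      = tensor_relations R S M"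
    by (auto simp: r_coset_def)
  then show ?thesis using tensor_coset_eq_iff[OF assms, of 0] by simp
qed

lemma carrier_tensor:
  "carrier (tensor R S M) =
    (\<lambda>c. tensor_relations R S M #>\<^bsub>free_Abelian_group (carrier S \<times> carrier M)\<^esub> c)
      ` {c. Poly_Mapping.keys c \<subseteq> carrier S \<times> carrier M}"
  by (simp add: tensor_def carrier_FactGroup carrier_free_Abelian_group_eq)

lemma mult_tensor:
  assumes "Poly_Mapping.keys a \<subseteq> carrier S \<times> carrier M" "Poly_Mapping.keys b \<subseteq> carrier S \<times> carrier M"
  shows "(tensor_relations R S M #>\<^bsub>free_Abelian_group (carrier S \<times> carrier M)\<^esub> a)
      \<otimes>\<^bsub>tensor R S M\<^esub> (tensor_relations R S M #>\<^bsub>free_Abelian_group (carrier S \<times> carrier M)\<^esub> b) =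
    tensor_relations R S M #>\<^bsub>free_Abelian_group (carrier S \<times> carrier M)\<^esub> (a + b)"
proof -
  have "tensor_relations R S M \<lhd> free_Abelian_group (carrier S \<times> carrier M)"
    by (intro comm_group.subgroup_imp_normal tensor_relations_subgroup)
      (simp add: abelian_free_Abelian_group)
  from normal.rcos_sum[OF this] assms show ?thesis by (simp add: tensor_def)
qed

end

lemma keys_frag_extend_tensor:
  assumes "f \<in> carrier M \<rightarrow> carrier N" "Poly_Mapping.keys c \<subseteq> carrier S \<times> carrier M"
  shows "Poly_Mapping.keys (frag_extend (\<lambda>(s, x). frag_of (s, f x)) c) \<subseteq> carrier S \<times> carrier N"
  using keys_frag_extend[of "\<lambda>(s, x). frag_of (s, f x)" c] assms by fastforce

text \<open>A homomorphism turns each defining relation into one of the same shape. This is what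
  makes the induced map on tensor products well defined.\<close>

lemma frag_extend_tensor_relations:
  assumes S: "right_module R S" and M: "left_module R M" and N: "left_module R N"
    and f: "f \<in> module_homs R M N" and c: "c \<in> tensor_relations R S M"
  shows "frag_extend (\<lambda>(s, x). frag_of (s, f x)) c \<in> tensor_relations R S N"
  using S M c
  by (rule tensor_relations_induct) (simp_all add: frag_extend_diff module_homsD[OF f] tensor_relationsI[OF S N]
    tensor_relations_zero[OF S N] tensor_relations_diff[OF S N])

text \<open>The union in \<open>tensor_map\<close> runs over all representatives of a coset. Two of
  them differ by a relation, so all contribute the same coset and one representative suffices for
  computing.\<close>

lemma tensor_map_coset:
  assumes S: "right_module R S" and M: "left_module R M" and N: "left_module R N"
    and f: "f \<in> module_homs R M N" and c: "Poly_Mapping.keys c \<subseteq> carrier S \<times> carrier M"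
  shows "tensor_map R S N f
      (tensor_relations R S M #>\<^bsub>free_Abelian_group (carrier S \<times> carrier M)\<^esub> c) =
    tensor_relations R S N #>\<^bsub>free_Abelian_group (carrier S \<times> carrier N)\<^esub>
      frag_extend (\<lambda>(s, x). frag_of (s, f x)) c"
proof -
  let ?f = "frag_extend (\<lambda>(s, x). frag_of (s, f x))"
  let ?C = "\<lambda>d. tensor_relations R S N #>\<^bsub>free_Abelian_group (carrier S \<times> carrier N)\<^esub> d"
  have fMN: "f \<in> carrier M \<rightarrow> carrier N" using module_homs_closed[OF f] by blast
  have "?C (?f (h + c)) = ?C (?f c)" if h: "h \<in> tensor_relations R S M" for h
  proof (subst tensor_coset_eq_iff[OF S N])
    have "Poly_Mapping.keys h \<subseteq> carrier S \<times> carrier M" using tensor_relations_keys[OF S M h] .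
    then have "Poly_Mapping.keys (h + c) \<subseteq> carrier S \<times> carrier M" using c keys_add[of h c] by blast
    then show "Poly_Mapping.keys (?f (h + c)) \<subseteq> carrier S \<times> carrier N" "Poly_Mapping.keys (?f c) \<subseteq> carrier S \<times> carrier N"
      using keys_frag_extend_tensor[OF fMN] c by auto
    show "?f (h + c) - ?f c \<in> tensor_relations R S N"
      using frag_extend_tensor_relations[OF S M N f h] by (simp add: frag_extend_add)
  qed
  then show ?thesis
    using tensor_relations_zero[OF S M]
    by (auto simp: tensor_map_def r_coset_def[of "free_Abelian_group (carrier S \<times> carrier M)"])
qed

lemma tensor_map_hom:
  assumes S: "right_module R S" and M: "left_module R M" and N: "left_module R N"
    and f: "f \<in> module_homs R M N"
  shows "tensor_map R S N f \<in> hom (tensor R S M) (tensor R S N)"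
proof -
  have fMN: "f \<in> carrier M \<rightarrow> carrier N" using module_homs_closed[OF f] by blast
  have add: "Poly_Mapping.keys (a + b) \<subseteq> U" if "Poly_Mapping.keys a \<subseteq> U" "Poly_Mapping.keys b \<subseteq> U" for a b :: "'b \<times> 'c \<Rightarrow>\<^sub>0 int" and U
    using that keys_add[of a b] by blast
  show ?thesis
    unfolding hom_def
    by (auto simp: carrier_tensor[OF S M] carrier_tensor[OF S N] mult_tensor[OF S M]
        mult_tensor[OF S N] tensor_map_coset[OF S M N f] frag_extend_add keys_frag_extend_tensor[OF fMN]
        add)
qed

subsection \<open>Quotient modules\<close>

lemma submodule_abelian_subgroup:
  assumes "left_module R B" "submodule K R B"
  shows "abelian_subgroup K B"
proof -
  interpret B: left_module R B by fact
  interpret K: submodule K R B by fact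
  show ?thesis
    using B.a_comm_group K.subgroup_axioms by (intro abelian_subgroupI3 additive_subgroup.intro) (auto intro: B.abelian_group_axioms)
qed

text \<open>The union in \<open>quotient_module\<close> is constant: representatives differ by some
  k in K, and \<open>r k\<close> stays in K.\<close>

lemma coset_smult:
  assumes "left_module R B" "submodule K R B" and r: "r \<in> carrier R" and x: "x \<in> carrier B"
  shows "r \<odot>\<^bsub>quotient_module B K\<^esub> (K +>\<^bsub>B\<^esub> x) = K +>\<^bsub>B\<^esub> (r \<odot>\<^bsub>B\<^esub> x)"
proof -
  interpret B: left_module R B by fact
  interpret K: submodule K R B by fact
  interpret A: abelian_subgroup K B using assms by (intro submodule_abelian_subgroup)
  have "K +>\<^bsub>B\<^esub> (r \<odot>\<^bsub>B\<^esub> y) = K +>\<^bsub>B\<^esub> (r \<odot>\<^bsub>B\<^esub> x)" if y: "y \<in> K +>\<^bsub>B\<^esub> x" for y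
  proof -
    obtain k where k: "k \<in> K" "y = k \<oplus>\<^bsub>B\<^esub> x"
      using y by (auto simp: a_r_coset_def r_coset_def)
    have "r \<odot>\<^bsub>B\<^esub> y = r \<odot>\<^bsub>B\<^esub> k \<oplus>\<^bsub>B\<^esub> r \<odot>\<^bsub>B\<^esub> x"
      using k r x by (simp add: B.smult_r_distr)
    then have "r \<odot>\<^bsub>B\<^esub> y \<in> K +>\<^bsub>B\<^esub> (r \<odot>\<^bsub>B\<^esub> x)"
      using k r by (auto simp: a_r_coset_def r_coset_def)
    then show ?thesis
      using A.a_repr_independence'[OF _ B.smult_closed[OF r x]] by simp
  qed
  then have "(\<Union>y\<in>K +>\<^bsub>B\<^esub> x. K +>\<^bsub>B\<^esub> (r \<odot>\<^bsub>B\<^esub> y)) = K +>\<^bsub>B\<^esub> (r \<odot>\<^bsub>B\<^esub> x)"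
    by (intro UN_constant_eq[OF A.a_rcos_self[OF x]] ballI)
  then show ?thesis by (simp add: quotient_module_def)
qed

lemma carrier_quotient_module: "carrier (quotient_module B K) = (\<lambda>x. K +>\<^bsub>B\<^esub> x) ` carrier B"
  by (auto simp: quotient_module_def A_RCOSETS_def RCOSETS_def a_r_coset_def)

lemma left_module_quotient:
  assumes B: "left_module R B" and K: "submodule K R B"
  shows "left_module R (quotient_module B K)"
    and "(\<lambda>x. K +>\<^bsub>B\<^esub> x) \<in> module_homs R B (quotient_module B K)"
proof -
  interpret B: left_module R B by fact
  interpret K: submodule K R B by fact
  interpret A: abelian_subgroup K B using assms by (intro submodule_abelian_subgroup)
  have add: "(K +>\<^bsub>B\<^esub> x) \<oplus>\<^bsub>quotient_module B K\<^esub> (K +>\<^bsub>B\<^esub> y) = K +>\<^bsub>B\<^esub> (x \<oplus>\<^bsub>B\<^esub> y)"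
    if "x \<in> carrier B" "y \<in> carrier B" for x y
    using A.a_rcos_sum[OF that] by (simp add: quotient_module_def)
  note sm = coset_smult[OF B K]
  have zero: "\<zero>\<^bsub>quotient_module B K\<^esub> = K +>\<^bsub>B\<^esub> \<zero>\<^bsub>B\<^esub>"
    using B.a_coset_add_zero[OF K.subset[simplified]] by (simp add: quotient_module_def)
  have "abelian_group (quotient_module B K)"
  proof (rule abelian_groupI)
    fix x assume "x \<in> carrier (quotient_module B K)"
    then obtain b where "b \<in> carrier B" "x = K +>\<^bsub>B\<^esub> b" by (auto simp: carrier_quotient_module)
    then show "\<exists>y\<in>carrier (quotient_module B K). y \<oplus>\<^bsub>quotient_module B K\<^esub> x = \<zero>\<^bsub>quotient_module B K\<^esub>"
      by (intro bexI[of _ "K +>\<^bsub>B\<^esub> (\<ominus>\<^bsub>B\<^esub> b)"]) (auto simp: add zero carrier_quotient_module B.l_neg)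
  qed (auto simp: carrier_quotient_module add zero B.a_ac)
  then show "left_module R (quotient_module B K)"
    by (intro left_module.intro left_module_axioms.intro B.R.ring_axioms)
      (auto simp: carrier_quotient_module sm add B.smult_l_distr B.smult_r_distr B.smult_assoc)
  show "(\<lambda>x. K +>\<^bsub>B\<^esub> x) \<in> module_homs R B (quotient_module B K)"
    by (rule module_homsI) (auto simp: carrier_quotient_module sm add)
qed

subsection \<open>Locally split submodules are coneat\<close>

text \<open>Splitting serves injectivity on the left: a chain over K has finite support, so one
  retraction that fixes this support pulls a relation over B back to a relation over K. The rest is
  right exactness of the tensor product, proved on chains.\<close>

lemma short_exact_tensor:
  assumes B: "left_module R B" and K: "submodule K R B" and S: "right_module R S"
    and split: "\<And>T. \<lbrakk>finite T; T \<subseteq> K\<rbrakk> \<Longrightarrow> \<exists>\<psi>\<in>module_homs R B (B\<lparr>carrier := K\<rparr>). \<forall>x\<in>T. \<psi> x = x"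
  shows "short_exact (tensor R S (B\<lparr>carrier := K\<rparr>)) (tensor R S B) (tensor R S (quotient_module B K))
    (tensor_map R S B (\<lambda>x. x)) (tensor_map R S (quotient_module B K) (\<lambda>x. K +>\<^bsub>B\<^esub> x))"
proof -
  interpret B: left_module R B by fact
  interpret S: left_module "opposite_ring R" S by fact
  interpret K: submodule K R B by fact
  interpret A: abelian_subgroup K B using B K by (intro submodule_abelian_subgroup)
  let ?K = "B\<lparr>carrier := K\<rparr>" and ?Q = "quotient_module B K"
  let ?\<pi> = "\<lambda>x. K +>\<^bsub>B\<^esub> x"
  let ?CK = "\<lambda>d. tensor_relations R S ?K #>\<^bsub>free_Abelian_group (carrier S \<times> carrier ?K)\<^esub> d"
  let ?CB = "\<lambda>d. tensor_relations R S B #>\<^bsub>free_Abelian_group (carrier S \<times> carrier B)\<^esub> d"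
  let ?CQ = "\<lambda>d. tensor_relations R S ?Q #>\<^bsub>free_Abelian_group (carrier S \<times> carrier ?Q)\<^esub> d"
  have Kmod: "left_module R ?K" by (rule left_module_submodule[OF B K])
  have Qmod: "left_module R ?Q" and \<pi>: "?\<pi> \<in> module_homs R B ?Q"
    by (rule left_module_quotient[OF B K])+
  have incl: "(\<lambda>x. x) \<in> module_homs R ?K B"
    by (rule module_homsI) auto
  have idK: "frag_extend (\<lambda>(s, x). frag_of (s, x)) c = c" for c :: "'c \<times> 'b \<Rightarrow>\<^sub>0 int"
  proof -
    have "(\<lambda>(s, x). frag_of (s, x)) = (frag_of :: 'c \<times> 'b \<Rightarrow> _)" by auto
    then show ?thesis by (metis frag_expansion)
  qed
  have keysKB: "Poly_Mapping.keys c \<subseteq> carrier S \<times> carrier B" if "Poly_Mapping.keys c \<subseteq> carrier S \<times> K"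
    for c :: "'c \<times> 'b \<Rightarrow>\<^sub>0 int"
    using that by auto
  have mapK: "tensor_map R S B (\<lambda>x. x) (?CK c) = ?CB c"
    if "Poly_Mapping.keys c \<subseteq> carrier S \<times> K" for c
    using tensor_map_coset[OF S Kmod B incl, of c] that by (simp add: idK)
  \<comment> \<open>The retraction \<open>\<psi>\<close> sends relations over B to relations over K,
    and it leaves c unchanged because it fixes all second components in the support of c.\<close>
  have relK: "c \<in> tensor_relations R S ?K"
    if c: "Poly_Mapping.keys c \<subseteq> carrier S \<times> K" "c \<in> tensor_relations R S B" for c
  proof -
    have sub: "snd ` Poly_Mapping.keys c \<subseteq> K" using c(1) by auto
    obtain \<psi> where \<psi>: "\<psi> \<in> module_homs R B ?K" "\<forall>x\<in>snd ` Poly_Mapping.keys c. \<psi> x = x"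
      by (rule bexE[OF split[OF finite_imageI[OF finite_keys] sub]])
    have "frag_extend (\<lambda>(s, x). frag_of (s, \<psi> x)) c = frag_extend frag_of c"
      using \<psi>(2) by (intro frag_extend_eq) force
    then show ?thesis
      using frag_extend_tensor_relations[OF S B Kmod \<psi>(1) c(2)] frag_expansion[of c] by simp
  qed
  have inj: "inj_on (tensor_map R S B (\<lambda>x. x)) (carrier (tensor R S ?K))"
  proof (rule inj_onI)
    fix x y assume "x \<in> carrier (tensor R S ?K)" "y \<in> carrier (tensor R S ?K)"
      and eq: "tensor_map R S B (\<lambda>x. x) x = tensor_map R S B (\<lambda>x. x) y"
    then obtain c d where c: "Poly_Mapping.keys c \<subseteq> carrier S \<times> K" "x = ?CK c"
      and d: "Poly_Mapping.keys d \<subseteq> carrier S \<times> K" "y = ?CK d"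
      by (auto simp: carrier_tensor[OF S Kmod])
    have "c - d \<in> tensor_relations R S B"
      using eq unfolding c(2) d(2) mapK[OF c(1)] mapK[OF d(1)]
      using tensor_coset_eq_iff[OF S B keysKB[OF c(1)] keysKB[OF d(1)]] by simp
    then have "c - d \<in> tensor_relations R S ?K"
      using relK keys_diff_subset[OF c(1) d(1)] by blast
    then show "x = y"
      using c d tensor_coset_eq_iff[OF S Kmod, of c d] by simp
  qed
  \<comment> \<open>A set-theoretic section of the projection. It need not be linear; its defects
    are absorbed by \<open>H\<close> below.\<close>
  obtain \<sigma> where \<sigma>: "\<sigma> q \<in> carrier B" "?\<pi> (\<sigma> q) = q" if "q \<in> carrier ?Q" for q
    unfolding carrier_quotient_module by (metis (no_types, lifting) f_inv_into_f inv_into_into)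
  let ?p = "frag_extend (\<lambda>(s, x). frag_of (s, ?\<pi> x)) :: ('c \<times> 'b \<Rightarrow>\<^sub>0 int) \<Rightarrow> _"
  let ?s = "frag_extend (\<lambda>(s, q). frag_of (s, \<sigma> q)) :: ('c \<times> 'b set \<Rightarrow>\<^sub>0 int) \<Rightarrow> _"
  have ps: "?p (?s d) = d" if "Poly_Mapping.keys d \<subseteq> carrier S \<times> carrier ?Q" for d
    using that by (induction d rule: frag_induction) (auto simp: frag_extend_diff \<sigma>)
  have surj: "tensor_map R S ?Q ?\<pi> ` carrier (tensor R S B) = carrier (tensor R S ?Q)"
  proof
    show "tensor_map R S ?Q ?\<pi> ` carrier (tensor R S B) \<subseteq> carrier (tensor R S ?Q)"
      using tensor_map_hom[OF S B Qmod \<pi>] by (auto simp: hom_def)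
    show "carrier (tensor R S ?Q) \<subseteq> tensor_map R S ?Q ?\<pi> ` carrier (tensor R S B)"
    proof
      fix y assume "y \<in> carrier (tensor R S ?Q)"
      then obtain d where d: "Poly_Mapping.keys d \<subseteq> carrier S \<times> carrier ?Q" "y = ?CQ d"
        by (auto simp: carrier_tensor[OF S Qmod])
      have "Poly_Mapping.keys (?s d) \<subseteq> carrier S \<times> carrier B"
        using keys_frag_extend_tensor[of \<sigma> ?Q B d S] d(1) \<sigma> by auto
      then show "y \<in> tensor_map R S ?Q ?\<pi> ` carrier (tensor R S B)"
        using tensor_map_coset[OF S B Qmod \<pi>, of "?s d"] ps[OF d(1)] d(2)
        by (auto simp: carrier_tensor[OF S B] intro!: image_eqI)
    qed
  qed
  \<comment> \<open>The chains whose class in the tensor product with B comes from K. Exactness in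
    the middle follows from two facts: \<open>?s\<close> maps relations over the quotient into
    \<open>H\<close>, and \<open>c - ?s (?p c)\<close> lies in \<open>H\<close> for every chain c
    over B.\<close>
  define H where "H = {a + b | a b. a \<in> tensor_relations R S B \<and> Poly_Mapping.keys b \<subseteq> carrier S \<times> K}"
  have Hrel: "a \<in> H" if "a \<in> tensor_relations R S B" for a
    unfolding H_def by (rule CollectI, rule exI[of _ a], rule exI[of _ 0]) (use that in simp)
  have HK: "frag_of (s, k) \<in> H" if "s \<in> carrier S" "k \<in> K" for s k
    unfolding H_def by (rule CollectI, rule exI[of _ 0], rule exI[of _ "frag_of (s, k)"])
      (use that tensor_relations_zero[OF S B] in simp)
  have Hdiff: "a - b \<in> H" if "a \<in> H" "b \<in> H" for a b
  proof -
    obtain a1 a2 b1 b2 where *: "a = a1 + a2" "b = b1 + b2" "a1 \<in> tensor_relations R S B"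
      "b1 \<in> tensor_relations R S B" "Poly_Mapping.keys a2 \<subseteq> carrier S \<times> K" "Poly_Mapping.keys b2 \<subseteq> carrier S \<times> K"
      using \<open>a \<in> H\<close> \<open>b \<in> H\<close> unfolding H_def by blast
    have "a - b = (a1 - b1) + (a2 - b2)" using * by simp
    then show ?thesis
      unfolding H_def using * tensor_relations_diff[OF S B] keys_diff_subset by blast
  qed
  have H0: "0 \<in> H" by (rule Hrel[OF tensor_relations_zero[OF S B]])
  have Hadd: "a + b \<in> H" if "a \<in> H" "b \<in> H" for a b
    using Hdiff[OF that(1) Hdiff[OF H0 that(2)]] by simp
  have Hcong: "frag_of (s, x) - frag_of (s, y) \<in> H"
    if h: "s \<in> carrier S" "x \<in> carrier B" "y \<in> carrier B" "?\<pi> x = ?\<pi> y" for s x y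
  proof -
    obtain k where k: "k \<in> K" "x = k \<oplus>\<^bsub>B\<^esub> y"
      using A.a_rcos_self[OF h(2)] h(4) by (auto simp: a_r_coset_def r_coset_def)
    have "frag_of (s, x) - frag_of (s, k) - frag_of (s, y) \<in> H"
      using tensor_relationsI(2)[OF S B, of s k y] h k by (auto intro!: Hrel)
    from Hadd[OF this HK[OF h(1) k(1)]] show ?thesis by (simp add: algebra_simps)
  qed
  have sH: "?s d \<in> H" if "d \<in> tensor_relations R S ?Q" for d
    using S Qmod that
  proof (rule tensor_relations_induct)
    fix s q r assume s: "s \<in> carrier S" and q: "q \<in> carrier ?Q" and r: "r \<in> carrier ?Q"
    have qr: "q \<oplus>\<^bsub>?Q\<^esub> r \<in> carrier ?Q"
      using abelian_monoid.a_closed[OF _ q r] Qmod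
      by (simp add: left_module_def abelian_group_def)
    have "?\<pi> (\<sigma> q \<oplus>\<^bsub>B\<^esub> \<sigma> r) = q \<oplus>\<^bsub>?Q\<^esub> r"
      using module_homs_add[OF \<pi>, of "\<sigma> q" "\<sigma> r"] \<sigma> q r by simp
    then have "frag_of (s, \<sigma> (q \<oplus>\<^bsub>?Q\<^esub> r)) - frag_of (s, \<sigma> q \<oplus>\<^bsub>B\<^esub> \<sigma> r) \<in> H"
      using \<sigma> q r qr s by (intro Hcong) auto
    note sum = Hadd[OF this Hrel[OF tensor_relationsI(2)[OF S B s \<sigma>(1)[OF q] \<sigma>(1)[OF r]]]]
    have telescope: "a - b + (b - c - d) = a - c - d" for a b c d :: "'c \<times> 'b \<Rightarrow>\<^sub>0 int" by simp
    show "?s (frag_of (s, q \<oplus>\<^bsub>?Q\<^esub> r) - frag_of (s, q) - frag_of (s, r)) \<in> H"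
      using sum[unfolded telescope] by (simp add: frag_extend_diff)
  next
    fix r s q assume r: "r \<in> carrier R" and s: "s \<in> carrier S" and q: "q \<in> carrier ?Q"
    have rq: "r \<odot>\<^bsub>?Q\<^esub> q \<in> carrier ?Q"
      by (rule left_module.smult_closed[OF Qmod r q])
    have "?\<pi> (r \<odot>\<^bsub>B\<^esub> \<sigma> q) = r \<odot>\<^bsub>?Q\<^esub> q"
      using module_homs_smult[OF \<pi> r, of "\<sigma> q"] \<sigma> q by simp
    then have "frag_of (s, r \<odot>\<^bsub>B\<^esub> \<sigma> q) - frag_of (s, \<sigma> (r \<odot>\<^bsub>?Q\<^esub> q)) \<in> H"
      using \<sigma> q r rq s by (intro Hcong) auto
    from Hadd[OF this Hrel[OF tensor_relationsI(3)[OF S B r s \<sigma>(1)[OF q]]]]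
    show "?s (frag_of (r \<odot>\<^bsub>S\<^esub> s, q) - frag_of (s, r \<odot>\<^bsub>?Q\<^esub> q)) \<in> H"
      by (simp add: frag_extend_diff)
  qed (auto simp: frag_extend_diff H0 Hdiff \<sigma> intro!: Hrel tensor_relationsI[OF S B])
  have sp: "c - ?s (?p c) \<in> H" if "Poly_Mapping.keys c \<subseteq> carrier S \<times> carrier B" for c
    using that
  proof (induction c rule: frag_induction)
    case (one x)
    then obtain s b where x: "x = (s, b)" "s \<in> carrier S" "b \<in> carrier B" by auto
    then have "?\<pi> b \<in> carrier ?Q" by (auto simp: carrier_quotient_module)
    with x show ?case by (auto intro!: Hcong simp: \<sigma>)
  next
    case (diff a b)
    then show ?case using Hdiff[OF diff] by (simp add: frag_extend_diff algebra_simps)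
  qed (simp add: H0)
  have oneQ: "\<one>\<^bsub>tensor R S ?Q\<^esub> = tensor_relations R S ?Q" by (simp add: tensor_def)
  have ker: "tensor_map R S B (\<lambda>x. x) ` carrier (tensor R S ?K) =
      kernel (tensor R S B) (tensor R S ?Q) (tensor_map R S ?Q ?\<pi>)"
  proof (intro equalityI subsetI)
    fix y assume "y \<in> tensor_map R S B (\<lambda>x. x) ` carrier (tensor R S ?K)"
    then obtain c where c: "Poly_Mapping.keys c \<subseteq> carrier S \<times> K" "y = tensor_map R S B (\<lambda>x. x) (?CK c)"
      by (auto simp: carrier_tensor[OF S Kmod])
    note c = c(1) c(2)[unfolded mapK[OF c(1)]]
    have "?p c \<in> tensor_relations R S ?Q"
      using c(1)
    proof (induction c rule: frag_induction)
      case (one x)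
      then obtain s k where x: "x = (s, k)" "s \<in> carrier S" "k \<in> K" by auto
      have "?\<pi> k = \<zero>\<^bsub>?Q\<^esub>" using A.a_rcos_const[OF x(3)] by (simp add: quotient_module_def)
      moreover have "\<zero>\<^bsub>?Q\<^esub> \<in> carrier ?Q" "\<zero>\<^bsub>?Q\<^esub> \<oplus>\<^bsub>?Q\<^esub> \<zero>\<^bsub>?Q\<^esub> = \<zero>\<^bsub>?Q\<^esub>"
        using Qmod by (auto simp: left_module_def abelian_group_def abelian_monoid.zero_closed abelian_monoid.l_zero)
      \<comment> \<open>The relator for the sum 0 + 0 in the second argument collapses to minus the
        generator at 0.\<close>
      ultimately have "- frag_of (s, ?\<pi> k) \<in> tensor_relations R S ?Q"
        using tensor_relationsI(2)[OF S Qmod x(2), of "\<zero>\<^bsub>?Q\<^esub>" "\<zero>\<^bsub>?Q\<^esub>"] by simp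
      from tensor_relations_minus[OF S Qmod this] show ?case by (simp add: x)
    qed (auto simp: frag_extend_diff tensor_relations_zero[OF S Qmod] tensor_relations_diff[OF S Qmod])
    moreover have "Poly_Mapping.keys (?p c) \<subseteq> carrier S \<times> carrier ?Q"
      using calculation tensor_relations_keys[OF S Qmod] by blast
    ultimately have "?CQ (?p c) = tensor_relations R S ?Q"
      using tensor_coset_zero_iff[OF S Qmod] by blast
    then show "y \<in> kernel (tensor R S B) (tensor R S ?Q) (tensor_map R S ?Q ?\<pi>)"
      using c keysKB[OF c(1)] tensor_map_coset[OF S B Qmod \<pi> keysKB[OF c(1)]]
      by (auto simp: kernel_def carrier_tensor[OF S B] oneQ)
  next
    fix y assume y: "y \<in> kernel (tensor R S B) (tensor R S ?Q) (tensor_map R S ?Q ?\<pi>)"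
    then obtain c where c: "Poly_Mapping.keys c \<subseteq> carrier S \<times> carrier B" "y = ?CB c"
      by (auto simp: kernel_def carrier_tensor[OF S B])
    have kp: "Poly_Mapping.keys (?p c) \<subseteq> carrier S \<times> carrier ?Q"
      using keys_frag_extend_tensor[of ?\<pi> B ?Q c S] c(1) by (auto simp: carrier_quotient_module)
    have "?CQ (?p c) = tensor_relations R S ?Q"
      using y tensor_map_coset[OF S B Qmod \<pi> c(1)] unfolding c(2) by (simp add: kernel_def oneQ)
    then have "?s (?p c) \<in> H"
      using tensor_coset_zero_iff[OF S Qmod kp] sH by blast
    from Hadd[OF sp[OF c(1)] this] have "c \<in> H" by simp
    then obtain a b where ab: "c = a + b" "a \<in> tensor_relations R S B" "Poly_Mapping.keys b \<subseteq> carrier S \<times> K"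
      unfolding H_def by blast
    then have y: "y = ?CB b"
      using c tensor_coset_eq_iff[OF S B c(1) keysKB[OF ab(3)]] by simp
    show "y \<in> tensor_map R S B (\<lambda>x. x) ` carrier (tensor R S ?K)"
      unfolding y mapK[OF ab(3), symmetric] carrier_tensor[OF S Kmod] using ab(3) by (intro imageI) simp
  qed
  show ?thesis
    unfolding short_exact_def mon_def epi_def
    using tensor_map_hom[OF S Kmod B incl] tensor_map_hom[OF S B Qmod \<pi>] inj surj ker by simp
qed

section \<open>Rings that are compact for definable cosets\<close>

subsection \<open>Left ideals and the Jacobson radical\<close>

locale unital_ring = ring S for S :: "'s ring" (structure)
begin

lemma regular_module_simps [simp]:
  "carrier (regular_module S) = carrier S" "x \<oplus>\<^bsub>regular_module S\<^esub> y = x \<oplus> y"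
  "\<zero>\<^bsub>regular_module S\<^esub> = \<zero>" "x \<odot>\<^bsub>regular_module S\<^esub> y = x \<otimes> y"
  by (simp_all add: regular_module_def)

abbreviation left_ideal :: "'s set \<Rightarrow> bool" where
  "left_ideal I \<equiv> submodule I S (regular_module S)"

lemma left_ideal_iff:
  "left_ideal I \<longleftrightarrow> I \<subseteq> carrier S \<and> \<zero> \<in> I \<and> (\<forall>a\<in>I. \<forall>b\<in>I. a \<oplus> b \<in> I) \<and>
    (\<forall>r\<in>carrier S. \<forall>a\<in>I. r \<otimes> a \<in> I)"
proof
  assume "left_ideal I"
  then interpret I: submodule I S "regular_module S" .
  show "I \<subseteq> carrier S \<and> \<zero> \<in> I \<and> (\<forall>a\<in>I. \<forall>b\<in>I. a \<oplus> b \<in> I) \<and>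
    (\<forall>r\<in>carrier S. \<forall>a\<in>I. r \<otimes> a \<in> I)"
    using I.subset I.m_closed I.one_closed I.smult_closed by simp
next
  assume "I \<subseteq> carrier S \<and> \<zero> \<in> I \<and> (\<forall>a\<in>I. \<forall>b\<in>I. a \<oplus> b \<in> I) \<and>
    (\<forall>r\<in>carrier S. \<forall>a\<in>I. r \<otimes> a \<in> I)"
  then show "left_ideal I"
    by (intro left_module.submoduleI left_module_regular ring_axioms) auto
qed

lemma left_idealD:
  assumes "left_ideal I"
  shows left_ideal_subset: "I \<subseteq> carrier S"
    and left_ideal_zero: "\<zero> \<in> I"
    and left_ideal_add: "\<lbrakk>a \<in> I; b \<in> I\<rbrakk> \<Longrightarrow> a \<oplus> b \<in> I"
    and left_ideal_mult: "\<lbrakk>r \<in> carrier S; a \<in> I\<rbrakk> \<Longrightarrow> r \<otimes> a \<in> I"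
    and left_ideal_minus: "a \<in> I \<Longrightarrow> \<ominus> a \<in> I"
    and left_ideal_diff: "\<lbrakk>a \<in> I; b \<in> I\<rbrakk> \<Longrightarrow> a \<ominus> b \<in> I"
proof -
  note I = assms[unfolded left_ideal_iff]
  show "I \<subseteq> carrier S" "\<zero> \<in> I" "\<lbrakk>a \<in> I; b \<in> I\<rbrakk> \<Longrightarrow> a \<oplus> b \<in> I"
    "\<lbrakk>r \<in> carrier S; a \<in> I\<rbrakk> \<Longrightarrow> r \<otimes> a \<in> I" for r a b
    using I by auto
  show minus: "\<ominus> a \<in> I" if "a \<in> I" for a
  proof -
    have "\<ominus> a = (\<ominus> \<one>) \<otimes> a" using that I by (simp add: l_minus subset_iff)
    then show ?thesis using I that by simp
  qed
  show "\<lbrakk>a \<in> I; b \<in> I\<rbrakk> \<Longrightarrow> a \<ominus> b \<in> I" using I minus by (simp add: minus_eq)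
qed

lemma mult_diff_right: "\<lbrakk>a \<in> carrier S; b \<in> carrier S; c \<in> carrier S\<rbrakk> \<Longrightarrow> a \<otimes> (b \<ominus> c) = a \<otimes> b \<ominus> a \<otimes> c"
  by (simp add: minus_eq r_distr r_minus)

lemma mult_diff_left: "\<lbrakk>a \<in> carrier S; b \<in> carrier S; c \<in> carrier S\<rbrakk> \<Longrightarrow> (b \<ominus> c) \<otimes> a = b \<otimes> a \<ominus> c \<otimes> a"
  by (simp add: minus_eq l_distr l_minus)

lemma diff_diff_cancel [simp]: "\<lbrakk>a \<in> carrier S; b \<in> carrier S\<rbrakk> \<Longrightarrow> a \<ominus> (a \<ominus> b) = b"
  by (simp add: minus_eq minus_add r_neg1 r_neg2)

lemma diff_add_cancel' [simp]: "\<lbrakk>a \<in> carrier S; b \<in> carrier S\<rbrakk> \<Longrightarrow> a \<ominus> b \<oplus> b = a"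
  by (simp add: minus_eq a_assoc l_neg)

lemma left_ideal_one_imp_eq:
  assumes "left_ideal I" "\<one> \<in> I"
  shows "I = carrier S"
  using left_idealD[OF assms(1)] assms(2) by (metis r_one subsetI subset_antisym)

lemma left_ideal_principal:
  assumes "a \<in> carrier S"
  shows "left_ideal {y \<otimes> a | y. y \<in> carrier S}"
  unfolding left_ideal_iff
proof (intro conjI ballI)
  show "\<zero> \<in> {y \<otimes> a |y. y \<in> carrier S}" using assms by (force intro: exI[of _ \<zero>])
  fix u v assume "u \<in> {y \<otimes> a |y. y \<in> carrier S}" "v \<in> {y \<otimes> a |y. y \<in> carrier S}"
  then show "u \<oplus> v \<in> {y \<otimes> a |y. y \<in> carrier S}"
    using assms by (auto simp flip: l_distr)
next
  fix r u assume "r \<in> carrier S" "u \<in> {y \<otimes> a |y. y \<in> carrier S}"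
  then show "r \<otimes> u \<in> {y \<otimes> a |y. y \<in> carrier S}"
    using assms by (auto simp flip: m_assoc)
qed (use assms in auto)

lemma left_ideal_annihilator:
  assumes "a \<in> carrier S"
  shows "left_ideal {s \<in> carrier S. s \<otimes> a = \<zero>}"
  unfolding left_ideal_iff using assms by (auto simp: l_distr m_assoc)

lemma left_ideal_Int:
  assumes "\<And>I. I \<in> \<K> \<Longrightarrow> left_ideal I"
  shows "left_ideal (carrier S \<inter> \<Inter>\<K>)"
  using assms unfolding left_ideal_iff by (auto simp: subset_iff)

lemma left_ideal_sum:
  assumes I: "left_ideal I" and L: "left_ideal L"
  shows "left_ideal {a \<oplus> b | a b. a \<in> I \<and> b \<in> L}"
  unfolding left_ideal_iff
proof (intro conjI ballI)
  note I' = left_idealD[OF I] and L' = left_idealD[OF L]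
  show "{a \<oplus> b | a b. a \<in> I \<and> b \<in> L} \<subseteq> carrier S" using I' L' by auto
  show "\<zero> \<in> {a \<oplus> b | a b. a \<in> I \<and> b \<in> L}"
    using I'(2) L'(2) by (intro CollectI exI[of _ \<zero>]) simp
  fix u v assume "u \<in> {a \<oplus> b | a b. a \<in> I \<and> b \<in> L}" "v \<in> {a \<oplus> b | a b. a \<in> I \<and> b \<in> L}"
  then obtain a b c d where *: "u = a \<oplus> b" "v = c \<oplus> d" "a \<in> I" "b \<in> L" "c \<in> I" "d \<in> L" by auto
  moreover from * have "u \<oplus> v = (a \<oplus> c) \<oplus> (b \<oplus> d)"
    using I'(1) L'(1) by (simp add: subset_iff a_ac)
  moreover have "a \<oplus> c \<in> I" "b \<oplus> d \<in> L" using * I'(3) L'(3) by simp_all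
  ultimately show "u \<oplus> v \<in> {a \<oplus> b | a b. a \<in> I \<and> b \<in> L}" by blast
next
  note I' = left_idealD[OF I] and L' = left_idealD[OF L]
  fix r u assume r: "r \<in> carrier S" and "u \<in> {a \<oplus> b | a b. a \<in> I \<and> b \<in> L}"
  then obtain a b where *: "u = a \<oplus> b" "a \<in> I" "b \<in> L" by auto
  moreover from * r have "r \<otimes> u = r \<otimes> a \<oplus> r \<otimes> b"
    using I'(1) L'(1) by (simp add: subset_iff r_distr)
  moreover have "r \<otimes> a \<in> I" "r \<otimes> b \<in> L" using * r I'(4) L'(4) by simp_all
  ultimately show "r \<otimes> u \<in> {a \<oplus> b | a b. a \<in> I \<and> b \<in> L}" by blast
qed

text \<open>Krull's argument; properness is recorded as \<open>\<one> \<notin> L\<close>, which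
  passes to unions of chains.\<close>

lemma maximal_left_ideal_exists:
  assumes I: "left_ideal I" "\<one> \<notin> I"
  obtains L where "maximal_left_ideal L S" "I \<subseteq> L"
proof -
  define \<A> where "\<A> = {L. left_ideal L \<and> \<one> \<notin> L \<and> I \<subseteq> L}"
  have "\<exists>L\<in>\<A>. \<forall>K\<in>\<A>. L \<subseteq> K \<longrightarrow> K = L"
  proof (rule subset_Zorn_nonempty)
    show "\<A> \<noteq> {}" using I by (auto simp: \<A>_def)
    fix C assume C: "C \<noteq> {}" "subset.chain \<A> C"
    then have CA: "\<And>L. L \<in> C \<Longrightarrow> left_ideal L \<and> \<one> \<notin> L \<and> I \<subseteq> L"
      by (auto simp: subset.chain_def \<A>_def)
    have "left_ideal (\<Union>C)"
      unfolding left_ideal_iff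
    proof (intro conjI ballI)
      fix a b assume "a \<in> \<Union>C" "b \<in> \<Union>C"
      then obtain K L where KL: "K \<in> C" "L \<in> C" "a \<in> K" "b \<in> L" by auto
      then have "K \<subseteq> L \<or> L \<subseteq> K" using C by (auto simp: subset.chain_def)
      then show "a \<oplus> b \<in> \<Union>C"
        using KL CA left_ideal_add by (metis UnionI subsetD)
    next
      show "\<Union>C \<subseteq> carrier S" using CA left_ideal_subset by blast
      show "\<zero> \<in> \<Union>C" using CA C(1) left_ideal_zero by blast
      fix r a assume "r \<in> carrier S" "a \<in> \<Union>C"
      then show "r \<otimes> a \<in> \<Union>C" using CA left_ideal_mult by blast
    qed
    then show "\<Union>C \<in> \<A>" using CA C(1) by (auto simp: \<A>_def)
  qed
  then obtain L where L: "L \<in> \<A>" "\<And>K. K \<in> \<A> \<Longrightarrow> L \<subseteq> K \<Longrightarrow> K = L" by blast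
  have "maximal_left_ideal L S"
    unfolding maximal_left_ideal_def
  proof (intro conjI allI impI)
    fix K assume K: "left_ideal K \<and> L \<subseteq> K"
    show "K = L \<or> K = carrier S"
    proof (cases "\<one> \<in> K")
      case True
      then show ?thesis using K left_ideal_one_imp_eq by blast
    next
      case False
      then have "K \<in> \<A>" using K L(1) by (auto simp: \<A>_def)
      then show ?thesis using K L(2) by blast
    qed
  qed (use L(1) in \<open>auto simp: \<A>_def\<close>)
  with L(1) that show thesis by (auto simp: \<A>_def)
qed

text \<open>If \<open>1 - tx\<close> had no left inverse, the left ideal it generates would lie in a
  maximal one, which contains \<open>tx\<close> and hence 1. Conversely, if a maximal L misses x,
  then \<open>L + Sx = S\<close> gives \<open>1 = m + tx\<close> with m in L, and a left inverse of
  m puts 1 into L.\<close>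

lemma jacobson_radical_iff:
  "x \<in> jacobson_radical S \<longleftrightarrow>
    x \<in> carrier S \<and> (\<forall>t\<in>carrier S. \<exists>w\<in>carrier S. w \<otimes> (\<one> \<ominus> t \<otimes> x) = \<one>)"
proof (intro iffI conjI ballI)
  assume x: "x \<in> jacobson_radical S"
  then show xc: "x \<in> carrier S" by (simp add: jacobson_radical_def)
  fix t assume t: "t \<in> carrier S"
  let ?I = "{y \<otimes> (\<one> \<ominus> t \<otimes> x) | y. y \<in> carrier S}"
  have I: "left_ideal ?I" using t xc by (intro left_ideal_principal) simp
  have "\<one> \<in> ?I"
  proof (rule ccontr)
    assume "\<one> \<notin> ?I"
    then obtain L where L: "maximal_left_ideal L S" "?I \<subseteq> L"
      using maximal_left_ideal_exists[OF I] by blast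
    then have LI: "left_ideal L" "L \<noteq> carrier S" by (auto simp: maximal_left_ideal_def)
    have "t \<otimes> x \<in> L" using x L(1) t LI left_ideal_mult by (auto simp: jacobson_radical_def)
    moreover have "\<one> \<otimes> (\<one> \<ominus> t \<otimes> x) \<in> ?I" by blast
    then have "\<one> \<ominus> t \<otimes> x \<in> L" using L(2) t xc by (simp add: subset_iff)
    ultimately have "\<one> \<ominus> t \<otimes> x \<oplus> t \<otimes> x \<in> L" using left_ideal_add[OF LI(1)] by blast
    then show False using LI left_ideal_one_imp_eq t xc by simp
  qed
  then obtain w where w: "w \<in> carrier S" "\<one> = w \<otimes> (\<one> \<ominus> t \<otimes> x)" by blast
  show "\<exists>w\<in>carrier S. w \<otimes> (\<one> \<ominus> t \<otimes> x) = \<one>" by (rule bexI[where x = w, OF _ w(1)]) (rule w(2)[symmetric])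
next
  assume x: "x \<in> carrier S \<and> (\<forall>t\<in>carrier S. \<exists>w\<in>carrier S. w \<otimes> (\<one> \<ominus> t \<otimes> x) = \<one>)"
  have "x \<in> L" if L: "maximal_left_ideal L S" for L
  proof (rule ccontr)
    assume xL: "x \<notin> L"
    have LI: "left_ideal L" "L \<noteq> carrier S" using L by (auto simp: maximal_left_ideal_def)
    let ?P = "{y \<otimes> x | y. y \<in> carrier S}"
    let ?K = "{a \<oplus> b | a b. a \<in> L \<and> b \<in> ?P}"
    have P: "left_ideal ?P" using x by (intro left_ideal_principal) simp
    have "left_ideal ?K" by (rule left_ideal_sum[OF LI(1) P])
    moreover have "L \<subseteq> ?K"
    proof
      fix l assume l: "l \<in> L"
      then have "l = l \<oplus> \<zero>" using left_ideal_subset[OF LI(1)] by (simp add: subset_iff)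
      then show "l \<in> ?K" using l left_ideal_zero[OF P] by blast
    qed
    moreover have xK: "x \<in> ?K"
      using left_ideal_zero[OF LI(1)] x by (intro CollectI exI[of _ \<zero>] exI[of _ x]) (auto intro!: exI[of _ \<one>])
    ultimately have "?K = L \<or> ?K = carrier S"
      using L[unfolded maximal_left_ideal_def, THEN conjunct2, THEN conjunct2, THEN spec, of ?K] by iprover
    moreover have "?K \<noteq> L" using xK xL by (metis (no_types))
    ultimately have K: "?K = carrier S" by simp
    have "\<one> \<in> ?K" unfolding K by (rule one_closed)
    then obtain m t where m: "m \<in> L" "t \<in> carrier S" "\<one> = m \<oplus> t \<otimes> x"
      by blast
    then have mc: "m \<in> carrier S" using left_ideal_subset[OF LI(1)] by blast
    have "\<one> \<ominus> t \<otimes> x = m" unfolding m(3) using mc m(2) x by (simp add: minus_eq a_assoc r_neg)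
    then obtain w where "w \<in> carrier S" "w \<otimes> m = \<one>" using x m(2) by auto
    then have "\<one> \<in> L" using left_ideal_mult[OF LI(1) _ m(1)] by force
    then show False using LI left_ideal_one_imp_eq by blast
  qed
  then show "x \<in> jacobson_radical S" using x by (simp add: jacobson_radical_def)
qed

lemma jacobson_radical_left_ideal: "left_ideal (jacobson_radical S)"
  unfolding jacobson_radical_def
  by (rule left_ideal_Int) (auto simp: maximal_left_ideal_def)

text \<open>If \<open>w\<close> is a left inverse of \<open>1 - ba\<close>, then \<open>1 + awb\<close> is a left inverse of \<open>1 - ab\<close>.\<close>

lemma jacobson_radical_ideal: "ideal (jacobson_radical S) S"
proof (rule idealI)
  note J = left_idealD[OF jacobson_radical_left_ideal]
  show "ring S" by (rule ring_axioms)
  show "subgroup (jacobson_radical S) (add_monoid S)"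
    using J by (intro add.subgroupI) (auto simp: a_inv_def)
  fix x r assume x: "x \<in> jacobson_radical S" and r: "r \<in> carrier S"
  then have xc: "x \<in> carrier S" using J(1) by blast
  show "r \<otimes> x \<in> jacobson_radical S" using J(4) x r by blast
  show "x \<otimes> r \<in> jacobson_radical S"
    unfolding jacobson_radical_iff
  proof (intro conjI ballI)
    fix t assume t: "t \<in> carrier S"
    have "r \<otimes> t \<in> carrier S" using r t by simp
    then obtain w where w: "w \<in> carrier S" "w \<otimes> (\<one> \<ominus> (r \<otimes> t) \<otimes> x) = \<one>"
      using x jacobson_radical_iff by blast
    define a where "a = t \<otimes> x"
    have a: "a \<in> carrier S" using t xc by (simp add: a_def)
    have wra: "w \<ominus> w \<otimes> (r \<otimes> a) = \<one>"
      using w r t xc by (simp add: a_def mult_diff_right m_assoc)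
    have "(\<one> \<oplus> a \<otimes> w \<otimes> r) \<otimes> (\<one> \<ominus> a \<otimes> r)
        = (\<one> \<ominus> a \<otimes> r) \<oplus> a \<otimes> w \<otimes> r \<otimes> (\<one> \<ominus> a \<otimes> r)"
      using a r w(1) by (simp add: l_distr)
    also have "a \<otimes> w \<otimes> r \<otimes> (\<one> \<ominus> a \<otimes> r) = a \<otimes> (w \<ominus> w \<otimes> (r \<otimes> a)) \<otimes> r"
      using a r w(1) by (simp add: mult_diff_right mult_diff_left m_assoc)
    also have "(\<one> \<ominus> a \<otimes> r) \<oplus> a \<otimes> (w \<ominus> w \<otimes> (r \<otimes> a)) \<otimes> r = \<one>" unfolding wra using a r by simp
    finally have inv: "(\<one> \<oplus> a \<otimes> w \<otimes> r) \<otimes> (\<one> \<ominus> a \<otimes> r) = \<one>" .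
    have "t \<otimes> (x \<otimes> r) = a \<otimes> r" using t xc r by (simp add: a_def m_assoc)
    then show "\<exists>w\<in>carrier S. w \<otimes> (\<one> \<ominus> t \<otimes> (x \<otimes> r)) = \<one>"
      using a r w(1) by (intro bexI[where x = "\<one> \<oplus> a \<otimes> w \<otimes> r"]) (simp_all only: inv, simp)
  qed (use xc r in simp)
qed

text \<open>The element \<open>1 - e\<close> has a left inverse, yet
  \<open>(1 - e) e = 0\<close>.\<close>

lemma idempotent_in_jacobson_radical:
  assumes "e \<in> jacobson_radical S" "e \<otimes> e = e"
  shows "e = \<zero>"
proof -
  have e: "e \<in> carrier S" using assms(1) jacobson_radical_iff by blast
  obtain w where w: "w \<in> carrier S" "w \<otimes> (\<one> \<ominus> e) = \<one>"
    using assms(1) one_closed e unfolding jacobson_radical_iff by fastforce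
  have "e = w \<otimes> (\<one> \<ominus> e) \<otimes> e" using w e by simp
  also have "\<dots> = w \<otimes> (e \<ominus> e \<otimes> e)" using w(1) e by (simp add: m_assoc mult_diff_left)
  also have "\<dots> = \<zero>" using w(1) e assms(2) by (simp add: minus_eq r_neg)
  finally show ?thesis .
qed

end

subsection \<open>Compactness for cosets of definable left ideals\<close>

text \<open>The letters pp stand for positive primitive: for S as a right module over itself, these
  are the subgroups defined by the formulas \<open>\<exists>y. s = y a\<close> and
  \<open>s a = 0\<close>.\<close>

definition pp_left_ideal :: "'s ring \<Rightarrow> 's set \<Rightarrow> bool" where
  "pp_left_ideal S P \<longleftrightarrow> (\<exists>a\<in>carrier S.
     P = {y \<otimes>\<^bsub>S\<^esub> a | y. y \<in> carrier S} \<or> P = {s \<in> carrier S. s \<otimes>\<^bsub>S\<^esub> a = \<zero>\<^bsub>S\<^esub>})"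

definition pp_coset :: "'s ring \<Rightarrow> 's set \<Rightarrow> bool" where
  "pp_coset S C \<longleftrightarrow> (\<exists>a\<in>carrier S. \<exists>b\<in>carrier S.
     C = {b \<oplus>\<^bsub>S\<^esub> y \<otimes>\<^bsub>S\<^esub> a | y. y \<in> carrier S} \<or> C = {s \<in> carrier S. s \<otimes>\<^bsub>S\<^esub> a = b})"

text \<open>A fragment of algebraic compactness of S as a right module over itself. A set of the
  form \<open>{s. s a = b}\<close> may be empty; the hypothesis on finite subfamilies excludes this
  within the family.\<close>

locale pp_compact_ring = unital_ring S for S :: "'s ring" (structure) +
  assumes pp_compact: "\<lbrakk>\<And>C. C \<in> \<C> \<Longrightarrow> pp_coset S C;
      \<And>\<F>. \<lbrakk>finite \<F>; \<F> \<subseteq> \<C>\<rbrakk> \<Longrightarrow> \<exists>x\<in>carrier S. \<forall>C\<in>\<F>. x \<in> C\<rbrakk>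
    \<Longrightarrow> \<exists>x\<in>carrier S. \<forall>C\<in>\<C>. x \<in> C"
begin

lemma pp_left_ideal_left_ideal: "pp_left_ideal S P \<Longrightarrow> left_ideal P"
  using left_ideal_principal left_ideal_annihilator unfolding pp_left_ideal_def by blast

lemma pp_coset_self:
  assumes "pp_left_ideal S P"
  shows "pp_coset S P"
proof -
  obtain a where a: "a \<in> carrier S"
    "P = {y \<otimes> a | y. y \<in> carrier S} \<or> P = {s \<in> carrier S. s \<otimes> a = \<zero>}"
    using assms unfolding pp_left_ideal_def by blast
  from a(2) show ?thesis
  proof
    assume P: "P = {y \<otimes> a | y. y \<in> carrier S}"
    have "P = {\<zero> \<oplus> y \<otimes> a | y. y \<in> carrier S}"
      unfolding P using a(1) by (intro Collect_cong) (metis l_zero m_closed)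
    then show ?thesis unfolding pp_coset_def by (intro bexI[OF _ a(1)] bexI[OF _ zero_closed] disjI1)
  next
    assume "P = {s \<in> carrier S. s \<otimes> a = \<zero>}"
    then show ?thesis unfolding pp_coset_def by (intro bexI[OF _ a(1)] bexI[OF _ zero_closed] disjI2)
  qed
qed

text \<open>Supplements involve the condition \<open>1 - v \<in> N\<close>. It has to be expressed
  by cosets in the variable v before compactness can be applied to it; for an annihilator it reads
  \<open>v a = a\<close>.\<close>

lemma pp_coset_translate:
  assumes "pp_left_ideal S P"
  shows "pp_coset S {x \<in> carrier S. x \<ominus> \<one> \<in> P}"
proof -
  obtain a where a: "a \<in> carrier S"
    "P = {y \<otimes> a | y. y \<in> carrier S} \<or> P = {s \<in> carrier S. s \<otimes> a = \<zero>}"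
    using assms unfolding pp_left_ideal_def by blast
  have *: "x \<ominus> \<one> = z \<longleftrightarrow> x = \<one> \<oplus> z" if "x \<in> carrier S" "z \<in> carrier S" for x z
  proof
    assume "x \<ominus> \<one> = z"
    then have "x = z \<oplus> \<one>" using that diff_add_cancel'[of x \<one>] by simp
    then show "x = \<one> \<oplus> z" using that a_comm by simp
  next
    assume "x = \<one> \<oplus> z"
    then show "x \<ominus> \<one> = z" using that by (simp add: minus_eq a_ac r_neg)
  qed
  from a(2) show ?thesis
  proof
    assume P: "P = {y \<otimes> a | y. y \<in> carrier S}"
    have "{x \<in> carrier S. x \<ominus> \<one> \<in> P} = {\<one> \<oplus> y \<otimes> a | y. y \<in> carrier S}"
    proof (intro equalityI subsetI)
      fix x assume "x \<in> {x \<in> carrier S. x \<ominus> \<one> \<in> P}"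
      then show "x \<in> {\<one> \<oplus> y \<otimes> a | y. y \<in> carrier S}"
        unfolding P using a(1) * by blast
    next
      fix x assume "x \<in> {\<one> \<oplus> y \<otimes> a | y. y \<in> carrier S}"
      then obtain y where y: "y \<in> carrier S" "x = \<one> \<oplus> y \<otimes> a" by blast
      then have "x \<ominus> \<one> = y \<otimes> a" using a(1) * by simp
      then show "x \<in> {x \<in> carrier S. x \<ominus> \<one> \<in> P}"
        unfolding P using y a(1) by auto
    qed
    then show ?thesis using a(1) unfolding pp_coset_def by blast
  next
    assume P: "P = {s \<in> carrier S. s \<otimes> a = \<zero>}"
    have "{x \<in> carrier S. x \<ominus> \<one> \<in> P} = {x \<in> carrier S. x \<otimes> a = a}"
      unfolding P using a(1) by (auto simp: mult_diff_left)
    then show ?thesis using a(1) unfolding pp_coset_def by blast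
  qed
qed

section \<open>Closed left ideals, minimal supplements and idempotents\<close>

definition closed_left_ideal :: "'s set \<Rightarrow> bool" where
  "closed_left_ideal V \<longleftrightarrow> (\<exists>\<K>. (\<forall>P\<in>\<K>. pp_left_ideal S P) \<and> V = carrier S \<inter> \<Inter>\<K>)"

lemma closed_left_ideal_left_ideal: "closed_left_ideal V \<Longrightarrow> left_ideal V"
  unfolding closed_left_ideal_def using left_ideal_Int pp_left_ideal_left_ideal by metis

lemma pp_left_ideal_closed:
  assumes "pp_left_ideal S P"
  shows "closed_left_ideal P"
proof -
  have "P = carrier S \<inter> \<Inter>{P}" using left_ideal_subset[OF pp_left_ideal_left_ideal[OF assms]] by auto
  then show ?thesis using assms unfolding closed_left_ideal_def by (intro exI[of _ "{P}"]) auto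
qed

lemma closed_left_ideal_principal:
  "a \<in> carrier S \<Longrightarrow> closed_left_ideal {y \<otimes> a | y. y \<in> carrier S}"
  by (intro pp_left_ideal_closed) (auto simp: pp_left_ideal_def)

lemma closed_left_ideal_annihilator:
  "a \<in> carrier S \<Longrightarrow> closed_left_ideal {s \<in> carrier S. s \<otimes> a = \<zero>}"
  by (intro pp_left_ideal_closed) (auto simp: pp_left_ideal_def)

lemma closed_left_ideal_Int:
  assumes "closed_left_ideal V" "closed_left_ideal W"
  shows "closed_left_ideal (V \<inter> W)"
proof -
  obtain \<K> \<L> where "\<forall>P\<in>\<K>. pp_left_ideal S P" "V = carrier S \<inter> \<Inter>\<K>"
    "\<forall>P\<in>\<L>. pp_left_ideal S P" "W = carrier S \<inter> \<Inter>\<L>"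
    using assms unfolding closed_left_ideal_def by blast
  then show ?thesis
    unfolding closed_left_ideal_def by (intro exI[of _ "\<K> \<union> \<L>"]) auto
qed

text \<open>The condition \<open>V + N = S\<close> is written as a decomposition of 1. Minimality is
  asked only among intersections of pp left ideals, because there compactness carries the
  decomposition of 1 to the limit of a descending chain.\<close>

definition supplement :: "'s set \<Rightarrow> 's set \<Rightarrow> bool" where
  "supplement V N \<longleftrightarrow> closed_left_ideal V \<and> (\<exists>v\<in>V. \<one> \<ominus> v \<in> N) \<and>
     (\<forall>W. closed_left_ideal W \<and> W \<subseteq> V \<and> (\<exists>v\<in>W. \<one> \<ominus> v \<in> N) \<longrightarrow> W = V)"

text \<open>Zorn's lemma is applied to families of pp left ideals instead of their intersections: a
  larger family has a smaller intersection. For the union of a chain, compactness yields an element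
  v common to all members with \<open>1 - v \<in> N\<close>; the latter is imposed through the
  translates of the ideals that cut out N.\<close>

lemma supplement_exists:
  assumes N: "closed_left_ideal N" and V0: "closed_left_ideal V0"
    and v: "v \<in> V0" "\<one> \<ominus> v \<in> N"
  obtains V where "V \<subseteq> V0" "supplement V N"
proof -
  obtain \<K>0 where \<K>0: "\<forall>P\<in>\<K>0. pp_left_ideal S P" "V0 = carrier S \<inter> \<Inter>\<K>0"
    using V0 unfolding closed_left_ideal_def by blast
  obtain \<N> where \<N>: "\<forall>P\<in>\<N>. pp_left_ideal S P" "N = carrier S \<inter> \<Inter>\<N>"
    using N unfolding closed_left_ideal_def by blast
  have NI: "left_ideal N" by (rule closed_left_ideal_left_ideal[OF N])
  have neg: "x \<ominus> \<one> \<in> P \<longleftrightarrow> \<one> \<ominus> x \<in> P" if "left_ideal P" "x \<in> carrier S" for x P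
  proof -
    have "x \<ominus> \<one> = \<ominus> (\<one> \<ominus> x)" "\<one> \<ominus> x = \<ominus> (x \<ominus> \<one>)"
      using that(2) by (simp_all add: minus_eq minus_add a_comm)
    then show ?thesis using left_ideal_minus[OF that(1)] by metis
  qed
  define \<A> where "\<A> = {\<K>. \<K>0 \<subseteq> \<K> \<and> (\<forall>P\<in>\<K>. pp_left_ideal S P) \<and> (\<exists>v\<in>carrier S. v \<in> \<Inter>\<K> \<and> \<one> \<ominus> v \<in> N)}"
  have "\<exists>\<K>\<in>\<A>. \<forall>\<L>\<in>\<A>. \<K> \<subseteq> \<L> \<longrightarrow> \<L> = \<K>"
  proof (rule subset_Zorn_nonempty)
    show "\<A> \<noteq> {}" using \<K>0 v by (auto simp: \<A>_def)
    fix D assume D: "D \<noteq> {}" "subset.chain \<A> D"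
    then have DA: "\<And>\<K>. \<K> \<in> D \<Longrightarrow> \<K> \<in> \<A>" by (auto simp: subset.chain_def)
    let ?C = "\<Union>D \<union> (\<lambda>P. {x \<in> carrier S. x \<ominus> \<one> \<in> P}) ` \<N>"
    have "\<exists>x\<in>carrier S. \<forall>C\<in>?C. x \<in> C"
    proof (rule pp_compact)
      fix C assume "C \<in> ?C"
      then show "pp_coset S C"
        using DA \<N> pp_coset_self pp_coset_translate by (auto simp: \<A>_def)
    next
      fix \<F> assume \<F>: "finite \<F>" "\<F> \<subseteq> ?C"
      obtain \<K> where \<K>: "\<K> \<in> D" "\<F> \<inter> \<Union>D \<subseteq> \<K>"
        using finite_subset_Union_chain[of "\<F> \<inter> \<Union>D" D \<A>] D \<F>(1) by (metis finite_Int inf_le2)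
      then obtain x where x: "x \<in> carrier S" "x \<in> \<Inter>\<K>" "\<one> \<ominus> x \<in> N"
        using DA[OF \<K>(1)] unfolding \<A>_def by blast
      have "x \<ominus> \<one> \<in> N" using neg[OF NI x(1)] x(3) by simp
      then have xN: "x \<ominus> \<one> \<in> P" if "P \<in> \<N>" for P using that \<N>(2) by blast
      have "x \<in> C" if CF: "C \<in> \<F>" for C
      proof (cases "C \<in> \<Union>D")
        case True
        then show ?thesis using CF \<K>(2) x(2) by blast
      next
        case False
        then obtain P where "P \<in> \<N>" "C = {x \<in> carrier S. x \<ominus> \<one> \<in> P}" using CF \<F>(2) by blast
        then show ?thesis using xN x(1) by blast
      qed
      then show "\<exists>x\<in>carrier S. \<forall>C\<in>\<F>. x \<in> C" using x(1) by blast
    qed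
    then obtain x where x0: "x \<in> carrier S" "\<forall>C\<in>?C. x \<in> C" by (rule bexE)
    note x = x0(1) bspec[OF x0(2)]
    have "x \<ominus> \<one> \<in> P" if P: "P \<in> \<N>" for P
      using x(2)[OF UnI2[OF imageI[OF P]]] by simp
    then have "x \<ominus> \<one> \<in> N" unfolding \<N>(2) using x(1) by simp
    then have "\<one> \<ominus> x \<in> N" using neg[OF NI x(1)] by simp
    then show "\<Union>D \<in> \<A>"
      using DA D(1) x unfolding \<A>_def by blast
  qed
  then obtain \<K> where \<K>: "\<K> \<in> \<A>" "\<And>\<L>. \<L> \<in> \<A> \<Longrightarrow> \<K> \<subseteq> \<L> \<Longrightarrow> \<L> = \<K>" by blast
  let ?V = "carrier S \<inter> \<Inter>\<K>"
  have "supplement ?V N"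
    unfolding supplement_def
  proof (intro conjI allI impI)
    show "closed_left_ideal ?V" using \<K>(1) by (auto simp: closed_left_ideal_def \<A>_def)
    show "\<exists>v\<in>?V. \<one> \<ominus> v \<in> N" using \<K>(1) by (auto simp: \<A>_def)
    fix W assume W: "closed_left_ideal W \<and> W \<subseteq> ?V \<and> (\<exists>v\<in>W. \<one> \<ominus> v \<in> N)"
    then obtain \<L> where \<L>: "\<forall>P\<in>\<L>. pp_left_ideal S P" "W = carrier S \<inter> \<Inter>\<L>"
      unfolding closed_left_ideal_def by blast
    obtain w where w: "w \<in> W" "\<one> \<ominus> w \<in> N" using W by blast
    \<comment> \<open>The ideals that cut out a smaller W can be added to the maximal family, hence
      they already belong to it and W is not smaller.\<close>
    have "\<K> \<union> \<L> \<in> \<A>"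
      using \<K>(1) \<L> W w by (auto simp: \<A>_def intro!: bexI[of _ w])
    then have "\<L> \<subseteq> \<K>" using \<K>(2)[of "\<K> \<union> \<L>"] by blast
    then show "W = ?V" using W \<L>(2) by blast
  qed
  moreover have "?V \<subseteq> V0" using \<K>(1) \<K>0(2) by (auto simp: \<A>_def)
  ultimately show thesis using that by blast
qed

lemma supplement_eqI:
  "\<lbrakk>supplement V N; closed_left_ideal W; W \<subseteq> V; w \<in> W; \<one> \<ominus> w \<in> N\<rbrakk> \<Longrightarrow> W = V"
  unfolding supplement_def by blast

text \<open>
  Take \<open>v\<close> in a minimal supplement \<open>V\<close> of \<open>Sf\<close> with \<open>1 - v = gf\<close>. Then \<open>f - fgf = fv\<close> lies in \<open>V \<inter> Sf\<close>, and
  minimality of \<open>V\<close> makes this left ideal superfluous.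
\<close>

lemma regular_mod_jacobson_radical:
  assumes f: "f \<in> carrier S"
  shows "\<exists>g\<in>carrier S. f \<ominus> f \<otimes> g \<otimes> f \<in> jacobson_radical S"
proof -
  let ?N = "{y \<otimes> f | y. y \<in> carrier S}"
  have N: "closed_left_ideal ?N" by (rule closed_left_ideal_principal[OF f])
  have "closed_left_ideal (carrier S)"
    unfolding closed_left_ideal_def by (intro exI[of _ "{}"]) auto
  moreover have "\<one> \<ominus> \<one> \<in> ?N"
    using left_ideal_zero[OF left_ideal_principal[OF f]] by (simp add: minus_eq r_neg)
  ultimately obtain V where V: "supplement V ?N"
    using supplement_exists[OF N _ one_closed] by blast
  then have VI: "closed_left_ideal V" "left_ideal V"
    using closed_left_ideal_left_ideal by (auto simp: supplement_def)
  obtain v g where v: "v \<in> V" and g: "g \<in> carrier S" "\<one> \<ominus> v = g \<otimes> f"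
    using V unfolding supplement_def by blast
  have vc: "v \<in> carrier S" using v left_ideal_subset[OF VI(2)] by blast
  have vg: "v = \<one> \<ominus> g \<otimes> f" using diff_diff_cancel[of \<one> v] g(2) vc by simp
  have fv: "f \<ominus> f \<otimes> g \<otimes> f = f \<otimes> v" unfolding vg using f g(1) by (simp add: mult_diff_right m_assoc)
  have "f \<otimes> v \<in> jacobson_radical S"
    unfolding jacobson_radical_iff
  proof (intro conjI ballI)
    fix t assume t: "t \<in> carrier S"
    define h where "h = t \<otimes> (f \<otimes> v)"
    have hc: "h \<in> carrier S" using t f vc by (simp add: h_def)
    have hV: "h \<in> V" unfolding h_def using left_ideal_mult[OF VI(2)] t f v by blast
    have "h = (t \<otimes> (\<one> \<ominus> f \<otimes> g)) \<otimes> f"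
      unfolding h_def fv[symmetric] using t f g(1) by (simp add: m_assoc mult_diff_left)
    then have hN: "h \<in> ?N" using t f g(1) by blast
    \<comment> \<open>Intersecting V with \<open>S(1 - h)\<close> still gives a supplement, with
      witness \<open>v(1 - h)\<close>, since \<open>1 - v(1 - h) = (1 - v) + vh\<close> and h lies
      in \<open>Sf\<close>. By minimality V is contained in \<open>S(1 - h)\<close>, so
      \<open>h = y(1 - h)\<close> and \<open>1 + y\<close> is the left inverse sought.\<close>
    let ?P = "{y \<otimes> (\<one> \<ominus> h) | y. y \<in> carrier S}"
    have "closed_left_ideal (?P \<inter> V)"
      using hc VI by (intro closed_left_ideal_Int closed_left_ideal_principal) auto
    moreover have "v \<otimes> (\<one> \<ominus> h) \<in> V"
      using vc v hV hc left_ideal_diff[OF VI(2)] left_ideal_mult[OF VI(2)] by (simp add: mult_diff_right)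
    then have "v \<otimes> (\<one> \<ominus> h) \<in> ?P \<inter> V" using vc by blast
    moreover have "\<one> \<ominus> v \<otimes> (\<one> \<ominus> h) = (\<one> \<ominus> v) \<oplus> v \<otimes> h"
      using vc hc by (simp add: mult_diff_right, simp add: minus_eq minus_add a_assoc)
    then have "\<one> \<ominus> v \<otimes> (\<one> \<ominus> h) \<in> ?N"
      using left_ideal_principal[OF f] g hN vc left_ideal_add left_ideal_mult by (metis (mono_tags, lifting) mem_Collect_eq)
    ultimately have "?P \<inter> V = V" using supplement_eqI[OF V, of "?P \<inter> V"] by blast
    then obtain y where y: "y \<in> carrier S" "h = y \<otimes> (\<one> \<ominus> h)" using hV by blast
    have "(\<one> \<oplus> y) \<otimes> (\<one> \<ominus> h) = (\<one> \<ominus> h) \<oplus> y \<otimes> (\<one> \<ominus> h)" using y(1) hc by (simp add: l_distr)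
    also have "\<dots> = \<one>" unfolding y(2)[symmetric] using hc by simp
    finally show "\<exists>w\<in>carrier S. w \<otimes> (\<one> \<ominus> t \<otimes> (f \<otimes> v)) = \<one>"
      using y(1) by (auto simp: h_def)
  qed (use f vc in simp)
  then show ?thesis using g(1) fv by metis
qed

text \<open>Mutual supplements in the projective module \<open>S\<close> are complementary direct summands.\<close>

lemma exchange_property:
  assumes y: "y \<in> carrier S"
  obtains p r s where "p \<otimes> p = p" "r \<in> carrier S" "s \<in> carrier S"
    "p = r \<otimes> y" "\<one> \<ominus> p = s \<otimes> (\<one> \<ominus> y)"
proof -
  let ?Y = "{r \<otimes> y | r. r \<in> carrier S}" and ?Z = "{s \<otimes> (\<one> \<ominus> y) | s. s \<in> carrier S}"
  have Y: "closed_left_ideal ?Y" and Z: "closed_left_ideal ?Z"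
    using y by (auto intro!: closed_left_ideal_principal)
  have "\<one> \<otimes> (\<one> \<ominus> y) \<in> ?Z" "\<one> \<otimes> y \<in> ?Y" by blast+
  then have "\<one> \<ominus> y \<in> ?Z" "\<one> \<ominus> (\<one> \<ominus> y) \<in> ?Y" using y by simp_all
  then obtain V where V: "V \<subseteq> ?Z" "supplement V ?Y" using supplement_exists[OF Y Z] by blast
  then have VI: "closed_left_ideal V" "left_ideal V"
    using closed_left_ideal_left_ideal by (auto simp: supplement_def)
  obtain v where v: "v \<in> V" "\<one> \<ominus> v \<in> ?Y" using V(2) unfolding supplement_def by blast
  then have "\<one> \<ominus> (\<one> \<ominus> v) \<in> V" using left_ideal_subset[OF VI(2)] by (simp add: subset_iff)
  then obtain U where U: "U \<subseteq> ?Y" "supplement U V" using supplement_exists[OF VI(1) Y v(2)] by blast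
  then have UI: "left_ideal U"
    using closed_left_ideal_left_ideal by (auto simp: supplement_def)
  obtain p where p: "p \<in> U" "\<one> \<ominus> p \<in> V" using U(2) unfolding supplement_def by blast
  have pc: "p \<in> carrier S" using p left_ideal_subset[OF UI] by blast
  \<comment> \<open>Since \<open>1 - pp = (1 - p) + p(1 - p)\<close>, the element \<open>pp\<close>
    is a witness as good as p, so minimality of U makes it a generator of U. This yields a
    retraction of p from \<open>pp\<close>.\<close>
  have "{s \<otimes> (p \<otimes> p) | s. s \<in> carrier S} = U"
  proof (rule supplement_eqI[OF U(2)])
    show "closed_left_ideal {s \<otimes> (p \<otimes> p) | s. s \<in> carrier S}"
      using pc by (intro closed_left_ideal_principal) simp
    show "{s \<otimes> (p \<otimes> p) | s. s \<in> carrier S} \<subseteq> U"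
      using p pc left_ideal_mult[OF UI] by auto
    have "\<one> \<otimes> (p \<otimes> p) \<in> {s \<otimes> (p \<otimes> p) | s. s \<in> carrier S}" by blast
    then show "p \<otimes> p \<in> {s \<otimes> (p \<otimes> p) | s. s \<in> carrier S}" using pc by simp
    have "\<one> \<ominus> p \<otimes> p = (\<one> \<ominus> p) \<oplus> p \<otimes> (\<one> \<ominus> p)"
      using pc by (simp add: mult_diff_right, simp add: minus_eq a_assoc r_neg1 r_neg2)
    then show "\<one> \<ominus> p \<otimes> p \<in> V"
      using left_ideal_add[OF VI(2)] left_ideal_mult[OF VI(2)] p pc by simp
  qed
  then obtain s where s: "s \<in> carrier S" "p = s \<otimes> (p \<otimes> p)" using p(1) by blast
  \<comment> \<open>Now minimality of V is used. From \<open>p = spp\<close> follows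
    \<open>wp = 0\<close>, so \<open>w = w(1 - p)\<close> lies in V, while \<open>1 - w = sp\<close>
    lies in \<open>Sy\<close>. Hence all of V annihilates p, in particular \<open>1 - p\<close>
    does, and p is idempotent.\<close>
  define w where "w = \<one> \<ominus> s \<otimes> p"
  have wc: "w \<in> carrier S" using s pc by (simp add: w_def)
  have ann: "closed_left_ideal {s \<in> carrier S. s \<otimes> p = \<zero>}" by (rule closed_left_ideal_annihilator[OF pc])
  have "w \<otimes> p = p \<ominus> s \<otimes> (p \<otimes> p)"
    using s(1) pc by (simp add: w_def mult_diff_left m_assoc)
  also have "\<dots> = \<zero>" using s(2) pc by (simp add: minus_eq r_neg)
  finally have wp: "w \<otimes> p = \<zero>" .
  then have "w \<otimes> (\<one> \<ominus> p) = w" using wc pc by (simp add: mult_diff_right, simp add: minus_eq)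
  then have "w \<in> V" using left_ideal_mult[OF VI(2) wc p(2)] by simp
  moreover have "\<one> \<ominus> w \<in> ?Y"
    using s pc U(1) left_ideal_mult[OF UI s(1) p(1)] by (auto simp: w_def)
  ultimately have "{s \<in> carrier S. s \<otimes> p = \<zero>} \<inter> V = V"
    using supplement_eqI[OF V(2) closed_left_ideal_Int[OF ann VI(1)], of w] wc wp by blast
  then have "(\<one> \<ominus> p) \<otimes> p = \<zero>" using p(2) by blast
  then have "p \<ominus> p \<otimes> p = \<zero>" using pc by (simp add: mult_diff_left)
  then have "p = p \<otimes> p" using pc diff_add_cancel'[of p "p \<otimes> p"] by simp
  moreover obtain r where "r \<in> carrier S" "p = r \<otimes> y" using p(1) U(1) by blast
  moreover obtain s where "s \<in> carrier S" "\<one> \<ominus> p = s \<otimes> (\<one> \<ominus> y)" using p(2) V(1) by blast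
  ultimately show thesis using that by metis
qed

text \<open>Some \<open>1 - ta\<close> has no left inverse. The exchange property for
  \<open>ta\<close> gives an idempotent \<open>e = qa\<close>, nonzero because otherwise
  \<open>1 = s(1 - ta)\<close>. To pass from the left ideal \<open>Sa\<close> to the right ideal
  \<open>aS\<close>, e is replaced by \<open>aeq\<close>, which is idempotent and nonzero since
  \<open>q(aeq)a = e\<close>.\<close>

lemma idempotent_in_principal_right_ideal:
  assumes a: "a \<in> carrier S" "a \<notin> jacobson_radical S"
  obtains r where "r \<in> carrier S" "a \<otimes> r \<otimes> (a \<otimes> r) = a \<otimes> r" "a \<otimes> r \<noteq> \<zero>"
proof -
  obtain t where t: "t \<in> carrier S" "\<And>w. w \<in> carrier S \<Longrightarrow> w \<otimes> (\<one> \<ominus> t \<otimes> a) \<noteq> \<one>"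
    using a jacobson_radical_iff by blast
  obtain e r s where e: "e \<otimes> e = e" "r \<in> carrier S" "s \<in> carrier S" "e = r \<otimes> (t \<otimes> a)"
    "\<one> \<ominus> e = s \<otimes> (\<one> \<ominus> t \<otimes> a)"
    using exchange_property[of "t \<otimes> a"] t a by (metis m_closed)
  have ec: "e \<in> carrier S" using e t a by simp
  have e0: "e \<noteq> \<zero>" using e(3,5) t(2)[of s] by (auto simp: minus_eq[of \<one> \<zero>])
  define q where "q = r \<otimes> t"
  have q: "q \<in> carrier S" "e = q \<otimes> a" using e t a by (simp_all add: q_def m_assoc)
  have ae: "a \<otimes> (e \<otimes> q) \<otimes> (a \<otimes> (e \<otimes> q)) = a \<otimes> (e \<otimes> (q \<otimes> a) \<otimes> (e \<otimes> q))"
    using a q(1) ec by (simp add: m_assoc)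
  also have "\<dots> = a \<otimes> (e \<otimes> q)" unfolding q(2)[symmetric] using ec a q(1) e(1) by (simp add: m_assoc[symmetric])
  finally have idem: "a \<otimes> (e \<otimes> q) \<otimes> (a \<otimes> (e \<otimes> q)) = a \<otimes> (e \<otimes> q)" .
  have "q \<otimes> (a \<otimes> (e \<otimes> q)) \<otimes> a = (q \<otimes> a) \<otimes> e \<otimes> (q \<otimes> a)" using a q(1) ec by (simp add: m_assoc)
  also have "\<dots> = e" unfolding q(2)[symmetric] using e(1) by simp
  finally have "a \<otimes> (e \<otimes> q) \<noteq> \<zero>" using e0 q(1) a(1) by auto
  with idem that[of "e \<otimes> q"] ec q(1) show thesis by simp
qed

end

subsection \<open>Homomorphisms from right ideals modulo the radical\<close>

lemma carrier_FactRing: "carrier (R Quot I) = (\<lambda>x. I +>\<^bsub>R\<^esub> x) ` carrier R"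
  by (auto simp: FactRing_def A_RCOSETS_def RCOSETS_def a_r_coset_def)

context pp_compact_ring
begin

lemma von_neumann_regular_Quot: "von_neumann_regular (S Quot jacobson_radical S)"
proof -
  interpret J: ideal "jacobson_radical S" S by (rule jacobson_radical_ideal)
  interpret h: ring_hom_ring S "S Quot jacobson_radical S" "(+>) (jacobson_radical S)"
    by (rule J.rcos_ring_hom_ring)
  show ?thesis
    unfolding von_neumann_regular_def
  proof (intro conjI ballI J.quotient_is_ring)
    fix a assume "a \<in> carrier (S Quot jacobson_radical S)"
    then obtain f where f: "f \<in> carrier S" "a = jacobson_radical S +> f"
      unfolding carrier_FactRing by (rule imageE)
    obtain g where g: "g \<in> carrier S" "f \<ominus> f \<otimes> g \<otimes> f \<in> jacobson_radical S"
      using regular_mod_jacobson_radical[OF f(1)] by blast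
    have "f \<in> jacobson_radical S +> (f \<otimes> g \<otimes> f)"
      using f g J.a_rcos_module_rev[of "f \<otimes> g \<otimes> f" f] by (simp add: minus_eq)
    then have "jacobson_radical S +> (f \<otimes> g \<otimes> f) = a"
      using f g J.a_repr_independence'[of f "f \<otimes> g \<otimes> f"] by (simp del: h.hom_mult)
    then show "\<exists>b\<in>carrier (S Quot jacobson_radical S). a \<otimes>\<^bsub>S Quot jacobson_radical S\<^esub> b \<otimes>\<^bsub>S Quot jacobson_radical S\<^esub> a = a"
      using f g by (intro bexI[of _ "jacobson_radical S +> g"]) (simp_all add: h.hom_mult[symmetric] del: h.hom_mult)
  qed
qed

text \<open>The joined idempotent generates \<open>gS + eS\<close>; \<open>p\<^sub>0\<close> witnesses that this sum is direct.\<close>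

lemma idempotent_join:
  assumes c: "g \<in> carrier S" "e \<in> carrier S" "p0 \<in> carrier S" "x \<in> carrier S" "b \<in> carrier S"
    and g: "g \<otimes> g = g" and e: "e \<otimes> e = e" and p0: "p0 \<otimes> g = \<zero>" "p0 \<otimes> e = e"
  defines "p \<equiv> e \<otimes> p0"
  defines "k \<equiv> p \<oplus> g \<otimes> (\<one> \<ominus> p)" and "y \<equiv> x \<otimes> g \<otimes> (\<one> \<ominus> p) \<oplus> b \<otimes> p"
  shows "k \<otimes> k = k" "k \<otimes> g = g" "k \<otimes> e = e" "y \<otimes> g = x \<otimes> g" "y \<otimes> e = b \<otimes> e"
proof -
  \<comment> \<open>The idempotent p projects onto \<open>eS\<close> and kills \<open>gS\<close>.
    Both k and y use p on the part in \<open>eS\<close> and \<open>1 - p\<close> on the part in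
    \<open>gS\<close>.\<close>
  have pc: "p \<in> carrier S" using c by (simp add: p_def)
  have pg: "p \<otimes> g = \<zero>" and pe: "p \<otimes> e = e" using c p0 e by (simp_all add: p_def m_assoc)
  have qg: "(\<one> \<ominus> p) \<otimes> g = g" using pc c pg by (simp add: mult_diff_left, simp add: minus_eq)
  have qe: "(\<one> \<ominus> p) \<otimes> e = \<zero>" using pc c pe by (simp add: mult_diff_left)
  have kc: "k \<in> carrier S" using pc c by (simp add: k_def)
  have qc: "\<one> \<ominus> p \<in> carrier S" using pc by simp
  show kg: "k \<otimes> g = g"
    using pc qc c by (simp add: k_def l_distr m_assoc qg pg g)
  show ke: "k \<otimes> e = e"
    using pc qc c by (simp add: k_def l_distr m_assoc qe pe)
  have kp: "k \<otimes> p = p"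
    using kc c ke by (simp add: p_def m_assoc[symmetric])
  have "k \<otimes> k = k \<otimes> p \<oplus> k \<otimes> g \<otimes> (\<one> \<ominus> p)"
    using kc pc qc c by (subst (2) k_def) (simp add: r_distr m_assoc)
  then show "k \<otimes> k = k" by (simp add: kp kg) (simp add: k_def)
  show "y \<otimes> g = x \<otimes> g"
    using pc qc c by (simp add: y_def l_distr m_assoc qg pg g)
  show "y \<otimes> e = b \<otimes> e"
    using pc qc c by (simp add: y_def l_distr m_assoc qe pe)
qed

text \<open>The hypothesis on e and g is independence of \<open>eS\<close> and \<open>gS\<close>
  modulo the radical; the conclusion is exact. With w a quasi-inverse of \<open>h = (1 - g)e\<close>
  modulo J and \<open>q = 1 - wh\<close>, the product \<open>hq\<close> lies in J, so
  \<open>eq\<close> is congruent to \<open>geq\<close> and hence lies in J. Then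
  \<open>t = ew(1 - g)\<close> kills g and satisfies \<open>te = (1 - eq)e\<close>. Multiplying t by
  a left inverse of \<open>1 - eq\<close> removes the error.\<close>

lemma independent_idempotents:
  assumes c: "g \<in> carrier S" "e \<in> carrier S" and e: "e \<otimes> e = e"
    and ind: "\<And>q j. \<lbrakk>q \<in> carrier S; j \<in> jacobson_radical S; e \<otimes> q \<ominus> j \<in> {g \<otimes> r | r. r \<in> carrier S}\<rbrakk>
      \<Longrightarrow> e \<otimes> q \<in> jacobson_radical S"
    and g: "g \<otimes> g = g"
  obtains p0 where "p0 \<in> carrier S" "p0 \<otimes> g = \<zero>" "p0 \<otimes> e = e"
proof -
  note J = left_idealD[OF jacobson_radical_left_ideal]
  define h where "h = (\<one> \<ominus> g) \<otimes> e"
  have hc: "h \<in> carrier S" using c by (simp add: h_def)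
  obtain w where w: "w \<in> carrier S" "h \<ominus> h \<otimes> w \<otimes> h \<in> jacobson_radical S"
    using regular_mod_jacobson_radical[OF hc] by blast
  define q where "q = \<one> \<ominus> w \<otimes> h"
  have qc: "q \<in> carrier S" using w hc by (simp add: q_def)
  have hq: "h \<otimes> q = h \<ominus> h \<otimes> w \<otimes> h"
    using hc w(1) by (simp add: q_def mult_diff_right m_assoc)
  have "h \<otimes> q = e \<otimes> q \<ominus> g \<otimes> (e \<otimes> q)"
    using c qc by (simp add: h_def mult_diff_left m_assoc)
  then have "e \<otimes> q \<ominus> h \<otimes> q = g \<otimes> (e \<otimes> q)" using c qc by simp
  then have "e \<otimes> q \<in> jacobson_radical S"
    using ind[OF qc, of "h \<otimes> q"] w(2) c qc unfolding hq by auto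
  define t where "t = e \<otimes> w \<otimes> (\<one> \<ominus> g)"
  have tc: "t \<in> carrier S" using c w by (simp add: t_def)
  have gg: "(\<one> \<ominus> g) \<otimes> g = \<zero>" using c g by (simp add: mult_diff_left)
  have tg: "t \<otimes> g = \<zero>" using c w gg by (simp add: t_def m_assoc)
  have te: "t \<otimes> e = e \<ominus> e \<otimes> q"
    using c w hc unfolding q_def mult_diff_right[OF c(2) one_closed m_closed[OF w(1) hc]]
    by (simp add: t_def h_def m_assoc)
  obtain k where "k \<in> carrier S" "k \<otimes> (\<one> \<ominus> \<one> \<otimes> (e \<otimes> q)) = \<one>"
    using \<open>e \<otimes> q \<in> jacobson_radical S\<close> one_closed unfolding jacobson_radical_iff by blast
  then have k: "k \<in> carrier S" "k \<otimes> (\<one> \<ominus> e \<otimes> q) = \<one>" using c qc by simp_all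
  have eqe: "e \<otimes> q \<otimes> e = e \<otimes> q"
  proof -
    have he: "h \<otimes> e = h" using c e by (simp add: h_def m_assoc)
    have "e \<otimes> (w \<otimes> h) \<otimes> e = e \<otimes> (w \<otimes> h)" using c w(1) hc he by (simp add: m_assoc)
    then show ?thesis using c w(1) hc e by (simp add: q_def mult_diff_right mult_diff_left)
  qed
  have "k \<otimes> t \<otimes> e = k \<otimes> (e \<ominus> e \<otimes> q)" using k tc c te by (simp add: m_assoc)
  also have "e \<ominus> e \<otimes> q = (\<one> \<ominus> e \<otimes> q) \<otimes> e" using c qc eqe by (simp add: mult_diff_left)
  also have "k \<otimes> ((\<one> \<ominus> e \<otimes> q) \<otimes> e) = e" using k c qc by (simp add: m_assoc[symmetric])
  finally have "k \<otimes> t \<otimes> e = e" .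
  moreover have "k \<otimes> t \<otimes> g = \<zero>" using k tc c tg by (simp add: m_assoc)
  ultimately show thesis using that[of "k \<otimes> t"] k tc by simp
qed

definition right_ideal :: "'s set \<Rightarrow> bool" where
  "right_ideal N \<longleftrightarrow> N \<subseteq> carrier S \<and> \<zero> \<in> N \<and> (\<forall>a\<in>N. \<forall>b\<in>N. a \<oplus> b \<in> N) \<and>
    (\<forall>a\<in>N. \<forall>r\<in>carrier S. a \<otimes> r \<in> N)"

text \<open>The last clause says that \<open>g\<close> lies in the right ideal generated by the first components of \<open>F\<close>.\<close>

definition jointly_solvable :: "('s \<times> 's) set \<Rightarrow> bool" where
  "jointly_solvable F \<longleftrightarrow> (\<exists>g\<in>carrier S. \<exists>x\<in>carrier S. g \<otimes> g = g \<and>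
     (\<forall>(e, a)\<in>F. g \<otimes> e = e \<and> x \<otimes> e = a) \<and> (\<forall>N. right_ideal N \<and> fst ` F \<subseteq> N \<longrightarrow> g \<in> N))"

text \<open>
  Compactness gives an \<open>x\<close> that realises \<open>\<phi>\<close> on a maximal jointly solvable set of prescribed values. If
  \<open>z = \<phi> y - xy\<close> were nonzero for some \<open>y\<close>, regularity would yield a multiple \<open>v\<close> of \<open>y\<close> on whose right
  ideal \<open>\<phi> - x\<close> is injective, and an idempotent \<open>e\<close> in \<open>vS\<close> could be added to the set.
\<close>

lemma right_ideal_hom_Quot:
  defines "Q \<equiv> S Quot jacobson_radical S"
  assumes I: "I \<subseteq> carrier Q" "\<zero>\<^bsub>Q\<^esub> \<in> I" "\<And>a b. \<lbrakk>a \<in> I; b \<in> I\<rbrakk> \<Longrightarrow> a \<oplus>\<^bsub>Q\<^esub> b \<in> I"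
      "\<And>a r. \<lbrakk>a \<in> I; r \<in> carrier Q\<rbrakk> \<Longrightarrow> a \<otimes>\<^bsub>Q\<^esub> r \<in> I"
    and \<phi>: "\<And>a. a \<in> I \<Longrightarrow> \<phi> a \<in> carrier Q" "\<And>a b. \<lbrakk>a \<in> I; b \<in> I\<rbrakk> \<Longrightarrow> \<phi> (a \<oplus>\<^bsub>Q\<^esub> b) = \<phi> a \<oplus>\<^bsub>Q\<^esub> \<phi> b"
      "\<And>a r. \<lbrakk>a \<in> I; r \<in> carrier Q\<rbrakk> \<Longrightarrow> \<phi> (a \<otimes>\<^bsub>Q\<^esub> r) = \<phi> a \<otimes>\<^bsub>Q\<^esub> r"
  shows "\<exists>c\<in>carrier Q. \<forall>y\<in>I. \<phi> y = c \<otimes>\<^bsub>Q\<^esub> y"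
proof -
  let ?J = "jacobson_radical S"
  interpret J: ideal ?J S by (rule jacobson_radical_ideal)
  define \<pi> where "\<pi> = (\<lambda>x. ?J +> x)"
  interpret h: ring_hom_ring S Q \<pi>
    unfolding Q_def \<pi>_def by (rule J.rcos_ring_hom_ring)
  have \<pi>_surj: "\<exists>s\<in>carrier S. y = \<pi> s" if "y \<in> carrier Q" for y
    using that unfolding Q_def \<pi>_def carrier_FactRing by blast
  have zeroQ: "\<zero>\<^bsub>Q\<^esub> = ?J" by (simp add: Q_def FactRing_def)
  have \<pi>0: "\<pi> s = \<zero>\<^bsub>Q\<^esub> \<longleftrightarrow> s \<in> ?J" if "s \<in> carrier S" for s
    unfolding \<pi>_def zeroQ using that J.a_rcos_self J.a_rcos_const by metis
  have Jc: "s \<in> carrier S" if "s \<in> ?J" for s using that by (rule J.a_Hcarr)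
  have \<phi>0: "\<phi> \<zero>\<^bsub>Q\<^esub> = \<zero>\<^bsub>Q\<^esub>"
    using \<phi>(3)[OF I(2) h.S.zero_closed] \<phi>(1)[OF I(2)] by simp
  \<comment> \<open>A pair (e, a) stands for the equation \<open>x e = a\<close> in S itself, a lift
    of one prescribed value of \<open>\<phi>\<close>.\<close>
  define Pairs where "Pairs = {(e, a). e \<in> carrier S \<and> a \<in> carrier S \<and> \<pi> e \<in> I \<and> \<phi> (\<pi> e) = \<pi> a}"
  define \<A> where "\<A> = {F. F \<subseteq> Pairs \<and> (\<forall>G. finite G \<and> G \<subseteq> F \<longrightarrow> jointly_solvable G)}"
  have "\<exists>F\<in>\<A>. \<forall>G\<in>\<A>. F \<subseteq> G \<longrightarrow> G = F"
  proof (rule subset_Zorn_nonempty)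
    have "jointly_solvable {}"
      unfolding jointly_solvable_def
      by (intro bexI[of _ \<zero>]) (auto simp: right_ideal_def)
    then have "{} \<in> \<A>" by (auto simp: \<A>_def)
    then show "\<A> \<noteq> {}" by blast
    fix D assume D: "D \<noteq> {}" "subset.chain \<A> D"
    have "jointly_solvable G" if G: "finite G" "G \<subseteq> \<Union>D" for G
    proof -
      obtain F where "F \<in> D" "G \<subseteq> F"
        using finite_subset_Union_chain[OF G D] by metis
      then show ?thesis using D(2) G(1) by (auto simp: subset.chain_def \<A>_def)
    qed
    then show "\<Union>D \<in> \<A>" using D(2) by (auto simp: subset.chain_def \<A>_def)
  qed
  then obtain F where F: "F \<in> \<A>" "\<And>G. G \<in> \<A> \<Longrightarrow> F \<subseteq> G \<Longrightarrow> G = F" by metis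
  have FP: "\<And>e a. (e, a) \<in> F \<Longrightarrow> e \<in> carrier S \<and> a \<in> carrier S \<and> \<pi> e \<in> I \<and> \<phi> (\<pi> e) = \<pi> a"
    using F(1) by (auto simp: \<A>_def Pairs_def)
  have Fsol: "jointly_solvable G" if "finite G" "G \<subseteq> F" for G
    using F(1) that by (auto simp: \<A>_def)
  have "\<exists>x\<in>carrier S. \<forall>C\<in>(\<lambda>(e, a). {x \<in> carrier S. x \<otimes> e = a}) ` F. x \<in> C"
  proof (rule pp_compact)
    fix C assume "C \<in> (\<lambda>(e, a). {x \<in> carrier S. x \<otimes> e = a}) ` F"
    then obtain e a where "(e, a) \<in> F" "C = {x \<in> carrier S. x \<otimes> e = a}" by auto
    then show "pp_coset S C" using FP unfolding pp_coset_def by blast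
  next
    fix \<F> assume "finite \<F>" "\<F> \<subseteq> (\<lambda>(e, a). {x \<in> carrier S. x \<otimes> e = a}) ` F"
    then obtain G where G: "G \<subseteq> F" "finite G" "\<F> = (\<lambda>(e, a). {x \<in> carrier S. x \<otimes> e = a}) ` G"
      by (metis (no_types, lifting) finite_subset_image)
    obtain g x where "x \<in> carrier S" "\<forall>(e, a)\<in>G. g \<otimes> e = e \<and> x \<otimes> e = a"
      using Fsol[OF G(2,1)] unfolding jointly_solvable_def by blast
    then show "\<exists>x\<in>carrier S. \<forall>C\<in>\<F>. x \<in> C" unfolding G(3) by auto
  qed
  then obtain x where x: "x \<in> carrier S" "\<And>e a. (e, a) \<in> F \<Longrightarrow> x \<otimes> e = a" by fastforce
  \<comment> \<open>The part of the domain on which \<open>\<phi>\<close> is already left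
    multiplication by x. Being a right ideal that contains all first components of F, it also
    contains each idempotent g that certifies a finite part of F.\<close>
  define N where "N = {s \<in> carrier S. \<pi> s \<in> I \<and> \<phi> (\<pi> s) = \<pi> x \<otimes>\<^bsub>Q\<^esub> \<pi> s}"
  have N: "right_ideal N"
    unfolding right_ideal_def N_def
    using I \<phi> \<phi>0 x(1) by (auto simp: h.S.r_distr h.S.m_assoc)
  have FN: "fst ` F \<subseteq> N"
  proof
    fix e assume "e \<in> fst ` F"
    then obtain a where ea: "(e, a) \<in> F" by auto
    then have "\<pi> a = \<pi> x \<otimes>\<^bsub>Q\<^esub> \<pi> e" using x(2)[OF ea] FP[OF ea] x(1) h.hom_mult by metis
    then show "e \<in> N" using FP[OF ea] by (simp add: N_def)
  qed
  have JN: "?J \<subseteq> N"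
  proof
    fix j assume j: "j \<in> ?J"
    then have "\<pi> j = \<zero>\<^bsub>Q\<^esub>" using \<pi>0[OF Jc[OF j]] by simp
    then show "j \<in> N" using Jc[OF j] I(2) \<phi>0 x(1) by (simp add: N_def)
  qed
  have "\<phi> y = \<pi> x \<otimes>\<^bsub>Q\<^esub> y" if y: "y \<in> I" for y
  proof (rule ccontr)
    assume neq: "\<phi> y \<noteq> \<pi> x \<otimes>\<^bsub>Q\<^esub> y"
    have yc: "y \<in> carrier Q" using y I(1) by blast
    define z where "z = \<phi> y \<ominus>\<^bsub>Q\<^esub> \<pi> x \<otimes>\<^bsub>Q\<^esub> y"
    have zc: "z \<in> carrier Q" using \<phi>(1)[OF y] x(1) yc by (simp add: z_def)
    have zadd: "\<phi> y = z \<oplus>\<^bsub>Q\<^esub> \<pi> x \<otimes>\<^bsub>Q\<^esub> y"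
      using \<phi>(1)[OF y] x(1) yc by (simp add: z_def h.S.minus_eq h.S.a_assoc h.S.l_neg)
    have z0: "z \<noteq> \<zero>\<^bsub>Q\<^esub>"
    proof
      assume "z = \<zero>\<^bsub>Q\<^esub>"
      with zadd have "\<phi> y = \<pi> x \<otimes>\<^bsub>Q\<^esub> y" using x(1) yc by (simp only: h.S.l_zero h.S.m_closed h.hom_closed)
      with neq show False by (rule notE)
    qed
    obtain w where w: "w \<in> carrier Q" "z \<otimes>\<^bsub>Q\<^esub> w \<otimes>\<^bsub>Q\<^esub> z = z"
      using von_neumann_regular_Quot zc unfolding von_neumann_regular_def Q_def[symmetric] by blast
    \<comment> \<open>On the right ideal generated by \<open>yu\<close> the map
      \<open>\<phi>\<close> minus left multiplication by x is injective: its value at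
      \<open>yur\<close> is \<open>zr\<close>, and \<open>zr = 0\<close> forces
      \<open>ur = wzr = 0\<close>.\<close>
    define u where "u = w \<otimes>\<^bsub>Q\<^esub> z"
    have uc: "u \<in> carrier Q" and zu: "z \<otimes>\<^bsub>Q\<^esub> u = z"
      using w zc by (simp_all add: u_def h.S.m_assoc)
    have step: "\<phi> (y \<otimes>\<^bsub>Q\<^esub> u \<otimes>\<^bsub>Q\<^esub> r) = z \<otimes>\<^bsub>Q\<^esub> r \<oplus>\<^bsub>Q\<^esub> \<pi> x \<otimes>\<^bsub>Q\<^esub> (y \<otimes>\<^bsub>Q\<^esub> u \<otimes>\<^bsub>Q\<^esub> r)"
      if r: "r \<in> carrier Q" for r
    proof -
      have "\<phi> (y \<otimes>\<^bsub>Q\<^esub> u \<otimes>\<^bsub>Q\<^esub> r) = (z \<oplus>\<^bsub>Q\<^esub> \<pi> x \<otimes>\<^bsub>Q\<^esub> y) \<otimes>\<^bsub>Q\<^esub> u \<otimes>\<^bsub>Q\<^esub> r"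
        using \<phi>(3) I(4) y uc r zadd by simp
      also have "\<dots> = (z \<otimes>\<^bsub>Q\<^esub> u) \<otimes>\<^bsub>Q\<^esub> r \<oplus>\<^bsub>Q\<^esub> \<pi> x \<otimes>\<^bsub>Q\<^esub> (y \<otimes>\<^bsub>Q\<^esub> u \<otimes>\<^bsub>Q\<^esub> r)"
        using zc x(1) yc uc r by (simp add: h.S.l_distr h.S.m_assoc)
      finally show ?thesis unfolding zu .
    qed
    have zr: "y \<otimes>\<^bsub>Q\<^esub> u \<otimes>\<^bsub>Q\<^esub> r = \<zero>\<^bsub>Q\<^esub>" if r: "r \<in> carrier Q"
      and eq: "\<phi> (y \<otimes>\<^bsub>Q\<^esub> u \<otimes>\<^bsub>Q\<^esub> r) = \<pi> x \<otimes>\<^bsub>Q\<^esub> (y \<otimes>\<^bsub>Q\<^esub> u \<otimes>\<^bsub>Q\<^esub> r)" for r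
    proof -
      have "z \<otimes>\<^bsub>Q\<^esub> r = \<zero>\<^bsub>Q\<^esub>"
        using h.S.add.r_cancel_one[of "\<pi> x \<otimes>\<^bsub>Q\<^esub> (y \<otimes>\<^bsub>Q\<^esub> u \<otimes>\<^bsub>Q\<^esub> r)" "z \<otimes>\<^bsub>Q\<^esub> r"]
          step[OF r] eq zc x(1) yc uc r
        by (simp only: h.S.m_closed h.hom_closed simp_thms partial_object.simps monoid.simps)
      then show ?thesis using w(1) zc yc r by (simp add: u_def h.S.m_assoc)
    qed
    obtain v where v: "v \<in> carrier S" "y \<otimes>\<^bsub>Q\<^esub> u = \<pi> v" using \<pi>_surj[of "y \<otimes>\<^bsub>Q\<^esub> u"] yc uc by auto
    have vI: "\<pi> v \<in> I" using I(4)[OF y uc] v by simp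
    have "v \<notin> ?J"
    proof
      assume "v \<in> ?J"
      then have "\<pi> v = \<zero>\<^bsub>Q\<^esub>" using \<pi>0 v by simp
      then have "\<zero>\<^bsub>Q\<^esub> = z"
        using step[OF h.S.one_closed] v zc x(1) \<phi>0 by simp
      then show False using z0 by simp
    qed
    then obtain r where r: "r \<in> carrier S" "v \<otimes> r \<otimes> (v \<otimes> r) = v \<otimes> r" "v \<otimes> r \<noteq> \<zero>"
      using idempotent_in_principal_right_ideal[OF v(1)] by metis
    define e where "e = v \<otimes> r"
    have e: "e \<in> carrier S" "e \<otimes> e = e" "e \<noteq> \<zero>" using v r by (simp_all add: e_def)
    have eI: "\<pi> e \<in> I" using I(4)[OF vI h.hom_closed[OF r(1)]] v r by (simp add: e_def)
    have indep: "e \<otimes> q \<in> ?J" if q: "q \<in> carrier S" and eq: "e \<otimes> q \<in> N" for q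
    proof -
      have "\<pi> (e \<otimes> q) = y \<otimes>\<^bsub>Q\<^esub> u \<otimes>\<^bsub>Q\<^esub> (\<pi> r \<otimes>\<^bsub>Q\<^esub> \<pi> q)"
        using v r(1) q by (simp add: e_def h.S.m_assoc)
      moreover have "\<phi> (\<pi> (e \<otimes> q)) = \<pi> x \<otimes>\<^bsub>Q\<^esub> \<pi> (e \<otimes> q)" using eq by (simp add: N_def)
      ultimately have "\<pi> (e \<otimes> q) = \<zero>\<^bsub>Q\<^esub>"
        using zr[of "\<pi> r \<otimes>\<^bsub>Q\<^esub> \<pi> q"] r(1) q by simp
      then show ?thesis using \<pi>0[OF m_closed[OF e(1) q]] by (rule iffD1[rotated])
    qed
    obtain b where b: "b \<in> carrier S" "\<phi> (\<pi> e) = \<pi> b" using \<pi>_surj \<phi>(1)[OF eI] by metis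
    \<comment> \<open>For idempotent e, an equation \<open>x e = a\<close> forces
      \<open>a = a e\<close>. The lift b is therefore replaced by \<open>be\<close>, a lift of the
      same value.\<close>
    have be: "\<phi> (\<pi> e) = \<pi> (b \<otimes> e)"
    proof -
      have "\<phi> (\<pi> e \<otimes>\<^bsub>Q\<^esub> \<pi> e) = \<pi> b \<otimes>\<^bsub>Q\<^esub> \<pi> e" using \<phi>(3)[OF eI] e b by simp
      moreover have "\<pi> e \<otimes>\<^bsub>Q\<^esub> \<pi> e = \<pi> e" using e(1,2) by (metis h.hom_mult)
      ultimately show ?thesis using b(1) e(1) by simp
    qed
    have "insert (e, b \<otimes> e) F \<in> \<A>"
      unfolding \<A>_def
    proof (intro CollectI conjI allI impI)
      show "insert (e, b \<otimes> e) F \<subseteq> Pairs"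
        using F(1) e b eI be by (auto simp: \<A>_def Pairs_def)
      fix G assume G: "finite G \<and> G \<subseteq> insert (e, b \<otimes> e) F"
      show "jointly_solvable G"
      proof (cases "(e, b \<otimes> e) \<in> G")
        case False
        then show ?thesis using G Fsol by blast
      next
        case eG: True
        define G' where "G' = G - {(e, b \<otimes> e)}"
        have G': "finite G'" "G' \<subseteq> F" using G by (auto simp: G'_def)
        obtain g x' where g: "g \<in> carrier S" "g \<otimes> g = g" and x': "x' \<in> carrier S"
          and sol: "\<And>f a. (f, a) \<in> G' \<Longrightarrow> g \<otimes> f = f \<and> x' \<otimes> f = a"
          and gen: "\<And>M. right_ideal M \<Longrightarrow> fst ` G' \<subseteq> M \<Longrightarrow> g \<in> M"
        proof -
          obtain g x' where *: "g \<in> carrier S" "g \<otimes> g = g" "x' \<in> carrier S"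
            "\<forall>(f, a)\<in>G'. g \<otimes> f = f \<and> x' \<otimes> f = a"
            "\<forall>M. right_ideal M \<and> fst ` G' \<subseteq> M \<longrightarrow> g \<in> M"
            using Fsol[OF G'] unfolding jointly_solvable_def by blast
          have "g \<otimes> f = f \<and> x' \<otimes> f = a" if "(f, a) \<in> G'" for f a using bspec[OF *(4) that] by simp
          moreover have "g \<in> M" if "right_ideal M" "fst ` G' \<subseteq> M" for M using *(5) that by simp
          ultimately show thesis by (rule that[OF *(1-3)])
        qed
        \<comment> \<open>Because g lies in N, independence of \<open>eS\<close> from N modulo the
          radical implies independence from \<open>gS\<close>, whatever finite part of F is under
          consideration.\<close>
        have gN: "g \<in> N" by (rule gen[OF N]) (use FN G'(2) in auto)
        have ind: "e \<otimes> q \<in> ?J" if q: "q \<in> carrier S" and j: "j \<in> ?J"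
          and gs: "e \<otimes> q \<ominus> j \<in> {g \<otimes> s | s. s \<in> carrier S}" for q j
        proof -
          obtain s where s: "s \<in> carrier S" "e \<otimes> q \<ominus> j = g \<otimes> s" using gs by auto
          have "e \<otimes> q = g \<otimes> s \<oplus> j" using s(2)[symmetric] e(1) q Jc[OF j] by simp
          moreover have "g \<otimes> s \<in> N" "j \<in> N" using gN N s(1) JN j by (auto simp: right_ideal_def)
          ultimately have "e \<otimes> q \<in> N" using N by (simp add: right_ideal_def)
          then show ?thesis using indep[OF q] by simp
        qed
        obtain p0 where p0: "p0 \<in> carrier S" "p0 \<otimes> g = \<zero>" "p0 \<otimes> e = e"
          by (rule independent_idempotents[OF g(1) e(1,2) ind g(2)])
        note join = idempotent_join[OF g(1) e(1) p0(1) x' b(1) g(2) e(2) p0(2,3)]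
        let ?p = "e \<otimes> p0"
        let ?k = "?p \<oplus> g \<otimes> (\<one> \<ominus> ?p)" and ?y = "x' \<otimes> g \<otimes> (\<one> \<ominus> ?p) \<oplus> b \<otimes> ?p"
        have kc: "?k \<in> carrier S" "?y \<in> carrier S" using g e p0 x' b by simp_all
        have "?k \<otimes> f = f \<and> ?y \<otimes> f = a" if fa: "(f, a) \<in> G" for f a
        proof (cases "(f, a) = (e, b \<otimes> e)")
          case True
          then show ?thesis using join by simp
        next
          case False
          then have fG: "(f, a) \<in> G'" using fa by (simp add: G'_def)
          then have fc: "f \<in> carrier S" using FP G'(2) by blast
          have gf: "g \<otimes> f = f" "x' \<otimes> f = a" using sol[OF fG] by auto
          \<comment> \<open>Since \<open>f = gf\<close>, the values at f follow from those at
            g.\<close>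
          have "?k \<otimes> f = ?k \<otimes> g \<otimes> f" "?y \<otimes> f = ?y \<otimes> g \<otimes> f"
            using m_assoc[OF kc(1) g(1) fc] m_assoc[OF kc(2) g(1) fc] gf by simp_all
          moreover have "x' \<otimes> g \<otimes> f = a" using m_assoc[OF x' g(1) fc] gf by simp
          ultimately show ?thesis unfolding join(2,4) using gf by simp
        qed
        moreover have "?k \<in> M" if M: "right_ideal M" "fst ` G \<subseteq> M" for M
        proof -
          have "e \<in> M" "fst ` G' \<subseteq> M" using M(2) eG by (auto simp: G'_def)
          then have "?p \<in> M" "g \<otimes> (\<one> \<ominus> ?p) \<in> M"
            using gen[OF M(1)] M(1) p0(1) e(1) by (auto simp: right_ideal_def)
          then show ?thesis using M(1) by (simp add: right_ideal_def)
        qed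
        ultimately show ?thesis
          unfolding jointly_solvable_def using kc join(1) by (intro bexI[OF _ kc(1)] bexI[OF _ kc(2)]) auto
      qed
    qed
    then have "(e, b \<otimes> e) \<in> F" using F(2) by blast
    then have "e \<in> N" using FN by force
    then have "e \<in> ?J" using indep[OF one_closed] e(1) by simp
    then show False using idempotent_in_jacobson_radical e by blast
  qed
  then show ?thesis using x(1) by auto
qed

end

lemma ring_opposite_ring:
  assumes "ring T"
  shows "ring (opposite_ring T)"
proof -
  interpret T: ring T by fact
  have ab: "abelian_group (opposite_ring T)"
    by (rule abelian_groupI)
      (auto simp: opposite_ring_def T.a_ac intro!: bexI[of _ "\<ominus>\<^bsub>T\<^esub> _"] T.l_neg)
  have "Group.monoid (opposite_ring T)"
    by (rule monoidI) (auto simp: opposite_ring_def T.m_assoc)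
  with ab show ?thesis
    by (intro ringI) (auto simp: opposite_ring_def T.l_distr T.r_distr)
qed

subsection \<open>Baer's criterion\<close>

text \<open>Graphs make extension an inclusion and give a chain its union as upper bound.
  Single-valuedness need only be demanded over 0, because differences of pairs stay in the
  graph.\<close>

definition partial_hom_graph ::
    "'r ring \<Rightarrow> ('r, 'b) module \<Rightarrow> ('r, 'm) module \<Rightarrow> ('b \<times> 'm) set \<Rightarrow> bool" where
  "partial_hom_graph T B M G \<longleftrightarrow> G \<subseteq> carrier B \<times> carrier M \<and>
     (\<forall>x y x' y'. (x, y) \<in> G \<longrightarrow> (x', y') \<in> G \<longrightarrow> (x \<oplus>\<^bsub>B\<^esub> x', y \<oplus>\<^bsub>M\<^esub> y') \<in> G) \<and>
     (\<forall>r x y. r \<in> carrier T \<longrightarrow> (x, y) \<in> G \<longrightarrow> (r \<odot>\<^bsub>B\<^esub> x, r \<odot>\<^bsub>M\<^esub> y) \<in> G) \<and>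
     (\<forall>y. (\<zero>\<^bsub>B\<^esub>, y) \<in> G \<longrightarrow> y = \<zero>\<^bsub>M\<^esub>)"

lemma partial_hom_graphD:
  assumes "partial_hom_graph T B M G"
  shows "(x, y) \<in> G \<Longrightarrow> x \<in> carrier B" "(x, y) \<in> G \<Longrightarrow> y \<in> carrier M"
    "\<lbrakk>(x, y) \<in> G; (x', y') \<in> G\<rbrakk> \<Longrightarrow> (x \<oplus>\<^bsub>B\<^esub> x', y \<oplus>\<^bsub>M\<^esub> y') \<in> G"
    "\<lbrakk>r \<in> carrier T; (x, y) \<in> G\<rbrakk> \<Longrightarrow> (r \<odot>\<^bsub>B\<^esub> x, r \<odot>\<^bsub>M\<^esub> y) \<in> G"
    "(\<zero>\<^bsub>B\<^esub>, y) \<in> G \<Longrightarrow> y = \<zero>\<^bsub>M\<^esub>"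
  using assms unfolding partial_hom_graph_def by blast+

lemma partial_hom_graph_unique:
  assumes B: "left_module T B" and M: "left_module T M" and G: "partial_hom_graph T B M G"
    and xy: "(x, y) \<in> G" "(x, y') \<in> G"
  shows "y = y'"
proof -
  interpret B: left_module T B by fact
  interpret M: left_module T M by fact
  note D = partial_hom_graphD[OF G]
  have "(\<ominus>\<^bsub>B\<^esub> x, \<ominus>\<^bsub>M\<^esub> y') \<in> G"
    using D(4)[OF _ xy(2), of "\<ominus>\<^bsub>T\<^esub> \<one>\<^bsub>T\<^esub>"] D(1,2)[OF xy(2)]
    by (simp add: B.smult_minus_one M.smult_minus_one)
  from D(3)[OF xy(1) this] have "y \<oplus>\<^bsub>M\<^esub> \<ominus>\<^bsub>M\<^esub> y' = \<zero>\<^bsub>M\<^esub>"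
    using D(1)[OF xy(1)] by (intro D(5)) (simp add: B.r_neg)
  then show ?thesis
    using D(2)[OF xy(1)] D(2)[OF xy(2)] M.minus_equality M.minus_minus by (metis M.a_inv_closed M.a_comm)
qed

text \<open>Single-valuedness is the point: if \<open>x + rb = 0\<close> with (x, y) in G, then the
  pair of \<open>rb\<close> and \<open>-y\<close> lies in G, so compatibility gives
  \<open>rc = -y\<close>.\<close>

lemma partial_hom_graph_extend:
  assumes B: "left_module T B" and M: "left_module T M" and G: "partial_hom_graph T B M G"
    and b: "b \<in> carrier B" and c: "c \<in> carrier M"
    and compat: "\<And>r y. \<lbrakk>r \<in> carrier T; (r \<odot>\<^bsub>B\<^esub> b, y) \<in> G\<rbrakk> \<Longrightarrow> y = r \<odot>\<^bsub>M\<^esub> c"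
  shows "partial_hom_graph T B M
    {(x \<oplus>\<^bsub>B\<^esub> r \<odot>\<^bsub>B\<^esub> b, y \<oplus>\<^bsub>M\<^esub> r \<odot>\<^bsub>M\<^esub> c) | x y r. (x, y) \<in> G \<and> r \<in> carrier T}"
    (is "partial_hom_graph T B M ?G")
proof -
  interpret B: left_module T B by fact
  interpret M: left_module T M by fact
  note D = partial_hom_graphD[OF G]
  have GI: "(x', y') \<in> ?G" if "(x, y) \<in> G" "r \<in> carrier T"
    "x' = x \<oplus>\<^bsub>B\<^esub> r \<odot>\<^bsub>B\<^esub> b" "y' = y \<oplus>\<^bsub>M\<^esub> r \<odot>\<^bsub>M\<^esub> c" for x y r x' y'
    using that by blast
  show ?thesis
    unfolding partial_hom_graph_def
  proof (intro conjI allI impI)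
    show "?G \<subseteq> carrier B \<times> carrier M" using D(1,2) b c by auto
    fix p q p' q' assume "(p, q) \<in> ?G" "(p', q') \<in> ?G"
    then obtain x y r x' y' r' where *: "(x, y) \<in> G" "(x', y') \<in> G" "r \<in> carrier T" "r' \<in> carrier T"
      "p = x \<oplus>\<^bsub>B\<^esub> r \<odot>\<^bsub>B\<^esub> b" "q = y \<oplus>\<^bsub>M\<^esub> r \<odot>\<^bsub>M\<^esub> c"
      "p' = x' \<oplus>\<^bsub>B\<^esub> r' \<odot>\<^bsub>B\<^esub> b" "q' = y' \<oplus>\<^bsub>M\<^esub> r' \<odot>\<^bsub>M\<^esub> c"
      by blast
    show "(p \<oplus>\<^bsub>B\<^esub> p', q \<oplus>\<^bsub>M\<^esub> q') \<in> ?G"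
    proof (rule GI[OF D(3)[OF *(1,2)] B.R.a_closed[OF *(3,4)]])
      show "p \<oplus>\<^bsub>B\<^esub> p' = x \<oplus>\<^bsub>B\<^esub> x' \<oplus>\<^bsub>B\<^esub> (r \<oplus>\<^bsub>T\<^esub> r') \<odot>\<^bsub>B\<^esub> b"
        using * D(1)[OF *(1)] D(1)[OF *(2)] b by (simp add: B.smult_l_distr B.a_ac)
      show "q \<oplus>\<^bsub>M\<^esub> q' = y \<oplus>\<^bsub>M\<^esub> y' \<oplus>\<^bsub>M\<^esub> (r \<oplus>\<^bsub>T\<^esub> r') \<odot>\<^bsub>M\<^esub> c"
        using * D(2)[OF *(1)] D(2)[OF *(2)] c by (simp add: M.smult_l_distr M.a_ac)
    qed
  next
    fix s p q assume s: "s \<in> carrier T" and "(p, q) \<in> ?G"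
    then obtain x y r where *: "(x, y) \<in> G" "r \<in> carrier T"
      "p = x \<oplus>\<^bsub>B\<^esub> r \<odot>\<^bsub>B\<^esub> b" "q = y \<oplus>\<^bsub>M\<^esub> r \<odot>\<^bsub>M\<^esub> c"
      by blast
    show "(s \<odot>\<^bsub>B\<^esub> p, s \<odot>\<^bsub>M\<^esub> q) \<in> ?G"
    proof (rule GI[OF D(4)[OF s *(1)] B.R.m_closed[OF s *(2)]])
      show "s \<odot>\<^bsub>B\<^esub> p = s \<odot>\<^bsub>B\<^esub> x \<oplus>\<^bsub>B\<^esub> (s \<otimes>\<^bsub>T\<^esub> r) \<odot>\<^bsub>B\<^esub> b"
        using * s D(1)[OF *(1)] b by (simp add: B.smult_r_distr B.smult_assoc)
      show "s \<odot>\<^bsub>M\<^esub> q = s \<odot>\<^bsub>M\<^esub> y \<oplus>\<^bsub>M\<^esub> (s \<otimes>\<^bsub>T\<^esub> r) \<odot>\<^bsub>M\<^esub> c"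
        using * s D(2)[OF *(1)] c by (simp add: M.smult_r_distr M.smult_assoc)
    qed
  next
    fix q assume "(\<zero>\<^bsub>B\<^esub>, q) \<in> ?G"
    then obtain x y r where *: "(x, y) \<in> G" "r \<in> carrier T"
      "x \<oplus>\<^bsub>B\<^esub> r \<odot>\<^bsub>B\<^esub> b = \<zero>\<^bsub>B\<^esub>" "q = y \<oplus>\<^bsub>M\<^esub> r \<odot>\<^bsub>M\<^esub> c"
      by auto
    have xy: "x \<in> carrier B" "y \<in> carrier M" using D(1,2)[OF *(1)] by auto
    have "r \<odot>\<^bsub>B\<^esub> b \<oplus>\<^bsub>B\<^esub> x = \<zero>\<^bsub>B\<^esub>" using *(2,3) xy b by (simp add: B.a_comm)
    then have "\<ominus>\<^bsub>B\<^esub> x = r \<odot>\<^bsub>B\<^esub> b" using *(2) xy b by (intro B.minus_equality) auto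
    then have "(r \<odot>\<^bsub>B\<^esub> b, \<ominus>\<^bsub>M\<^esub> y) \<in> G"
      using D(4)[OF _ *(1), of "\<ominus>\<^bsub>T\<^esub> \<one>\<^bsub>T\<^esub>"] xy by (simp add: B.smult_minus_one M.smult_minus_one)
    then have "r \<odot>\<^bsub>M\<^esub> c = \<ominus>\<^bsub>M\<^esub> y" using compat[OF *(2)] by simp
    then show "q = \<zero>\<^bsub>M\<^esub>" using xy by (simp add: *(4) M.r_neg)
  qed
qed

text \<open>For a maximal graph above f and any b, the ideal of all r with \<open>rb\<close> in the
  domain carries a homomorphism; the element representing it is an admissible image of b. The ideals
  do not involve \<open>'b\<close>, so injectivity results for test modules of every element
  type.\<close>

lemma Baer_criterion:
  fixes T :: "'r ring" and M :: "('r, 'm) module"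
  assumes M: "left_module T M"
    and Baer: "\<And>I \<phi>. \<lbrakk>submodule I T (regular_module T);
        \<phi> \<in> module_homs T ((regular_module T)\<lparr>carrier := I\<rparr>) M\<rbrakk>
      \<Longrightarrow> \<exists>c\<in>carrier M. \<forall>r\<in>I. \<phi> r = r \<odot>\<^bsub>M\<^esub> c"
  shows "injective_module TYPE('b) T M"
  unfolding injective_module_def
proof (intro conjI allI impI ballI M)
  fix B :: "('r, 'b) module" and K f
  assume BK: "left_module T B \<and> submodule K T B" and f: "f \<in> module_homs T (B\<lparr>carrier := K\<rparr>) M"
  then have B: "left_module T B" by simp
  interpret B: left_module T B by (rule B)
  interpret M: left_module T M by (rule M)
  interpret K: submodule K T B using BK by simp
  interpret T: unital_ring T by (intro unital_ring.intro B.R.ring_axioms)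
  have Kc: "x \<in> carrier B" if "x \<in> K" for x using K.subset that by auto
  have f0: "f \<zero>\<^bsub>B\<^esub> = \<zero>\<^bsub>M\<^esub>"
  proof -
    have "\<zero>\<^bsub>B\<^esub> \<in> K" using K.one_closed by simp
    then have "f (\<zero>\<^bsub>T\<^esub> \<odot>\<^bsub>B\<^esub> \<zero>\<^bsub>B\<^esub>) = \<zero>\<^bsub>T\<^esub> \<odot>\<^bsub>M\<^esub> f \<zero>\<^bsub>B\<^esub>" "f \<zero>\<^bsub>B\<^esub> \<in> carrier M"
      using module_homs_smult[OF f, of "\<zero>\<^bsub>T\<^esub>" "\<zero>\<^bsub>B\<^esub>"] module_homs_closed[OF f, of "\<zero>\<^bsub>B\<^esub>"] by simp_all
    then show ?thesis by simp
  qed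
  define \<A> where "\<A> = {G. partial_hom_graph T B M G \<and> (\<lambda>x. (x, f x)) ` K \<subseteq> G}"
  have "\<exists>G\<in>\<A>. \<forall>H\<in>\<A>. G \<subseteq> H \<longrightarrow> H = G"
  proof (rule subset_Zorn_nonempty)
    have "partial_hom_graph T B M ((\<lambda>x. (x, f x)) ` K)"
      unfolding partial_hom_graph_def
      using Kc module_homsD[OF f] K.m_closed K.smult_closed f0
      by (auto simp: image_iff)
    then show "\<A> \<noteq> {}" by (auto simp: \<A>_def)
    fix C assume C: "C \<noteq> {}" "subset.chain \<A> C"
    then have CA: "G \<in> C \<Longrightarrow> partial_hom_graph T B M G \<and> (\<lambda>x. (x, f x)) ` K \<subseteq> G" for G
      by (auto simp: subset.chain_def \<A>_def)
    have "partial_hom_graph T B M (\<Union>C)"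
      unfolding partial_hom_graph_def
    proof (intro conjI allI impI)
      show "\<Union>C \<subseteq> carrier B \<times> carrier M"
      proof (rule Union_least)
        fix G assume "G \<in> C"
        then show "G \<subseteq> carrier B \<times> carrier M" using CA[of G] by (simp add: partial_hom_graph_def)
      qed
      fix x y x' y' assume "(x, y) \<in> \<Union>C" "(x', y') \<in> \<Union>C"
      then obtain G H where GH: "G \<in> C" "H \<in> C" "(x, y) \<in> G" "(x', y') \<in> H" by auto
      then have "G \<subseteq> H \<or> H \<subseteq> G" using C(2) by (auto simp: subset.chain_def)
      then obtain U where "U \<in> C" "(x, y) \<in> U" "(x', y') \<in> U" using GH by blast
      then show "(x \<oplus>\<^bsub>B\<^esub> x', y \<oplus>\<^bsub>M\<^esub> y') \<in> \<Union>C"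
        using CA partial_hom_graphD(3) by (metis UnionI)
    next
      fix r x y assume r: "r \<in> carrier T" and "(x, y) \<in> \<Union>C"
      then obtain G where "G \<in> C" "(x, y) \<in> G" by auto
      then show "(r \<odot>\<^bsub>B\<^esub> x, r \<odot>\<^bsub>M\<^esub> y) \<in> \<Union>C"
        using CA partial_hom_graphD(4)[OF _ r] by (metis UnionI)
    next
      fix y assume "(\<zero>\<^bsub>B\<^esub>, y) \<in> \<Union>C"
      then obtain G where G: "G \<in> C" "(\<zero>\<^bsub>B\<^esub>, y) \<in> G" by auto
      show "y = \<zero>\<^bsub>M\<^esub>" using partial_hom_graphD(5)[OF conjunct1[OF CA[OF G(1)]] G(2)] .
    qed
    then show "\<Union>C \<in> \<A>" using C(1) CA by (auto simp: \<A>_def)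
  qed
  then obtain G where G: "G \<in> \<A>" "\<And>H. H \<in> \<A> \<Longrightarrow> G \<subseteq> H \<Longrightarrow> H = G" by metis
  have PG: "partial_hom_graph T B M G" and KG: "\<And>x. x \<in> K \<Longrightarrow> (x, f x) \<in> G"
    using G(1) by (auto simp: \<A>_def)
  note D = partial_hom_graphD[OF PG]
  note uniq = partial_hom_graph_unique[OF B M PG]
  have zG: "(\<zero>\<^bsub>B\<^esub>, \<zero>\<^bsub>M\<^esub>) \<in> G" using KG[of "\<zero>\<^bsub>B\<^esub>"] K.one_closed f0 by simp
  have dom: "\<exists>y. (b, y) \<in> G" if b: "b \<in> carrier B" for b
  proof -
    define I where "I = {r \<in> carrier T. \<exists>y. (r \<odot>\<^bsub>B\<^esub> b, y) \<in> G}"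
    define \<phi> where "\<phi> r = (SOME y. (r \<odot>\<^bsub>B\<^esub> b, y) \<in> G)" for r
    have \<phi>: "(r \<odot>\<^bsub>B\<^esub> b, \<phi> r) \<in> G" if "r \<in> I" for r
      using that unfolding I_def \<phi>_def by (auto intro: someI)
    have \<phi>_eq: "\<phi> r = y" if "r \<in> carrier T" "(r \<odot>\<^bsub>B\<^esub> b, y) \<in> G" for r y
      using that uniq[OF \<phi> that(2)] by (auto simp: I_def)
    have Ic: "r \<in> carrier T" if "r \<in> I" for r using that by (simp add: I_def)
    have addG: "((r \<oplus>\<^bsub>T\<^esub> s) \<odot>\<^bsub>B\<^esub> b, \<phi> r \<oplus>\<^bsub>M\<^esub> \<phi> s) \<in> G" if "r \<in> I" "s \<in> I" for r s
      using D(3)[OF \<phi>[OF that(1)] \<phi>[OF that(2)]] that b by (simp add: Ic B.smult_l_distr)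
    have multG: "((s \<otimes>\<^bsub>T\<^esub> r) \<odot>\<^bsub>B\<^esub> b, s \<odot>\<^bsub>M\<^esub> \<phi> r) \<in> G" if "s \<in> carrier T" "r \<in> I" for r s
      using D(4)[OF that(1) \<phi>[OF that(2)]] that b by (simp add: Ic B.smult_assoc)
    have "submodule I T (regular_module T)"
      unfolding T.left_ideal_iff
    proof (intro conjI ballI)
      show "I \<subseteq> carrier T" using Ic by blast
      have "(\<zero>\<^bsub>T\<^esub> \<odot>\<^bsub>B\<^esub> b, \<zero>\<^bsub>M\<^esub>) \<in> G" using zG b by simp
      then show "\<zero>\<^bsub>T\<^esub> \<in> I" unfolding I_def by blast
      show "r \<oplus>\<^bsub>T\<^esub> s \<in> I" if "r \<in> I" "s \<in> I" for r s
        using addG[OF that] B.R.a_closed[OF Ic[OF that(1)] Ic[OF that(2)]] unfolding I_def by blast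
      show "s \<otimes>\<^bsub>T\<^esub> r \<in> I" if "s \<in> carrier T" "r \<in> I" for s r
        using multG[OF that] B.R.m_closed[OF that(1) Ic[OF that(2)]] unfolding I_def by blast
    qed
    moreover have "\<phi> \<in> module_homs T ((regular_module T)\<lparr>carrier := I\<rparr>) M"
    proof (rule module_homsI)
      show "\<phi> r \<in> carrier M" if "r \<in> carrier ((regular_module T)\<lparr>carrier := I\<rparr>)" for r
        using that D(2)[OF \<phi>] by simp
      show "\<phi> (r \<oplus>\<^bsub>(regular_module T)\<lparr>carrier := I\<rparr>\<^esub> s) = \<phi> r \<oplus>\<^bsub>M\<^esub> \<phi> s"
        if "r \<in> carrier ((regular_module T)\<lparr>carrier := I\<rparr>)" "s \<in> carrier ((regular_module T)\<lparr>carrier := I\<rparr>)" for r s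
        using that \<phi>_eq[OF _ addG] by (simp add: Ic)
      show "\<phi> (s \<odot>\<^bsub>(regular_module T)\<lparr>carrier := I\<rparr>\<^esub> r) = s \<odot>\<^bsub>M\<^esub> \<phi> r"
        if "s \<in> carrier T" "r \<in> carrier ((regular_module T)\<lparr>carrier := I\<rparr>)" for r s
        using that \<phi>_eq[OF _ multG] by (simp add: Ic)
    qed
    ultimately obtain c where c: "c \<in> carrier M" "\<And>r. r \<in> I \<Longrightarrow> \<phi> r = r \<odot>\<^bsub>M\<^esub> c"
      using Baer by metis
    have compat: "y = r \<odot>\<^bsub>M\<^esub> c" if "r \<in> carrier T" "(r \<odot>\<^bsub>B\<^esub> b, y) \<in> G" for r y
      using \<phi>_eq[OF that] c(2)[of r] that by (auto simp: I_def)
    let ?H = "{(x \<oplus>\<^bsub>B\<^esub> r \<odot>\<^bsub>B\<^esub> b, y \<oplus>\<^bsub>M\<^esub> r \<odot>\<^bsub>M\<^esub> c) | x y r. (x, y) \<in> G \<and> r \<in> carrier T}"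
    have "G \<subseteq> ?H"
    proof (rule subrelI)
      fix x y assume xy: "(x, y) \<in> G"
      then have "x = x \<oplus>\<^bsub>B\<^esub> \<zero>\<^bsub>T\<^esub> \<odot>\<^bsub>B\<^esub> b" "y = y \<oplus>\<^bsub>M\<^esub> \<zero>\<^bsub>T\<^esub> \<odot>\<^bsub>M\<^esub> c"
        using D(1,2)[OF xy] b c(1) by simp_all
      then show "(x, y) \<in> ?H" using xy B.R.zero_closed by blast
    qed
    moreover have "?H \<in> \<A>"
      using partial_hom_graph_extend[OF B M PG b c(1) compat] \<open>G \<subseteq> ?H\<close> G(1) by (auto simp: \<A>_def)
    ultimately have "?H = G" using G(2) by blast
    moreover have "(\<zero>\<^bsub>B\<^esub> \<oplus>\<^bsub>B\<^esub> \<one>\<^bsub>T\<^esub> \<odot>\<^bsub>B\<^esub> b, \<zero>\<^bsub>M\<^esub> \<oplus>\<^bsub>M\<^esub> \<one>\<^bsub>T\<^esub> \<odot>\<^bsub>M\<^esub> c) \<in> ?H"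
      using zG B.R.one_closed by blast
    ultimately show ?thesis using b by (auto simp: B.smult_one)
  qed
  define g where "g x = (SOME y. (x, y) \<in> G)" for x
  have gG: "(x, g x) \<in> G" if "x \<in> carrier B" for x
    using dom[OF that] unfolding g_def by (rule someI_ex)
  have g_eq: "g x = y" if "(x, y) \<in> G" for x y
    using uniq[OF gG[OF D(1)[OF that]] that] .
  have "g \<in> module_homs T B M"
    using D(2)[OF gG] g_eq[OF D(3)[OF gG gG]] g_eq[OF D(4)[OF _ gG]] by (intro module_homsI) auto
  then show "\<exists>g\<in>module_homs T B M. \<forall>x\<in>K. g x = f x"
    using g_eq[OF KG] by blast
qed

text \<open>Left ideals of the opposite ring are right ideals of the quotient, so the hypothesis of
  Baer's criterion is exactly what \<open>right_ideal_hom_Quot\<close> delivers.\<close>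

lemma (in pp_compact_ring) right_self_injective_Quot:
  "right_self_injective TYPE('b) (S Quot jacobson_radical S)"
proof -
  let ?Q = "S Quot jacobson_radical S"
  let ?T = "opposite_ring ?Q"
  have Q: "ring ?Q" by (rule ideal.quotient_is_ring[OF jacobson_radical_ideal])
  interpret T: unital_ring ?T by (intro unital_ring.intro ring_opposite_ring Q)
  have T: "x \<otimes>\<^bsub>?T\<^esub> y = y \<otimes>\<^bsub>?Q\<^esub> x" "x \<oplus>\<^bsub>?T\<^esub> y = x \<oplus>\<^bsub>?Q\<^esub> y" "\<zero>\<^bsub>?T\<^esub> = \<zero>\<^bsub>?Q\<^esub>" for x y
    by (simp_all add: opposite_ring_def)
  show ?thesis
    unfolding right_self_injective_def
  proof (rule Baer_criterion)
    show "left_module ?T (regular_module ?T)" by (rule left_module_regular[OF T.ring_axioms])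
    fix I \<phi> assume I: "T.left_ideal I"
      and \<phi>: "\<phi> \<in> module_homs ?T ((regular_module ?T)\<lparr>carrier := I\<rparr>) (regular_module ?T)"
    note ID = T.left_idealD[OF I, unfolded T carrier_opposite_ring]
    have Ic: "\<And>x. x \<in> I \<Longrightarrow> x \<in> carrier ?Q" using ID(1) by blast
    have "\<exists>c\<in>carrier ?Q. \<forall>y\<in>I. \<phi> y = c \<otimes>\<^bsub>?Q\<^esub> y"
    proof (rule right_ideal_hom_Quot)
      show "I \<subseteq> carrier ?Q" "\<zero>\<^bsub>?Q\<^esub> \<in> I" by (rule ID)+
      show "a \<oplus>\<^bsub>?Q\<^esub> b \<in> I" if "a \<in> I" "b \<in> I" for a b using ID(3) that .
      show "a \<otimes>\<^bsub>?Q\<^esub> r \<in> I" if "a \<in> I" "r \<in> carrier ?Q" for a r using ID(4) that by simp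
      show "\<phi> a \<in> carrier ?Q" if "a \<in> I" for a
        using module_homs_closed[OF \<phi>, of a] that by simp
      show "\<phi> (a \<oplus>\<^bsub>?Q\<^esub> b) = \<phi> a \<oplus>\<^bsub>?Q\<^esub> \<phi> b" if "a \<in> I" "b \<in> I" for a b
        using module_homs_add[OF \<phi>, of a b] that by (simp add: T)
      show "\<phi> (a \<otimes>\<^bsub>?Q\<^esub> r) = \<phi> a \<otimes>\<^bsub>?Q\<^esub> r" if "a \<in> I" "r \<in> carrier ?Q" for a r
        using module_homs_smult[OF \<phi>, of r a] that by (simp add: T)
    qed
    then show "\<exists>c\<in>carrier (regular_module ?T). \<forall>r\<in>I. \<phi> r = r \<odot>\<^bsub>regular_module ?T\<^esub> c"
      by (simp add: T)
  qed
qed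

section \<open>Coneat quasi injective modules\<close>

subsection \<open>Coneat injective modules admit linear generalised limits\<close>

text \<open>The cardinality estimate behind the limits: the power of E over the index type
  \<open>'e \<Rightarrow> 'e\<close> fits into the test type. An argument f together with its value
  is coded by a set, and a functional by the set of all these codes.\<close>

lemma ex_inj_functionals:
  "\<exists>\<iota> :: (('e \<Rightarrow> 'e) \<Rightarrow> 'e) \<Rightarrow> ('r \<times> 'e \<times> nat) set set. inj \<iota>"
proof -
  have "infinite (UNIV :: ('e \<times> nat) set)"
    by (simp add: finite_prod)
  then have "|(UNIV :: ('e \<times> nat) set) \<times> (UNIV :: ('e \<times> nat) set)| =o |UNIV :: ('e \<times> nat) set|"
    by (rule card_of_Times_same_infinite)
  then obtain \<beta> :: "('e \<times> nat) \<times> ('e \<times> nat) \<Rightarrow> 'e \<times> nat"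
    where "bij_betw \<beta> (UNIV \<times> UNIV) UNIV"
    using card_of_ordIso by metis
  then have \<beta>: "inj \<beta>" by (simp add: bij_betw_def)
  \<comment> \<open>The factor \<open>nat\<close> makes \<open>'e \<times> nat\<close> infinite, so
    pairs can be coded in it even for finite \<open>'e\<close>. The component of type
    \<open>'r\<close> is a dummy.\<close>
  define \<theta> :: "'e \<Rightarrow> 'e \<Rightarrow> nat \<Rightarrow> 'r \<times> 'e \<times> nat"
    where "\<theta> a b n = (undefined, \<beta> ((a, n), (b, n)))" for a b n
  have \<theta>: "\<theta> a b n = \<theta> a' b' n' \<longleftrightarrow> a = a' \<and> b = b' \<and> n = n'" for a b n a' b' n'
    using inj_eq[OF \<beta>] by (auto simp: \<theta>_def)
  \<comment> \<open>Tag 0 marks the graph of f and tag 1 the value z, so both can be read off the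
    set.\<close>
  define enc where "enc f z = insert (\<theta> z z 1) (range (\<lambda>x. \<theta> x (f x) 0))" for f :: "'e \<Rightarrow> 'e" and z
  have enc: "f = f' \<and> z = z'" if eq: "enc f z = enc f' z'" for f f' z z'
  proof
    show "f = f'"
    proof
      fix x
      have "\<theta> x (f x) 0 \<in> enc f' z'" unfolding eq[symmetric] by (simp add: enc_def)
      then show "f x = f' x" by (auto simp: enc_def \<theta>)
    qed
    have "\<theta> z z 1 \<in> enc f' z'" unfolding eq[symmetric] by (simp add: enc_def)
    then show "z = z'" by (auto simp: enc_def \<theta>)
  qed
  have "inj (\<lambda>F. range (\<lambda>f. enc f (F f)))"
  proof (rule injI)
    fix F G :: "('e \<Rightarrow> 'e) \<Rightarrow> 'e"
    assume eq: "range (\<lambda>f. enc f (F f)) = range (\<lambda>f. enc f (G f))"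
    have "F f = G f" for f
    proof -
      from eq have "enc f (F f) \<in> range (\<lambda>f. enc f (G f))" by blast
      then obtain g where g: "enc f (F f) = enc g (G g)" by (rule rangeE)
      have fg: "f = g" using enc[OF g] by (rule conjunct1)
      have FG: "F f = G g" using enc[OF g] by (rule conjunct2)
      show "F f = G f" using FG unfolding fg by assumption
    qed
    then show "F = G" by (rule ext)
  qed
  then show ?thesis by blast
qed

text \<open>
  The test module is the power \<open>E\<^bsup>I\<^esup>\<close>, transported along \<open>\<iota>\<close>, with the submodule of eventually constant
  functions, which is locally split.
\<close>

lemma generalised_limit_exists:
  fixes R :: "'r ring" and E :: "('r, 'e) module" and F :: "'i filter"
    and \<iota> :: "('i \<Rightarrow> 'e) \<Rightarrow> ('r, 'e) test"
  assumes E: "coneat_injective R E" and F: "F \<noteq> bot" and \<iota>: "inj \<iota>"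
  obtains L where "\<And>f. (\<And>i. f i \<in> carrier E) \<Longrightarrow> L f \<in> carrier E"
    "\<And>f g. \<lbrakk>\<And>i. f i \<in> carrier E; \<And>i. g i \<in> carrier E\<rbrakk> \<Longrightarrow> L (\<lambda>i. f i \<oplus>\<^bsub>E\<^esub> g i) = L f \<oplus>\<^bsub>E\<^esub> L g"
    "\<And>r f. \<lbrakk>r \<in> carrier R; \<And>i. f i \<in> carrier E\<rbrakk> \<Longrightarrow> L (\<lambda>i. r \<odot>\<^bsub>E\<^esub> f i) = r \<odot>\<^bsub>E\<^esub> L f"
    "\<And>f m. \<lbrakk>\<And>i. f i \<in> carrier E; m \<in> carrier E; eventually (\<lambda>i. f i = m) F\<rbrakk> \<Longrightarrow> L f = m"
proof -
  have Emod: "left_module R E" using E by (simp add: coneat_injective_def)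
  interpret E: left_module R E by (rule Emod)
  define Pw where "Pw = {f :: 'i \<Rightarrow> 'e. \<forall>i. f i \<in> carrier E}"
  define \<kappa> where "\<kappa> = inv_into UNIV \<iota>"
  have \<kappa> [simp]: "\<kappa> (\<iota> f) = f" for f unfolding \<kappa>_def by (rule inv_f_f[OF \<iota>])
  define B :: "('r, ('r, 'e) test) module" where
    "B = \<lparr>carrier = \<iota> ` Pw, monoid.mult = undefined, monoid.one = undefined,
      ring.zero = \<iota> (\<lambda>_. \<zero>\<^bsub>E\<^esub>), ring.add = (\<lambda>x y. \<iota> (\<lambda>i. \<kappa> x i \<oplus>\<^bsub>E\<^esub> \<kappa> y i)),
      smult = (\<lambda>r x. \<iota> (\<lambda>i. r \<odot>\<^bsub>E\<^esub> \<kappa> x i))\<rparr>"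
  have B [simp]: "carrier B = \<iota> ` Pw" "\<zero>\<^bsub>B\<^esub> = \<iota> (\<lambda>_. \<zero>\<^bsub>E\<^esub>)"
    "\<iota> f \<oplus>\<^bsub>B\<^esub> \<iota> g = \<iota> (\<lambda>i. f i \<oplus>\<^bsub>E\<^esub> g i)" "r \<odot>\<^bsub>B\<^esub> \<iota> f = \<iota> (\<lambda>i. r \<odot>\<^bsub>E\<^esub> f i)" for f g r
    by (simp_all add: B_def)
  have "abelian_group B"
  proof (rule abelian_groupI)
    fix x assume "x \<in> carrier B"
    then obtain f where f: "x = \<iota> f" "\<And>i. f i \<in> carrier E" by (auto simp: Pw_def)
    then show "\<exists>y\<in>carrier B. y \<oplus>\<^bsub>B\<^esub> x = \<zero>\<^bsub>B\<^esub>"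
      by (intro bexI[of _ "\<iota> (\<lambda>i. \<ominus>\<^bsub>E\<^esub> f i)"]) (simp_all add: Pw_def E.l_neg)
  qed (auto simp: Pw_def E.a_ac)
  then have Bmod: "left_module R B"
    by (intro left_module.intro left_module_axioms.intro E.R.ring_axioms)
      (auto simp: Pw_def E.smult_l_distr E.smult_r_distr E.smult_assoc)
  interpret B: left_module R B by (rule Bmod)
  define D where "D = {f \<in> Pw. \<exists>m\<in>carrier E. eventually (\<lambda>i. f i = m) F}"
  \<comment> \<open>The description is proper because F is: two eventual values agree at some
    index.\<close>
  define ev where "ev f = (THE m. eventually (\<lambda>i. f i = m) F)" for f :: "'i \<Rightarrow> 'e"
  have ev: "ev f = m" if m: "eventually (\<lambda>i. f i = m) F" for f :: "'i \<Rightarrow> 'e" and m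
    unfolding ev_def
  proof (rule the_equality)
    show "eventually (\<lambda>i. f i = m) F" by (rule m)
    fix m' assume "eventually (\<lambda>i. f i = m') F"
    with m have "eventually (\<lambda>i. m' = m) F" by eventually_elim simp
    then show "m' = m" using eventually_happens'[OF F] by blast
  qed
  have DI: "f \<in> D" if "\<And>i. f i \<in> carrier E" "m \<in> carrier E" "eventually (\<lambda>i. f i = m) F" for f m
    using that by (auto simp: D_def Pw_def)
  have DE: "f \<in> Pw" "ev f \<in> carrier E" "eventually (\<lambda>i. f i = ev f) F" if f: "f \<in> D" for f
  proof -
    obtain m where m: "f \<in> Pw" "m \<in> carrier E" "eventually (\<lambda>i. f i = m) F"
      using f by (auto simp: D_def)
    then show "f \<in> Pw" "ev f \<in> carrier E" "eventually (\<lambda>i. f i = ev f) F" using ev[OF m(3)] by simp_all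
  qed
  have evadd: "eventually (\<lambda>i. f i \<oplus>\<^bsub>E\<^esub> g i = ev f \<oplus>\<^bsub>E\<^esub> ev g) F" if "f \<in> D" "g \<in> D" for f g
    using DE(3)[OF that(1)] DE(3)[OF that(2)] by eventually_elim simp
  have evsm: "eventually (\<lambda>i. r \<odot>\<^bsub>E\<^esub> f i = r \<odot>\<^bsub>E\<^esub> ev f) F" if "f \<in> D" for r f
    using DE(3)[OF that] by eventually_elim simp
  have DC: "f i \<in> carrier E" if "f \<in> D" for f i using DE(1)[OF that] by (simp add: Pw_def)
  have K: "submodule (\<iota> ` D) R B"
  proof (rule B.submoduleI)
    show "\<iota> ` D \<subseteq> carrier B" using DE(1) by auto
    have "(\<lambda>_. \<zero>\<^bsub>E\<^esub>) \<in> D" by (rule DI[of _ "\<zero>\<^bsub>E\<^esub>"]) simp_all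
    then show "\<zero>\<^bsub>B\<^esub> \<in> \<iota> ` D" by simp
    fix a b assume "a \<in> \<iota> ` D" "b \<in> \<iota> ` D"
    then obtain f g where fg: "a = \<iota> f" "b = \<iota> g" "f \<in> D" "g \<in> D" by auto
    have "(\<lambda>i. f i \<oplus>\<^bsub>E\<^esub> g i) \<in> D"
      by (rule DI[OF _ _ evadd[OF fg(3,4)]]) (simp_all add: DC DE(2) fg)
    then show "a \<oplus>\<^bsub>B\<^esub> b \<in> \<iota> ` D" by (simp add: fg)
  next
    fix r a assume r: "r \<in> carrier R" and "a \<in> \<iota> ` D"
    then obtain f where f: "a = \<iota> f" "f \<in> D" by auto
    have "(\<lambda>i. r \<odot>\<^bsub>E\<^esub> f i) \<in> D"
      by (rule DI[OF _ _ evsm[OF f(2)]]) (simp_all add: DC DE(2) f r)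
    then show "r \<odot>\<^bsub>B\<^esub> a \<in> \<iota> ` D" by (simp add: f)
  qed
  have split: "\<exists>\<psi>\<in>module_homs R B (B\<lparr>carrier := \<iota> ` D\<rparr>). \<forall>x\<in>T. \<psi> x = x"
    if T: "finite T" "T \<subseteq> \<iota> ` D" for T
  proof -
    \<comment> \<open>On the large set of indices where all members of T show their eventual values,
      \<open>\<psi>\<close> freezes every function at its value at one such index \<open>i0\<close>.
      The result is eventually constant, depends linearly on the function, and leaves the members of
      T unchanged.\<close>
    define P where "P i \<longleftrightarrow> (\<forall>x\<in>T. \<kappa> x i = ev (\<kappa> x))" for i
    have P: "eventually P F"
      unfolding P_def using T DE(3) by (intro eventually_ball_finite) auto
    then obtain i0 where i0: "P i0" using eventually_happens'[OF F] by blast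
    define \<psi> where "\<psi> x = \<iota> (\<lambda>i. if P i then \<kappa> x i0 else \<kappa> x i)" for x
    have \<psi>\<iota>: "\<psi> (\<iota> f) = \<iota> (\<lambda>i. if P i then f i0 else f i)" for f unfolding \<psi>_def \<kappa> by (rule refl)
    have "\<psi> \<in> module_homs R B (B\<lparr>carrier := \<iota> ` D\<rparr>)"
    proof (rule module_homsI)
      fix x assume "x \<in> carrier B"
      then obtain f where f: "x = \<iota> f" "\<And>i. f i \<in> carrier E" by (auto simp: Pw_def)
      have "eventually (\<lambda>i. (if P i then f i0 else f i) = f i0) F"
        using P by eventually_elim simp
      then have "(\<lambda>i. if P i then f i0 else f i) \<in> D"
        by (intro DI[of _ "f i0"]) (simp_all add: f)
      then show "\<psi> x \<in> carrier (B\<lparr>carrier := \<iota> ` D\<rparr>)" by (simp add: f \<psi>\<iota>)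
    next
      fix x y assume "x \<in> carrier B" "y \<in> carrier B"
      then obtain f g where fg: "x = \<iota> f" "y = \<iota> g" by auto
      have "(\<lambda>i. if P i then f i0 \<oplus>\<^bsub>E\<^esub> g i0 else f i \<oplus>\<^bsub>E\<^esub> g i) =
          (\<lambda>i. (if P i then f i0 else f i) \<oplus>\<^bsub>E\<^esub> (if P i then g i0 else g i))" by (rule ext) simp
      then show "\<psi> (x \<oplus>\<^bsub>B\<^esub> y) = \<psi> x \<oplus>\<^bsub>B\<lparr>carrier := \<iota> ` D\<rparr>\<^esub> \<psi> y" by (simp add: fg \<psi>\<iota>)
    next
      fix r x assume "x \<in> carrier B"
      then obtain f where f: "x = \<iota> f" by auto
      have "(\<lambda>i. if P i then r \<odot>\<^bsub>E\<^esub> f i0 else r \<odot>\<^bsub>E\<^esub> f i) =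
          (\<lambda>i. r \<odot>\<^bsub>E\<^esub> (if P i then f i0 else f i))" by (rule ext) simp
      then show "\<psi> (r \<odot>\<^bsub>B\<^esub> x) = r \<odot>\<^bsub>B\<lparr>carrier := \<iota> ` D\<rparr>\<^esub> \<psi> x" by (simp add: f \<psi>\<iota>)
    qed
    moreover have "\<psi> x = x" if x: "x \<in> T" for x
    proof -
      obtain f where f: "x = \<iota> f" using T(2) x by auto
      have "f i = ev f" if "P i" for i using that x by (auto simp: P_def f)
      then have "(\<lambda>i. if P i then f i0 else f i) = f" using i0 by (auto simp: fun_eq_iff)
      then show ?thesis by (simp add: f \<psi>\<iota>)
    qed
    ultimately show ?thesis by blast
  qed
  have KB: "coneat_submodule R (\<iota> ` D) B"
    unfolding coneat_submodule_def simple_right_module_def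
    by (intro conjI allI impI K, elim conjE) (rule short_exact_tensor[OF Bmod K _ split])
  have evhom: "(\<lambda>x. ev (\<kappa> x)) \<in> module_homs R (B\<lparr>carrier := \<iota> ` D\<rparr>) E"
    by (rule module_homsI) (auto simp: DE(2) intro!: ev evadd evsm)
  have "\<forall>f\<in>module_homs R (B\<lparr>carrier := \<iota> ` D\<rparr>) E. \<exists>g\<in>module_homs R B E. \<forall>x\<in>\<iota> ` D. g x = f x"
    using E[unfolded coneat_injective_def, THEN conjunct2, THEN spec, THEN spec, THEN mp, OF conjI, OF Bmod KB] .
  then obtain h where h: "h \<in> module_homs R B E" "\<forall>x\<in>\<iota> ` D. h x = ev (\<kappa> x)"
    using evhom by (rule bspec[elim_format]) (rule bexE)
  show thesis
  proof (rule that[of "\<lambda>f. h (\<iota> f)"])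
    show "h (\<iota> f) \<in> carrier E" if "\<And>i. f i \<in> carrier E" for f
      using module_homs_closed[OF h(1), of "\<iota> f"] that by (simp add: Pw_def)
    show "h (\<iota> (\<lambda>i. f i \<oplus>\<^bsub>E\<^esub> g i)) = h (\<iota> f) \<oplus>\<^bsub>E\<^esub> h (\<iota> g)"
      if "\<And>i. f i \<in> carrier E" "\<And>i. g i \<in> carrier E" for f g
      using module_homs_add[OF h(1), of "\<iota> f" "\<iota> g"] that by (simp add: Pw_def)
    show "h (\<iota> (\<lambda>i. r \<odot>\<^bsub>E\<^esub> f i)) = r \<odot>\<^bsub>E\<^esub> h (\<iota> f)"
      if "r \<in> carrier R" "\<And>i. f i \<in> carrier E" for r f
      using module_homs_smult[OF h(1), of r "\<iota> f"] that by (simp add: Pw_def)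
    show "h (\<iota> f) = m" if "\<And>i. f i \<in> carrier E" "m \<in> carrier E" "eventually (\<lambda>i. f i = m) F" for f m
      using bspec[OF h(2) imageI[OF DI[OF that]]] ev[OF that(3)] by simp
  qed
qed

subsection \<open>Endomorphism rings\<close>

lemma endo_ring_simps:
  "carrier (endo_ring R M) = module_homs R M M \<inter> extensional (carrier M)"
  "\<one>\<^bsub>endo_ring R M\<^esub> = (\<lambda>x\<in>carrier M. x)" "\<zero>\<^bsub>endo_ring R M\<^esub> = (\<lambda>x\<in>carrier M. \<zero>\<^bsub>M\<^esub>)"
  "f \<otimes>\<^bsub>endo_ring R M\<^esub> g = compose (carrier M) f g"
  "f \<oplus>\<^bsub>endo_ring R M\<^esub> g = (\<lambda>x\<in>carrier M. f x \<oplus>\<^bsub>M\<^esub> g x)"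
  by (simp_all add: endo_ring_def)

lemma endo_ringI:
  assumes "\<And>x. x \<in> carrier M \<Longrightarrow> f x \<in> carrier M"
    and "\<And>x y. \<lbrakk>x \<in> carrier M; y \<in> carrier M\<rbrakk> \<Longrightarrow> f (x \<oplus>\<^bsub>M\<^esub> y) = f x \<oplus>\<^bsub>M\<^esub> f y"
    and "\<And>r x. \<lbrakk>r \<in> carrier R; x \<in> carrier M\<rbrakk> \<Longrightarrow> f (r \<odot>\<^bsub>M\<^esub> x) = r \<odot>\<^bsub>M\<^esub> f x"
    and "f \<in> extensional (carrier M)"
  shows "f \<in> carrier (endo_ring R M)"
  unfolding endo_ring_simps using assms by (intro IntI module_homsI) auto

lemma endo_ringD:
  assumes "f \<in> carrier (endo_ring R M)"
  shows "x \<in> carrier M \<Longrightarrow> f x \<in> carrier M"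
    and "\<lbrakk>x \<in> carrier M; y \<in> carrier M\<rbrakk> \<Longrightarrow> f (x \<oplus>\<^bsub>M\<^esub> y) = f x \<oplus>\<^bsub>M\<^esub> f y"
    and "\<lbrakk>r \<in> carrier R; x \<in> carrier M\<rbrakk> \<Longrightarrow> f (r \<odot>\<^bsub>M\<^esub> x) = r \<odot>\<^bsub>M\<^esub> f x"
    and "f \<in> extensional (carrier M)"
  using assms module_homsD[of f R M M] by (simp_all add: endo_ring_simps)

lemma endo_ring_eqI:
  assumes "f \<in> carrier (endo_ring R M)" "g \<in> carrier (endo_ring R M)"
    and "\<And>x. x \<in> carrier M \<Longrightarrow> f x = g x"
  shows "f = g"
  using extensionalityI[OF endo_ringD(4)[OF assms(1)] endo_ringD(4)[OF assms(2)]] assms(3) by blast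

lemma ring_endo_ring:
  assumes "left_module R M"
  shows "ring (endo_ring R M)"
proof -
  interpret left_module R M by fact
  let ?S = "endo_ring R M"
  have add: "f \<oplus>\<^bsub>?S\<^esub> g \<in> carrier ?S" if "f \<in> carrier ?S" "g \<in> carrier ?S" for f g
    using endo_ringD[OF that(1)] endo_ringD[OF that(2)]
    by (intro endo_ringI) (auto simp: endo_ring_simps(5) M.a_ac smult_r_distr)
  have mult: "f \<otimes>\<^bsub>?S\<^esub> g \<in> carrier ?S" if "f \<in> carrier ?S" "g \<in> carrier ?S" for f g
    using endo_ringD[OF that(1)] endo_ringD[OF that(2)]
    by (intro endo_ringI) (auto simp: endo_ring_simps(4) compose_def)
  have zero: "\<zero>\<^bsub>?S\<^esub> \<in> carrier ?S" by (rule endo_ringI) (auto simp: endo_ring_simps(3))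
  have one: "\<one>\<^bsub>?S\<^esub> \<in> carrier ?S" by (rule endo_ringI) (auto simp: endo_ring_simps(2))
  note [simp] = endo_ring_simps(2-5) compose_def endo_ringD(1)
  have inv: "\<exists>g\<in>carrier ?S. g \<oplus>\<^bsub>?S\<^esub> f = \<zero>\<^bsub>?S\<^esub>" if f: "f \<in> carrier ?S" for f
  proof (rule bexI)
    note D = endo_ringD[OF f]
    \<comment> \<open>Negation is written as the scalar -1; it is linear because -1 is central in
      R.\<close>
    let ?g = "\<lambda>x\<in>carrier M. (\<ominus>\<^bsub>R\<^esub> \<one>\<^bsub>R\<^esub>) \<odot>\<^bsub>M\<^esub> f x"
    show g: "?g \<in> carrier ?S"
    proof (rule endo_ringI)
      fix r x assume r: "r \<in> carrier R" and x: "x \<in> carrier M"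
      have "(\<ominus>\<^bsub>R\<^esub> \<one>\<^bsub>R\<^esub>) \<otimes>\<^bsub>R\<^esub> r = r \<otimes>\<^bsub>R\<^esub> (\<ominus>\<^bsub>R\<^esub> \<one>\<^bsub>R\<^esub>)"
        using r by (simp add: R.l_minus R.r_minus)
      then have "(\<ominus>\<^bsub>R\<^esub> \<one>\<^bsub>R\<^esub>) \<odot>\<^bsub>M\<^esub> (r \<odot>\<^bsub>M\<^esub> f x) = r \<odot>\<^bsub>M\<^esub> ((\<ominus>\<^bsub>R\<^esub> \<one>\<^bsub>R\<^esub>) \<odot>\<^bsub>M\<^esub> f x)"
        using r D(1)[OF x] by (simp flip: smult_assoc)
      then show "?g (r \<odot>\<^bsub>M\<^esub> x) = r \<odot>\<^bsub>M\<^esub> ?g x" using D(3) r x by simp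
    qed (auto simp: D(1,2) smult_r_distr)
    have "x \<in> carrier M \<Longrightarrow> (\<ominus>\<^bsub>R\<^esub> \<one>\<^bsub>R\<^esub>) \<odot>\<^bsub>M\<^esub> f x \<oplus>\<^bsub>M\<^esub> f x = \<zero>\<^bsub>M\<^esub>" for x
      using D(1) by (simp add: smult_minus_one M.l_neg)
    then show "?g \<oplus>\<^bsub>?S\<^esub> f = \<zero>\<^bsub>?S\<^esub>" by auto
  qed
  have "abelian_group ?S"
  proof (rule abelian_groupI)
    fix f g h assume *: "f \<in> carrier ?S" "g \<in> carrier ?S" "h \<in> carrier ?S"
    show "f \<oplus>\<^bsub>?S\<^esub> g \<oplus>\<^bsub>?S\<^esub> h = f \<oplus>\<^bsub>?S\<^esub> (g \<oplus>\<^bsub>?S\<^esub> h)"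
      using * by (intro endo_ring_eqI[OF add[OF add] add[OF _ add]]) (auto simp: M.a_assoc)
  next
    fix f g assume *: "f \<in> carrier ?S" "g \<in> carrier ?S"
    show "f \<oplus>\<^bsub>?S\<^esub> g = g \<oplus>\<^bsub>?S\<^esub> f"
      using * by (intro endo_ring_eqI[OF add add]) (auto simp: M.a_comm)
  next
    fix f assume *: "f \<in> carrier ?S"
    show "\<zero>\<^bsub>?S\<^esub> \<oplus>\<^bsub>?S\<^esub> f = f"
      using * zero by (intro endo_ring_eqI[OF add[OF zero] *]) auto
  qed (use add zero inv in auto)
  moreover have "Group.monoid ?S"
  proof (rule monoidI)
    fix f g h assume *: "f \<in> carrier ?S" "g \<in> carrier ?S" "h \<in> carrier ?S"
    show "f \<otimes>\<^bsub>?S\<^esub> g \<otimes>\<^bsub>?S\<^esub> h = f \<otimes>\<^bsub>?S\<^esub> (g \<otimes>\<^bsub>?S\<^esub> h)"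
      using * by (intro endo_ring_eqI[OF mult[OF mult] mult[OF _ mult]]) auto
  next
    fix f assume *: "f \<in> carrier ?S"
    show "\<one>\<^bsub>?S\<^esub> \<otimes>\<^bsub>?S\<^esub> f = f" using * by (intro endo_ring_eqI[OF mult[OF one] *]) auto
    show "f \<otimes>\<^bsub>?S\<^esub> \<one>\<^bsub>?S\<^esub> = f" using * by (intro endo_ring_eqI[OF mult[OF _ one] *]) auto
  qed (use mult one in auto)
  ultimately show ?thesis
  proof (rule ringI)
    fix f g h assume *: "f \<in> carrier ?S" "g \<in> carrier ?S" "h \<in> carrier ?S"
    show "(f \<oplus>\<^bsub>?S\<^esub> g) \<otimes>\<^bsub>?S\<^esub> h = f \<otimes>\<^bsub>?S\<^esub> h \<oplus>\<^bsub>?S\<^esub> g \<otimes>\<^bsub>?S\<^esub> h"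
      using * by (intro endo_ring_eqI[OF mult[OF add] add[OF mult mult]]) auto
    show "h \<otimes>\<^bsub>?S\<^esub> (f \<oplus>\<^bsub>?S\<^esub> g) = h \<otimes>\<^bsub>?S\<^esub> f \<oplus>\<^bsub>?S\<^esub> h \<otimes>\<^bsub>?S\<^esub> g"
      using * by (intro endo_ring_eqI[OF mult[OF _ add] add[OF mult mult]]) (auto simp: endo_ringD(2))
  qed
qed

text \<open>
  A solution of a finitely solvable system is a generalised limit of approximate solutions. It maps \<open>A\<close>
  into \<open>A\<close> because \<open>A\<close> is fully invariant in the envelope.
\<close>

lemma pp_compact_endo_ring:
  fixes R :: "'r ring" and A :: "('r, 'a) module"
  assumes "coneat_quasi_injective TYPE('e) R A"
  shows "pp_compact_ring (endo_ring R A)"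
proof -
  let ?S = "endo_ring R A"
  have A: "left_module R A" and "\<exists>(E :: ('r, 'e) module) u. coneat_injective_envelope R A E u \<and>
      (\<forall>f\<in>module_homs R E E. f ` (u ` carrier A) \<subseteq> u ` carrier A)"
    using assms unfolding coneat_quasi_injective_def by simp_all
  then obtain E :: "('r, 'e) module" and u where env: "coneat_injective_envelope R A E u"
    and inv: "\<forall>f\<in>module_homs R E E. f ` (u ` carrier A) \<subseteq> u ` carrier A"
    by (elim exE conjE)
  note env' = env[unfolded coneat_injective_envelope_def]
  have E: "coneat_injective R E" and u: "u \<in> module_homs R A E" and u_inj: "inj_on u (carrier A)"
    using env' by simp_all
  have ext: "\<exists>h\<in>module_homs R E E. \<forall>x\<in>carrier A. h (u x) = g x" if "g \<in> module_homs R A E" for g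
    using env' E that by simp
  have Emod: "left_module R E" using E by (simp add: coneat_injective_def)
  interpret E: left_module R E by (rule Emod)
  interpret A: left_module R A by (rule A)
  interpret S: unital_ring ?S by (intro unital_ring.intro ring_endo_ring A)
  note uD = module_homsD[OF u]
  define v where "v = inv_into (carrier A) u"
  have vu [simp]: "v (u m) = m" if "m \<in> carrier A" for m
    unfolding v_def using u_inj that by (rule inv_into_f_f)
  obtain \<iota> :: "(('e \<Rightarrow> 'e) \<Rightarrow> 'e) \<Rightarrow> ('r, 'e) test" where \<iota>: "inj \<iota>"
    using ex_inj_functionals by blast
  \<comment> \<open>The envelope property extends g to an endomorphism of E, and full invariance
    keeps the image of A under it inside A.\<close>
  have corestrict: "\<exists>x\<in>carrier ?S. \<forall>m\<in>carrier A. u (x m) = g m" if g: "g \<in> module_homs R A E" for g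
  proof -
    obtain h where h: "h \<in> module_homs R E E" "\<And>m. m \<in> carrier A \<Longrightarrow> h (u m) = g m"
      using ext[OF g] by blast
    have "\<exists>m'\<in>carrier A. u m' = g m" if m: "m \<in> carrier A" for m
    proof -
      have "h (u m) \<in> u ` carrier A" using bspec[OF inv h(1)] m by blast
      then show ?thesis using h(2)[OF m] by auto
    qed
    then obtain x where x: "\<And>m. m \<in> carrier A \<Longrightarrow> x m \<in> carrier A \<and> u (x m) = g m" by metis
    have eqI: "a = b" if "a \<in> carrier A" "b \<in> carrier A" "u a = u b" for a b
      using u_inj that by (auto dest: inj_onD)
    have "restrict x (carrier A) \<in> carrier ?S"
    proof (rule endo_ringI)
      fix m m' assume m: "m \<in> carrier A" "m' \<in> carrier A"
      have "x (m \<oplus>\<^bsub>A\<^esub> m') = x m \<oplus>\<^bsub>A\<^esub> x m'"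
        using m x module_homs_add[OF g] uD by (intro eqI) auto
      then show "restrict x (carrier A) (m \<oplus>\<^bsub>A\<^esub> m') = restrict x (carrier A) m \<oplus>\<^bsub>A\<^esub> restrict x (carrier A) m'"
        using m by simp
    next
      fix r m assume r: "r \<in> carrier R" and m: "m \<in> carrier A"
      have "x (r \<odot>\<^bsub>A\<^esub> m) = r \<odot>\<^bsub>A\<^esub> x m"
        using m r x module_homs_smult[OF g] uD by (intro eqI) auto
      then show "restrict x (carrier A) (r \<odot>\<^bsub>A\<^esub> m) = r \<odot>\<^bsub>A\<^esub> restrict x (carrier A) m"
        using m r by simp
    qed (use x in auto)
    then show ?thesis using x by (intro bexI[of _ "restrict x (carrier A)"]) auto
  qed
  show ?thesis
  proof (intro pp_compact_ring.intro pp_compact_ring_axioms.intro S.unital_ring_axioms)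
    fix \<C> assume pp: "\<And>Q. Q \<in> \<C> \<Longrightarrow> pp_coset ?S Q"
      and fip: "\<And>\<F>. \<lbrakk>finite \<F>; \<F> \<subseteq> \<C>\<rbrakk> \<Longrightarrow> \<exists>x\<in>carrier ?S. \<forall>Q\<in>\<F>. x \<in> Q"
    \<comment> \<open>The index type is built from \<open>'e\<close> alone to fit the test type of
      E. Each endomorphism of A is decoded from some i, but not every i decodes to an
      endomorphism.\<close>
    define dec where "dec i = (\<lambda>m\<in>carrier A. v (i (u m)))" for i :: "'e \<Rightarrow> 'e"
    have dec: "\<exists>i. dec i = s" if s: "s \<in> carrier ?S" for s
    proof
      show "dec (\<lambda>z. u (s (v z))) = s"
        using endo_ringD(1,4)[OF s] by (intro extensionalityI[of _ "carrier A"]) (auto simp: dec_def)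
    qed
    \<comment> \<open>The finite intersection property makes this filter proper. Inserting the
      carrier ensures that eventually \<open>dec i\<close> is an endomorphism.\<close>
    define F where "F = (INF Q\<in>insert (carrier ?S) \<C>. principal {i. dec i \<in> Q})"
    have F: "F \<noteq> bot"
      unfolding F_def
    proof (rule INF_filter_not_bot)
      fix \<F> assume \<F>: "\<F> \<subseteq> insert (carrier ?S) \<C>" "finite \<F>"
      then obtain x where x: "x \<in> carrier ?S" "\<forall>Q\<in>\<F> - {carrier ?S}. x \<in> Q"
        using fip[of "\<F> - {carrier ?S}"] by auto
      obtain i where "dec i = x" using dec[OF x(1)] by blast
      then have "i \<in> (\<Inter>Q\<in>\<F>. {i. dec i \<in> Q})" using x by auto
      then show "(INF Q\<in>\<F>. principal {i. dec i \<in> Q}) \<noteq> bot"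
        using \<F>(2) by (subst INF_principal_finite) (auto simp: principal_eq_bot_iff)
    qed
    have evQ: "eventually (\<lambda>i. dec i \<in> Q) F" if "Q \<in> insert (carrier ?S) \<C>" for Q
    proof -
      have "F \<le> principal {i. dec i \<in> Q}" unfolding F_def using that by (rule INF_lower)
      then show ?thesis by (simp add: le_principal)
    qed
    obtain L where L: "\<And>f. (\<And>i. f i \<in> carrier E) \<Longrightarrow> L f \<in> carrier E"
      "\<And>f g. \<lbrakk>\<And>i. f i \<in> carrier E; \<And>i. g i \<in> carrier E\<rbrakk> \<Longrightarrow> L (\<lambda>i. f i \<oplus>\<^bsub>E\<^esub> g i) = L f \<oplus>\<^bsub>E\<^esub> L g"
      "\<And>r f. \<lbrakk>r \<in> carrier R; \<And>i. f i \<in> carrier E\<rbrakk> \<Longrightarrow> L (\<lambda>i. r \<odot>\<^bsub>E\<^esub> f i) = r \<odot>\<^bsub>E\<^esub> L f"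
      "\<And>f m. \<lbrakk>\<And>i. f i \<in> carrier E; m \<in> carrier E; eventually (\<lambda>i. f i = m) F\<rbrakk> \<Longrightarrow> L f = m"
      using generalised_limit_exists[OF E F \<iota>] by blast
    have lim: "\<exists>x\<in>carrier ?S. \<forall>m\<in>carrier A. u (x m) = L (\<lambda>i. u (Z i m))"
      if Z: "\<And>i. Z i \<in> carrier ?S" for Z
    proof (rule corestrict, rule module_homsI)
      note ZD = endo_ringD[OF Z]
      show "L (\<lambda>i. u (Z i m)) \<in> carrier E" if "m \<in> carrier A" for m
        using that by (intro L(1) uD ZD)
      show "L (\<lambda>i. u (Z i (m \<oplus>\<^bsub>A\<^esub> m'))) = L (\<lambda>i. u (Z i m)) \<oplus>\<^bsub>E\<^esub> L (\<lambda>i. u (Z i m'))"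
        if "m \<in> carrier A" "m' \<in> carrier A" for m m'
        using that by (subst L(2)[symmetric]) (auto intro!: uD ZD simp: ZD(1,2) uD(2))
      show "L (\<lambda>i. u (Z i (r \<odot>\<^bsub>A\<^esub> m))) = r \<odot>\<^bsub>E\<^esub> L (\<lambda>i. u (Z i m))"
        if "r \<in> carrier R" "m \<in> carrier A" for r m
        using that by (subst L(3)[symmetric]) (auto intro!: uD ZD simp: ZD(1,3) uD(3))
    qed
    \<comment> \<open>The laws of L require values in E at every index, hence the default 0 where
      decoding fails; eventually it does not occur.\<close>
    define Z where "Z i = (if dec i \<in> carrier ?S then dec i else \<zero>\<^bsub>?S\<^esub>)" for i
    have Z: "Z i \<in> carrier ?S" for i by (simp add: Z_def)
    have evZ: "eventually (\<lambda>i. Z i \<in> Q) F" if "Q \<in> \<C>" for Q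
      using evQ[OF insertI1] evQ[OF insertI2[OF that]] by eventually_elim (auto simp: Z_def)
    obtain x where x0: "x \<in> carrier ?S" "\<forall>m\<in>carrier A. u (x m) = L (\<lambda>i. u (Z i m))"
      by (rule bexE[OF lim[OF Z]])
    note x = x0(1) bspec[OF x0(2)]
    have u_eqI: "f = g" if fg: "f \<in> carrier ?S" "g \<in> carrier ?S"
      and eq: "\<And>m. m \<in> carrier A \<Longrightarrow> u (f m) = u (g m)" for f g
    proof (rule endo_ring_eqI[OF fg])
      show "f m = g m" if "m \<in> carrier A" for m
        using that by (intro inj_onD[OF u_inj eq] endo_ringD(1)[OF fg(1)] endo_ringD(1)[OF fg(2)])
    qed
    have "x \<in> Q" if Q: "Q \<in> \<C>" for Q
    proof -
      obtain a b where a: "a \<in> carrier ?S" and b: "b \<in> carrier ?S"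
        and cases: "Q = {b \<oplus>\<^bsub>?S\<^esub> y \<otimes>\<^bsub>?S\<^esub> a | y. y \<in> carrier ?S} \<or> Q = {s \<in> carrier ?S. s \<otimes>\<^bsub>?S\<^esub> a = b}"
        using pp[OF Q] unfolding pp_coset_def by blast
      note aD = endo_ringD[OF a] and bD = endo_ringD[OF b]
      from cases show ?thesis
      proof
        assume QP: "Q = {b \<oplus>\<^bsub>?S\<^esub> y \<otimes>\<^bsub>?S\<^esub> a | y. y \<in> carrier ?S}"
        \<comment> \<open>Approximate solutions in Q come with witnesses, and the limit of the
          witnesses is a witness for the limit. Where \<open>Z i\<close> lies outside Q, any
          endomorphism will do.\<close>
        define Y where "Y i = (SOME y. y \<in> carrier ?S \<and> (Z i \<in> Q \<longrightarrow> Z i = b \<oplus>\<^bsub>?S\<^esub> y \<otimes>\<^bsub>?S\<^esub> a))" for i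
        have "\<exists>y. y \<in> carrier ?S \<and> (Z i \<in> Q \<longrightarrow> Z i = b \<oplus>\<^bsub>?S\<^esub> y \<otimes>\<^bsub>?S\<^esub> a)" for i
          unfolding QP using S.zero_closed by blast
        then have Y: "Y i \<in> carrier ?S" "Z i \<in> Q \<Longrightarrow> Z i = b \<oplus>\<^bsub>?S\<^esub> Y i \<otimes>\<^bsub>?S\<^esub> a" for i
          using someI_ex[of "\<lambda>y. y \<in> carrier ?S \<and> (Z i \<in> Q \<longrightarrow> Z i = b \<oplus>\<^bsub>?S\<^esub> y \<otimes>\<^bsub>?S\<^esub> a)"]
          unfolding Y_def by blast+
        obtain y where y0: "y \<in> carrier ?S" "\<forall>m\<in>carrier A. u (y m) = L (\<lambda>i. u (Y i m))"
          by (rule bexE[OF lim[OF Y(1)]])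
        note y = y0(1) bspec[OF y0(2)]
        have "x = b \<oplus>\<^bsub>?S\<^esub> y \<otimes>\<^bsub>?S\<^esub> a"
        proof (rule u_eqI[OF x(1)])
          show "b \<oplus>\<^bsub>?S\<^esub> y \<otimes>\<^bsub>?S\<^esub> a \<in> carrier ?S" using a b y(1) by simp
          fix m assume m: "m \<in> carrier A"
          have c: "u (Z i m) \<in> carrier E" "u (Y i (a m)) \<in> carrier E" for i
            using uD(1) endo_ringD(1)[OF Z] endo_ringD(1)[OF Y(1)] aD(1) m by auto
          \<comment> \<open>L can be evaluated on eventually constant functions. Neither term need
            be of this kind, but their difference is eventually \<open>u (b m)\<close>; linearity of
            L then separates the terms.\<close>
          let ?d = "\<lambda>i. u (Z i m) \<oplus>\<^bsub>E\<^esub> (\<ominus>\<^bsub>R\<^esub> \<one>\<^bsub>R\<^esub>) \<odot>\<^bsub>E\<^esub> u (Y i (a m))"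
          have "eventually (\<lambda>i. ?d i = u (b m)) F"
            using evZ[OF Q]
          proof eventually_elim
            case (elim i)
            have "Z i m = b m \<oplus>\<^bsub>A\<^esub> Y i (a m)"
              using Y(2)[OF elim] m by (simp add: endo_ring_simps compose_def)
            then have "u (Z i m) = u (b m) \<oplus>\<^bsub>E\<^esub> u (Y i (a m))"
              using uD(2) bD(1)[OF m] endo_ringD(1)[OF Y(1)] aD(1)[OF m] by simp
            then show ?case
              using c(2)[of i] uD(1)[OF bD(1)[OF m]] by (simp add: E.smult_minus_one E.a_assoc E.r_neg)
          qed
          then have "L ?d = u (b m)"
            using c uD(1)[OF bD(1)[OF m]] by (intro L(4)) auto
          moreover have "L ?d = L (\<lambda>i. u (Z i m)) \<oplus>\<^bsub>E\<^esub> L (\<lambda>i. (\<ominus>\<^bsub>R\<^esub> \<one>\<^bsub>R\<^esub>) \<odot>\<^bsub>E\<^esub> u (Y i (a m)))"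
            using c by (intro L(2)) auto
          moreover have "L (\<lambda>i. (\<ominus>\<^bsub>R\<^esub> \<one>\<^bsub>R\<^esub>) \<odot>\<^bsub>E\<^esub> u (Y i (a m))) = (\<ominus>\<^bsub>R\<^esub> \<one>\<^bsub>R\<^esub>) \<odot>\<^bsub>E\<^esub> L (\<lambda>i. u (Y i (a m)))"
            using c by (intro L(3)) auto
          ultimately have "u (x m) \<oplus>\<^bsub>E\<^esub> \<ominus>\<^bsub>E\<^esub> u (y (a m)) = u (b m)"
            using x(2)[OF m] y(2)[OF aD(1)[OF m]] uD(1)[OF endo_ringD(1)[OF y(1) aD(1)[OF m]]]
            by (simp add: E.smult_minus_one)
          then have "u (b m) \<oplus>\<^bsub>E\<^esub> u (y (a m)) = u (x m)"
            using uD(1)[OF endo_ringD(1)[OF x(1) m]] uD(1)[OF endo_ringD(1)[OF y(1) aD(1)[OF m]]]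
            by (auto simp: E.a_assoc E.l_neg dest: sym)
          then show "u (x m) = u ((b \<oplus>\<^bsub>?S\<^esub> y \<otimes>\<^bsub>?S\<^esub> a) m)"
            using m uD(2)[OF bD(1)[OF m] endo_ringD(1)[OF y(1) aD(1)[OF m]]]
            by (simp add: endo_ring_simps compose_def)
        qed
        then show "x \<in> Q" unfolding QP using y(1) by blast
      next
        assume QP: "Q = {s \<in> carrier ?S. s \<otimes>\<^bsub>?S\<^esub> a = b}"
        have "x \<otimes>\<^bsub>?S\<^esub> a = b"
        proof (rule u_eqI[OF _ b])
          show "x \<otimes>\<^bsub>?S\<^esub> a \<in> carrier ?S" using x(1) a by simp
          fix m assume m: "m \<in> carrier A"
          have "eventually (\<lambda>i. u (Z i (a m)) = u (b m)) F"
            using evZ[OF Q]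
          proof eventually_elim
            case (elim i)
            then have "compose (carrier A) (Z i) a = b" by (simp add: QP endo_ring_simps)
            then have "Z i (a m) = b m" using m by (auto simp: compose_def)
            then show ?case by simp
          qed
          then have "L (\<lambda>i. u (Z i (a m))) = u (b m)"
            using uD(1) endo_ringD(1)[OF Z] aD(1)[OF m] bD(1)[OF m] by (intro L(4)) auto
          then show "u ((x \<otimes>\<^bsub>?S\<^esub> a) m) = u (b m)"
            using x(2)[OF aD(1)[OF m]] m by (simp add: endo_ring_simps compose_def)
        qed
        then show "x \<in> Q" unfolding QP using x(1) by simp
      qed
    qed
    then show "\<exists>x\<in>carrier ?S. \<forall>Q\<in>\<C>. x \<in> Q" using x(1) by blast
  qed
qed

theorem corollary3p13:
  fixes R :: "'r ring" and A :: "('r, 'a) module"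
  assumes "ring R"
    and "coneat_quasi_injective TYPE('e) R A"
  shows "von_neumann_regular (endo_ring R A Quot jacobson_radical (endo_ring R A)) \<and>
    right_self_injective TYPE('b) (endo_ring R A Quot jacobson_radical (endo_ring R A))"
proof -
  interpret pp_compact_ring "endo_ring R A"
    by (rule pp_compact_endo_ring[OF assms(2)])
  show ?thesis
    using von_neumann_regular_Quot right_self_injective_Quot by blast
qed

end
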